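(* A repetitive Meyer set $\Lambda$ in $\mathbb{R}^d$ is an inter-model set with Euclidean internal space if and only if $\operatorname{rank}(\langle\Lambda-\Lambda\rangle)>d$ and the address system of $\Lambda$ is a topological factor of $(\Omega_\Lambda,\mathbb{R}^d)$ such that there is one point (of the address system) with a unique preimage under the factor map. In particular, if $\Lambda$ is an inter-model set with Euclidean internal space, then the address system of $\Lambda$ is the maximal equicontinuous factor of $(\Omega_\Lambda,\mathbb{R}^d)$.
   Context: Delone sets and hull. A Delone set in $\mathbb{R}^d$ is a subset that is uniformly discrete (for some $r>0$ every closed ball of radius $r$ contains at most one of its points) and relatively dense (for some $R>0$ every closed ball of radius $R$ contains at least one of its points). A $\rho$-patch of $\Lambda$ centered at $t\in\mathbb{R}^d$ is $\Lambda\cap\overline{B(t,\rho)}$. $\Lambda$ is repetitive if for each $\rho>0$ there is $M>0$ such that every closed ball of radius $M$ contains the center of a translated copy of every $\rho$-patch of $\Lambda$. A Meyer set is a Delone set $\Lambda$ such that $\Lambda-\Lambda$ is a Delone set. $\langle A\rangle$ is the subgroup of $\mathbb{R}^d$ generated by $A$; for a repetitive Meyer set, $\langle\Lambda-\Lambda\rangle$ is a finitely generated free Abelian group. The hull $\Omega_\Lambda$ is the set of all Delone sets whose $\rho$-patches, for every $\rho>0$, are $\rho$-patches of $\Lambda$ up to translation. A basis of neighborhoods of $\Lambda'\in\Omega_\Lambda$ is given by the sets $\{\widetilde\Lambda-t : \widetilde\Lambda\in\Omega_\Lambda,\ \widetilde\Lambda\cap\overline{B(0,R)}=\Lambda'\cap\overline{B(0,R)},\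 t\in B(0,\varepsilon)\}$, $0<\varepsilon<R/2$; then $\Omega_\Lambda$ is compact metrizable and $\mathbb{R}^d$ acts continuously by $(\Lambda',t)\mapsto\Lambda'-t$. The transversal is $\Xi_\Lambda=\{\Lambda'\in\Omega_\Lambda:0\in\Lambda'\}$. Address system. Let $s=\operatorname{rank}\langle\Lambda-\Lambda\rangle$, let $\mathcal{B}$ be a basis of $\langle\Lambda-\Lambda\rangle$ and $\varphi:\langle\Lambda-\Lambda\rangle\to\mathbb{Z}^s$ the coordinate map in this basis. There is a unique linear map $\ell:\mathbb{R}^d\to\mathbb{R}^s$ for which there is $C>0$ with $\|\varphi(t)-\ell(t)\|\le C$ for all $\Lambda_0\in\Xi_\Lambda$ and $t\in\Lambda_0$. The address system of $\Lambda$ is the torus $\mathbb{T}^s=\mathbb{R}^s/\mathbb{Z}^s$ with the $\mathbb{R}^d$-action $(w,t)\mapsto w+[\ell(t)]_{\mathbb{Z}^s}$. There is a continuous map (the address homomorphism) $\pi_{\mathrm{Ad}}:\Omega_\Lambda\to\mathbb{T}^s$ with $\pi_{\mathrm{Ad}}(\Lambda'-t)=\pi_{\mathrm{Ad}}(\Lambda')+[\ell(t)]_{\mathbb{Z}^s}$ for all $\Lambda'\in\Omega_\Lambda$, $t\in\mathbb{R}^d$. The address system and $\pi_{\mathrm{Ad}}$ are well defined up to topological conjugacy. The address system is a topological factor of $(\Omega_\Lambda,\mathbb{R}^d)$ when $\pi_{\mathrm{Ad}}$ is surjective, and then $\pi_{\mathrm{Ad}}$ is the factor map. The maximal equicontinuous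 factor of a dynamical system is a topological factor with equicontinuous action such that every other equicontinuous factor is a topological factor of it; it is unique up to topological conjugacy. Inter-model sets. A Euclidean cut and project scheme (CPS) over $\mathbb{R}^d$ is a triple $(\mathbb{R}^n,\Gamma,s_{\mathbb{R}^n})$ with $n$ a positive integer, $\Gamma$ a countable subgroup of $\mathbb{R}^d$ and $s_{\mathbb{R}^n}:\Gamma\to\mathbb{R}^n$ a group morphism with dense range whose graph $\{(\gamma,s_{\mathbb{R}^n}(\gamma)):\gamma\in\Gamma\}$ is discrete and co-compact in $\mathbb{R}^d\times\mathbb{R}^n$. A window is a compact set $W\subseteq\mathbb{R}^n$ that is the closure of its interior. For $V\subseteq\mathbb{R}^n$ and $w\in\mathbb{R}^n$ put $\curlywedge(w+V)=\{t\in\Gamma: s_{\mathbb{R}^n}(t)\in w+V\}$. A Delone set $\Lambda\subseteq\mathbb{R}^d$ is an inter-model set with Euclidean internal space if for some Euclidean CPS, some window $W$, and some $t\in\mathbb{R}^d$, $w\in\mathbb{R}^n$, one has $\curlywedge(w+\operatorname{int}(W))-t\subseteq\Lambda\subseteq\curlywedge(w+W)-t$. *)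

theory Defs
  imports
    "HOL-Analysis.Analysis"
    "HOL-Computational_Algebra.Group_Closure"
begin

section \<open>Delone sets, Meyer sets and repetitivity\<close>

definition translate :: "'a::euclidean_space set \<Rightarrow> 'a \<Rightarrow> 'a set"
  where "translate \<Lambda> t = (\<lambda>x. x - t) ` \<Lambda>"

definition patch :: "'a::euclidean_space set \<Rightarrow> 'a \<Rightarrow> real \<Rightarrow> 'a set"
  where "patch \<Lambda> t \<rho> = \<Lambda> \<inter> cball t \<rho>"

definition delone :: "'a::euclidean_space set \<Rightarrow> bool"
  where "delone \<Lambda> \<longleftrightarrow>
    (\<exists>r>0. \<forall>c. \<forall>x \<in> \<Lambda> \<inter> cball c r. \<forall>y \<in> \<Lambda> \<inter> cball c r. x = y) \<and>
    (\<exists>R>0. \<forall>c. \<Lambda> \<inter> cball c R \<noteq> {})"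

definition difference_set :: "'a::euclidean_space set \<Rightarrow> 'a set"
  where "difference_set \<Lambda> = {x - y | x y. x \<in> \<Lambda> \<and> y \<in> \<Lambda>}"

definition meyer :: "'a::euclidean_space set \<Rightarrow> bool"
  where "meyer \<Lambda> \<longleftrightarrow> delone \<Lambda> \<and> delone (difference_set \<Lambda>)"

text \<open>Two patches are translated copies of each other when they agree after their centers
  have been moved to the origin.\<close>

definition repetitive :: "'a::euclidean_space set \<Rightarrow> bool"
  where "repetitive \<Lambda> \<longleftrightarrow>
    (\<forall>\<rho>>0. \<exists>M>0. \<forall>c t. \<exists>t' \<in> cball c M.
       translate (patch \<Lambda> t' \<rho>) t' = translate (patch \<Lambda> t \<rho>) t)"

section \<open>The hull\<close>

definition hull_of :: "'a::euclidean_space set \<Rightarrow> 'a set set"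
  where "hull_of \<Lambda> = {\<Lambda>'. delone \<Lambda>' \<and>
    (\<forall>\<rho>>0. \<forall>t. \<exists>t'. translate (patch \<Lambda>' t \<rho>) t = translate (patch \<Lambda> t' \<rho>) t')}"

definition transversal :: "'a::euclidean_space set \<Rightarrow> 'a set set"
  where "transversal \<Lambda> = {\<Lambda>' \<in> hull_of \<Lambda>. 0 \<in> \<Lambda>'}"

definition hull_nbhd :: "'a::euclidean_space set \<Rightarrow> 'a set \<Rightarrow> real \<Rightarrow> real \<Rightarrow> 'a set set"
  where "hull_nbhd \<Lambda> \<Lambda>' R \<epsilon> =
    {translate \<Lambda>'' t | \<Lambda>'' t. \<Lambda>'' \<in> hull_of \<Lambda> \<and> \<Lambda>'' \<inter> cball 0 R = \<Lambda>' \<inter> cball 0 R \<and> t \<in> ball 0 \<epsilon>}"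

definition hull_topology :: "'a::euclidean_space set \<Rightarrow> 'a set topology"
  where "hull_topology \<Lambda> = topology (\<lambda>U. U \<subseteq> hull_of \<Lambda> \<and>
    (\<forall>\<Lambda>' \<in> U. \<exists>R \<epsilon>. 0 < \<epsilon> \<and> \<epsilon> < R / 2 \<and> hull_nbhd \<Lambda> \<Lambda>' R \<epsilon> \<subseteq> U))"

lemma hull_nbhd_mono:
  assumes "R \<le> R'" "\<epsilon>' \<le> \<epsilon>"
  shows "hull_nbhd \<Lambda> \<Lambda>' R' \<epsilon>' \<subseteq> hull_nbhd \<Lambda> \<Lambda>' R \<epsilon>"
proof
  fix X assume "X \<in> hull_nbhd \<Lambda> \<Lambda>' R' \<epsilon>'"
  then obtain \<Lambda>'' t where X: "X = translate \<Lambda>'' t" "\<Lambda>'' \<in> hull_of \<Lambda>"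
    "\<Lambda>'' \<inter> cball 0 R' = \<Lambda>' \<inter> cball 0 R'" "t \<in> ball 0 \<epsilon>'"
    unfolding hull_nbhd_def by blast
  have "cball 0 R \<subseteq> (cball 0 R' :: 'a set)" "ball 0 \<epsilon>' \<subseteq> (ball 0 \<epsilon> :: 'a set)"
    using assms by auto
  with X have "\<Lambda>'' \<inter> cball 0 R = \<Lambda>' \<inter> cball 0 R" "t \<in> ball 0 \<epsilon>" by blast+
  with X show "X \<in> hull_nbhd \<Lambda> \<Lambda>' R \<epsilon>" unfolding hull_nbhd_def by blast
qed

lemma openin_hull_topology:
  "openin (hull_topology \<Lambda>) U \<longleftrightarrow> U \<subseteq> hull_of \<Lambda> \<and>
    (\<forall>\<Lambda>' \<in> U. \<exists>R \<epsilon>. 0 < \<epsilon> \<and> \<epsilon> < R / 2 \<and> hull_nbhd \<Lambda> \<Lambda>' R \<epsilon> \<subseteq> U)"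
proof -
  have "istopology (\<lambda>U. U \<subseteq> hull_of \<Lambda> \<and>
    (\<forall>\<Lambda>' \<in> U. \<exists>R \<epsilon>. 0 < \<epsilon> \<and> \<epsilon> < R / 2 \<and> hull_nbhd \<Lambda> \<Lambda>' R \<epsilon> \<subseteq> U))" (is "istopology ?L")
    unfolding istopology_def
  proof (intro conjI allI impI)
    fix S T assume S: "?L S" and T: "?L T"
    show "S \<inter> T \<subseteq> hull_of \<Lambda>" using S by blast
    show "\<forall>\<Lambda>' \<in> S \<inter> T. \<exists>R \<epsilon>. 0 < \<epsilon> \<and> \<epsilon> < R / 2 \<and> hull_nbhd \<Lambda> \<Lambda>' R \<epsilon> \<subseteq> S \<inter> T"
    proof
      fix \<Lambda>' assume "\<Lambda>' \<in> S \<inter> T"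
      then obtain R1 e1 R2 e2 where
        1: "0 < e1" "e1 < R1 / 2" "hull_nbhd \<Lambda> \<Lambda>' R1 e1 \<subseteq> S" and
        2: "0 < e2" "e2 < R2 / 2" "hull_nbhd \<Lambda> \<Lambda>' R2 e2 \<subseteq> T"
        using S T by (meson IntD1 IntD2)
      have "hull_nbhd \<Lambda> \<Lambda>' (max R1 R2) (min e1 e2) \<subseteq> S \<inter> T"
        using 1(3) 2(3) hull_nbhd_mono[of R1 "max R1 R2" "min e1 e2" e1 \<Lambda> \<Lambda>']
          hull_nbhd_mono[of R2 "max R1 R2" "min e1 e2" e2 \<Lambda> \<Lambda>'] by auto
      moreover have "0 < min e1 e2" "min e1 e2 < max R1 R2 / 2" using 1 2 by auto
      ultimately show "\<exists>R \<epsilon>. 0 < \<epsilon> \<and> \<epsilon> < R / 2 \<and> hull_nbhd \<Lambda> \<Lambda>' R \<epsilon> \<subseteq> S \<inter> T" by blast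
    qed
  next
    fix \<K> assume K: "\<forall>K \<in> \<K>. ?L K"
    show "\<Union>\<K> \<subseteq> hull_of \<Lambda>" using K by blast
    show "\<forall>\<Lambda>' \<in> \<Union>\<K>. \<exists>R \<epsilon>. 0 < \<epsilon> \<and> \<epsilon> < R / 2 \<and> hull_nbhd \<Lambda> \<Lambda>' R \<epsilon> \<subseteq> \<Union>\<K>"
      using K by (meson Sup_upper UnionE subset_trans)
  qed
  then show ?thesis unfolding hull_topology_def by (simp add: topology_inverse')
qed

lemma translate_translate: "translate (translate \<Lambda> s) t = translate \<Lambda> (s + t)"
  unfolding translate_def image_image by (simp add: algebra_simps)

lemma mem_translate: "x \<in> translate \<Lambda> t \<longleftrightarrow> x + t \<in> \<Lambda>"
  unfolding translate_def by (force simp: image_iff algebra_simps)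

lemma patch_translate: "translate (patch (translate \<Lambda> s) t \<rho>) t = translate (patch \<Lambda> (s + t) \<rho>) (s + t)"
  by (auto simp: mem_translate patch_def dist_norm algebra_simps)

lemma delone_translate:
  assumes "delone \<Lambda>" shows "delone (translate \<Lambda> s)"
proof -
  obtain r R where r: "r > 0" "\<forall>c. \<forall>x \<in> \<Lambda> \<inter> cball c r. \<forall>y \<in> \<Lambda> \<inter> cball c r. x = y"
    and R: "R > 0" "\<forall>c. \<Lambda> \<inter> cball c R \<noteq> {}"
    using assms unfolding delone_def by blast
  have mem: "x \<in> translate \<Lambda> s \<inter> cball c \<rho> \<longleftrightarrow> x + s \<in> \<Lambda> \<inter> cball (c + s) \<rho>" for x c \<rho>
    by (simp add: mem_translate dist_norm)
  have "\<forall>c. \<forall>x \<in> translate \<Lambda> s \<inter> cball c r. \<forall>y \<in> translate \<Lambda> s \<inter> cball c r. x = y"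
  proof (intro allI ballI)
    fix c x y assume "x \<in> translate \<Lambda> s \<inter> cball c r" "y \<in> translate \<Lambda> s \<inter> cball c r"
    then have "x + s = y + s" unfolding mem using r(2) by blast
    then show "x = y" by simp
  qed
  moreover have "\<forall>c. translate \<Lambda> s \<inter> cball c R \<noteq> {}"
  proof
    fix c
    obtain y where "y \<in> \<Lambda> \<inter> cball (c + s) R" using R(2) by blast
    then have "y - s \<in> translate \<Lambda> s \<inter> cball c R" unfolding mem by simp
    then show "translate \<Lambda> s \<inter> cball c R \<noteq> {}" by blast
  qed
  ultimately show ?thesis unfolding delone_def using r(1) R(1) by blast
qed

lemma hull_of_translate:
  assumes "\<Lambda>' \<in> hull_of \<Lambda>" shows "translate \<Lambda>' s \<in> hull_of \<Lambda>"
  using assms unfolding hull_of_def by (simp add: delone_translate patch_translate)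

lemma topspace_hull_topology: "topspace (hull_topology \<Lambda>) = hull_of \<Lambda>"
proof -
  have "openin (hull_topology \<Lambda>) (hull_of \<Lambda>)"
    unfolding openin_hull_topology
  proof (intro conjI ballI)
    fix \<Lambda>'
    have "hull_nbhd \<Lambda> \<Lambda>' 3 1 \<subseteq> hull_of \<Lambda>"
      unfolding hull_nbhd_def using hull_of_translate by blast
    then show "\<exists>R \<epsilon>. 0 < \<epsilon> \<and> \<epsilon> < R / 2 \<and> hull_nbhd \<Lambda> \<Lambda>' R \<epsilon> \<subseteq> hull_of \<Lambda>"
      by (intro exI[of _ 3] exI[of _ 1]) simp
  qed simp
  then show ?thesis
    by (meson openin_hull_topology openin_subset openin_topspace subset_antisym)
qed

section \<open>Dynamical systems and factors\<close>

definition dynamical_system :: "'x topology \<Rightarrow> ('x \<Rightarrow> 'a::euclidean_space \<Rightarrow> 'x) \<Rightarrow> bool"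
  where "dynamical_system X \<alpha> \<longleftrightarrow>
    compact_space X \<and> metrizable_space X \<and>
    continuous_map (prod_topology X euclidean) X (\<lambda>(x, t). \<alpha> x t) \<and>
    (\<forall>x \<in> topspace X. \<alpha> x 0 = x) \<and>
    (\<forall>x \<in> topspace X. \<forall>s t. \<alpha> (\<alpha> x s) t = \<alpha> x (s + t))"

definition factor_map ::
  "'x topology \<Rightarrow> ('x \<Rightarrow> 'a::euclidean_space \<Rightarrow> 'x) \<Rightarrow> 'y topology \<Rightarrow> ('y \<Rightarrow> 'a \<Rightarrow> 'y) \<Rightarrow> ('x \<Rightarrow> 'y) \<Rightarrow> bool"
  where "factor_map X \<alpha> Y \<beta> \<pi> \<longleftrightarrow>
    continuous_map X Y \<pi> \<and> \<pi> ` topspace X = topspace Y \<and>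
    (\<forall>x \<in> topspace X. \<forall>t. \<pi> (\<alpha> x t) = \<beta> (\<pi> x) t)"

definition topological_factor ::
  "'x topology \<Rightarrow> ('x \<Rightarrow> 'a::euclidean_space \<Rightarrow> 'x) \<Rightarrow> 'y topology \<Rightarrow> ('y \<Rightarrow> 'a \<Rightarrow> 'y) \<Rightarrow> bool"
  where "topological_factor X \<alpha> Y \<beta> \<longleftrightarrow> (\<exists>\<pi>. factor_map X \<alpha> Y \<beta> \<pi>)"

text \<open>On a compact space all metrics inducing the topology are uniformly equivalent, so the
  choice of the metric is immaterial.\<close>

definition equicontinuous_action :: "'x topology \<Rightarrow> ('x \<Rightarrow> 'a::euclidean_space \<Rightarrow> 'x) \<Rightarrow> bool"
  where "equicontinuous_action X \<alpha> \<longleftrightarrow>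
    (\<exists>m. mtopology_of m = X \<and>
      (\<forall>\<epsilon>>0. \<exists>\<delta>>0. \<forall>x \<in> topspace X. \<forall>y \<in> topspace X.
         mdist m x y < \<delta> \<longrightarrow> (\<forall>t. mdist m (\<alpha> x t) (\<alpha> y t) < \<epsilon>)))"

definition equicontinuous_factor ::
  "'x topology \<Rightarrow> ('x \<Rightarrow> 'a::euclidean_space \<Rightarrow> 'x) \<Rightarrow> 'y topology \<Rightarrow> ('y \<Rightarrow> 'a \<Rightarrow> 'y) \<Rightarrow> bool"
  where "equicontinuous_factor X \<alpha> Y \<beta> \<longleftrightarrow>
    dynamical_system Y \<beta> \<and> equicontinuous_action Y \<beta> \<and> topological_factor X \<alpha> Y \<beta>"

text \<open>HOL formulas cannot quantify over types, so the carrier type \<open>'z\<close> of the competing factors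
  is a parameter; theorems leave it as a type variable.\<close>

definition maximal_equicontinuous_factor ::
  "'z itself \<Rightarrow> 'x topology \<Rightarrow> ('x \<Rightarrow> 'a::euclidean_space \<Rightarrow> 'x) \<Rightarrow> 'y topology \<Rightarrow> ('y \<Rightarrow> 'a \<Rightarrow> 'y) \<Rightarrow> bool"
  where "maximal_equicontinuous_factor (_ :: 'z itself) X \<alpha> Y \<beta> \<longleftrightarrow>
    equicontinuous_factor X \<alpha> Y \<beta> \<and>
    (\<forall>(Z :: 'z topology) \<gamma>. equicontinuous_factor X \<alpha> Z \<gamma> \<longrightarrow> topological_factor Y \<beta> Z \<gamma>)"

section \<open>Integer bases and rank\<close>

text \<open>The library's module notions (\<open>zmod.span\<close>, \<open>zmod.independent\<close>, \<open>zmod.representation\<close>),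
  with integer scalars.\<close>

global_interpretation zmod: module "\<lambda>(k::int) (x::'a::real_vector). of_int k *\<^sub>R x"
  by unfold_locales (simp_all add: algebra_simps)

definition zrank :: "'a::real_vector set \<Rightarrow> nat"
  where "zrank G = (THE s. \<exists>B. finite B \<and> card B = s \<and> zmod.independent B \<and> zmod.span B = G)"

text \<open>An ordered basis is the restriction of \<open>b\<close> to the indices below the rank.\<close>

definition zbasis :: "'a::real_vector set \<Rightarrow> (nat \<Rightarrow> 'a) \<Rightarrow> bool"
  where "zbasis G b \<longleftrightarrow> inj_on b {..<zrank G} \<and>
    zmod.independent (b ` {..<zrank G}) \<and> zmod.span (b ` {..<zrank G}) = G"

definition zcoord :: "'a::real_vector set \<Rightarrow> (nat \<Rightarrow> 'a) \<Rightarrow> 'a \<Rightarrow> nat \<Rightarrow> int"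
  where "zcoord G b t i = zmod.representation (b ` {..<zrank G}) t (b i)"

section \<open>Quotient spaces and the torus\<close>

definition quotient_topology :: "'x topology \<Rightarrow> ('x \<Rightarrow> 'y) \<Rightarrow> 'y topology"
  where "quotient_topology X q =
    topology (\<lambda>U. U \<subseteq> q ` topspace X \<and> openin X {x \<in> topspace X. q x \<in> U})"

lemma openin_quotient_topology:
  "openin (quotient_topology X q) U \<longleftrightarrow>
    U \<subseteq> q ` topspace X \<and> openin X {x \<in> topspace X. q x \<in> U}"
proof -
  have "istopology (\<lambda>U. U \<subseteq> q ` topspace X \<and> openin X {x \<in> topspace X. q x \<in> U})"
    unfolding istopology_def
  proof (intro conjI allI impI)
    fix S T
    assume S: "S \<subseteq> q ` topspace X \<and> openin X {x \<in> topspace X. q x \<in> S}"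
      and T: "T \<subseteq> q ` topspace X \<and> openin X {x \<in> topspace X. q x \<in> T}"
    show "S \<inter> T \<subseteq> q ` topspace X" using S by blast
    have eq: "{x \<in> topspace X. q x \<in> S \<inter> T} = {x \<in> topspace X. q x \<in> S} \<inter> {x \<in> topspace X. q x \<in> T}"
      by blast
    show "openin X {x \<in> topspace X. q x \<in> S \<inter> T}"
      unfolding eq by (rule openin_Int) (use S T in blast)+
  next
    fix \<K> assume K: "\<forall>K\<in>\<K>. K \<subseteq> q ` topspace X \<and> openin X {x \<in> topspace X. q x \<in> K}"
    show "\<Union>\<K> \<subseteq> q ` topspace X" using K by blast
    have eq: "{x \<in> topspace X. q x \<in> \<Union>\<K>} = (\<Union>K\<in>\<K>. {x \<in> topspace X. q x \<in> K})" by blast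
    show "openin X {x \<in> topspace X. q x \<in> \<Union>\<K>}"
      unfolding eq by (rule openin_Union) (use K in blast)
  qed
  then show ?thesis unfolding quotient_topology_def by (simp add: topology_inverse')
qed

lemma quotient_map_quotient_topology: "quotient_map X (quotient_topology X q) q"
proof -
  have "openin (quotient_topology X q) (q ` topspace X)"
  proof -
    have "{x \<in> topspace X. q x \<in> q ` topspace X} = topspace X" by blast
    then show ?thesis unfolding openin_quotient_topology by simp
  qed
  then have "topspace (quotient_topology X q) = q ` topspace X"
    by (metis openin_quotient_topology openin_subset openin_topspace subset_antisym)
  then show ?thesis unfolding quotient_map_def by (auto simp: openin_quotient_topology)
qed

text \<open>\<open>\<real>\<^sup>s\<close> is the space \<open>Euclidean_space s\<close> of sequences vanishing from index \<open>s\<close> on.\<close>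

definition integer_lattice :: "nat \<Rightarrow> (nat \<Rightarrow> real) set"
  where "integer_lattice s = {k \<in> topspace (Euclidean_space s). \<forall>i. k i \<in> \<int>}"

definition torus_class :: "nat \<Rightarrow> (nat \<Rightarrow> real) \<Rightarrow> (nat \<Rightarrow> real) set"
  where "torus_class s x = {(\<lambda>i. x i + k i) | k. k \<in> integer_lattice s}"

definition torus :: "nat \<Rightarrow> (nat \<Rightarrow> real) set topology"
  where "torus s = quotient_topology (Euclidean_space s) (torus_class s)"

definition torus_add :: "(nat \<Rightarrow> real) set \<Rightarrow> (nat \<Rightarrow> real) set \<Rightarrow> (nat \<Rightarrow> real) set"
  where "torus_add v w = {(\<lambda>i. x i + y i) | x y. x \<in> v \<and> y \<in> w}"

section \<open>The address system\<close>

abbreviation difference_group :: "'a::euclidean_space set \<Rightarrow> 'a set"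
  where "difference_group \<Lambda> \<equiv> group_closure (difference_set \<Lambda>)"

abbreviation difference_rank :: "'a::euclidean_space set \<Rightarrow> nat"
  where "difference_rank \<Lambda> \<equiv> zrank (difference_group \<Lambda>)"

definition address_linear_map :: "'a::euclidean_space set \<Rightarrow> (nat \<Rightarrow> 'a) \<Rightarrow> 'a \<Rightarrow> nat \<Rightarrow> real"
  where "address_linear_map \<Lambda> b = (THE l.
    (\<forall>t. l t \<in> topspace (Euclidean_space (difference_rank \<Lambda>))) \<and>
    (\<forall>i. linear (\<lambda>t. l t i)) \<and>
    (\<exists>C>0. \<forall>\<Lambda>\<^sub>0 \<in> transversal \<Lambda>. \<forall>t \<in> \<Lambda>\<^sub>0.
       L2_set (\<lambda>i. of_int (zcoord (difference_group \<Lambda>) b t i) - l t i)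
         {..<difference_rank \<Lambda>} \<le> C))"

definition address_space :: "'a::euclidean_space set \<Rightarrow> (nat \<Rightarrow> real) set topology"
  where "address_space \<Lambda> = torus (difference_rank \<Lambda>)"

definition address_action ::
  "'a::euclidean_space set \<Rightarrow> (nat \<Rightarrow> 'a) \<Rightarrow> (nat \<Rightarrow> real) set \<Rightarrow> 'a \<Rightarrow> (nat \<Rightarrow> real) set"
  where "address_action \<Lambda> b w t =
    torus_add w (torus_class (difference_rank \<Lambda>) (address_linear_map \<Lambda> b t))"

section \<open>Inter-model sets\<close>

definition euclidean_cps ::
  "nat \<Rightarrow> 'a::euclidean_space set \<Rightarrow> ('a \<Rightarrow> nat \<Rightarrow> real) \<Rightarrow> bool"
  where "euclidean_cps n \<Gamma> \<sigma> \<longleftrightarrow>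
    0 < n \<and> countable \<Gamma> \<and>
    0 \<in> \<Gamma> \<and> (\<forall>x \<in> \<Gamma>. \<forall>y \<in> \<Gamma>. x - y \<in> \<Gamma>) \<and>
    \<sigma> ` \<Gamma> \<subseteq> topspace (Euclidean_space n) \<and>
    (\<forall>x \<in> \<Gamma>. \<forall>y \<in> \<Gamma>. \<forall>i. \<sigma> (x + y) i = \<sigma> x i + \<sigma> y i) \<and>
    Euclidean_space n closure_of (\<sigma> ` \<Gamma>) = topspace (Euclidean_space n) \<and>
    (let P = prod_topology euclidean (Euclidean_space n);
         graph = {(\<gamma>, \<sigma> \<gamma>) | \<gamma>. \<gamma> \<in> \<Gamma>};
         coset = (\<lambda>(x, y). {(x + \<gamma>, \<lambda>i. y i + v i) | \<gamma> v. (\<gamma>, v) \<in> graph})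
     in subtopology P graph = discrete_topology graph \<and>
        compact_space (quotient_topology P coset))"

definition window :: "nat \<Rightarrow> (nat \<Rightarrow> real) set \<Rightarrow> bool"
  where "window n W \<longleftrightarrow> compactin (Euclidean_space n) W \<and>
    W = Euclidean_space n closure_of (Euclidean_space n interior_of W)"

definition cut_project ::
  "'a::euclidean_space set \<Rightarrow> ('a \<Rightarrow> nat \<Rightarrow> real) \<Rightarrow> (nat \<Rightarrow> real) \<Rightarrow> (nat \<Rightarrow> real) set \<Rightarrow> 'a set"
  where "cut_project \<Gamma> \<sigma> w V = {t \<in> \<Gamma>. \<sigma> t \<in> {(\<lambda>i. w i + v i) | v. v \<in> V}}"

definition euclidean_inter_model_set :: "'a::euclidean_space set \<Rightarrow> bool"
  where "euclidean_inter_model_set \<Lambda> \<longleftrightarrow> delone \<Lambda> \<and>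
    (\<exists>n \<Gamma> \<sigma> W t w. euclidean_cps n \<Gamma> \<sigma> \<and> window n W \<and> w \<in> topspace (Euclidean_space n) \<and>
       translate (cut_project \<Gamma> \<sigma> w (Euclidean_space n interior_of W)) t \<subseteq> \<Lambda> \<and>
       \<Lambda> \<subseteq> translate (cut_project \<Gamma> \<sigma> w W) t)"

end

theory Submission
  imports Defs
begin

text \<open>On \<open>\<Lambda> - \<Lambda>\<close> every additive function on \<open>L = \<langle>\<Lambda> - \<Lambda>\<rangle>\<close> stays at bounded distance from a linear
  function. For the coordinates \<open>\<phi>\<close> this gives \<open>\<ell>\<close>, and \<open>\<phi> - \<ell>\<close> is a star map with values in the kernel
  of \<open>\<real>\<^sup>s \<rightarrow> \<real>\<^sup>d\<close>. Being a bounded cocycle over a minimal system, it is the coboundary of a continuous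
  function \<open>g\<close> on the transversal, and \<open>A - t \<mapsto> [\<ell>(t) - g(A)]\<close> is the address homomorphism.

  If \<open>\<Lambda>\<close> is an inter-model set, then the star map of its cut and project scheme is a linear image of
  \<open>\<phi> - \<ell>\<close>. Hence \<open>g(A)\<close> determines the translate of the window that belongs to \<open>A\<close>, and by Baire's theorem
  some \<open>A\<close> has no points over the boundary of its window; its address has no other preimage. Conversely,
  let \<open>\<Lambda>\<^sup>*\<close> be the only preimage of its address. Then the range of \<open>g\<close> serves as window: by compactness,
  elements of \<open>L\<close> with star close to \<open>g(\<Lambda>\<^sup>*)\<close> lie in \<open>\<Lambda>\<close>, which produces interior points of the window, and
  minimality transports them, as well as holes of \<open>\<Lambda>\<close>, between \<open>\<Lambda>\<close> and \<open>\<Lambda>\<^sup>*\<close>.\<close>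

section \<open>Additive functions on the difference group\<close>

text \<open>Two things in the statement are not explicit: \<open>address_linear_map\<close> is a
  definite description, and \<open>\<pi>\<close> is an arbitrary factor map. So existence and
  uniqueness of the linear part are proved, and every factor map is identified with the explicit
  address map up to a rotation; equivariance along the orbit of \<Lambda> and continuity do this.
  Both conditions on the factor map then become algebraic: surjectivity is density of the stars of
  \<open>L\<close> in the kernel of \<open>combine\<close> (\<open>star_dense\<close>), and a
  one-point fibre is \<open>determined\<close>. The rank condition says that this kernel, whose
  dimension is the rank minus the dimension of the ambient space, is not zero, which gives an
  internal space of positive dimension. Discreteness comes from integrality: bounded norm and
  bounded star leave finitely many integer coordinate vectors. This finiteness turns compactness of
  the transversal into statements about all elements of \<open>L\<close> whose star is close to a
  given point of the kernel.\<close>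

definition additive_on :: "'a::ab_group_add set \<Rightarrow> ('a \<Rightarrow> real) \<Rightarrow> bool"
  where "additive_on G h \<longleftrightarrow> (\<forall>x\<in>G. \<forall>y\<in>G. h (x + y) = h x + h y)"

lemma additive_on_add:
  "additive_on G h \<Longrightarrow> x \<in> G \<Longrightarrow> y \<in> G \<Longrightarrow> h (x + y) = h x + h y"
  by (simp add: additive_on_def)

lemma additive_on_diff:
  assumes "additive_on (group_closure S) h" "x \<in> group_closure S" "y \<in> group_closure S"
  shows "h (x - y) = h x - h y"
  using additive_on_add[OF assms(1) group_closure.diff[OF assms(2,3)] assms(3)] by simp

lemma additive_on_zero:
  assumes "additive_on (group_closure S) h" shows "h 0 = 0"
  using additive_on_diff[OF assms zero_in_group_closure zero_in_group_closure] by simp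

lemma additive_on_minus:
  assumes "additive_on (group_closure S) h" "x \<in> group_closure S"
  shows "h (- x) = - h x"
  using additive_on_diff[OF assms(1) zero_in_group_closure assms(2)] additive_on_zero[OF assms(1)]
  by simp

lemma additive_on_of_nat:
  fixes S :: "'a::real_vector set"
  assumes add: "additive_on (group_closure S) h" and x: "x \<in> group_closure S"
  shows "of_nat n *\<^sub>R x \<in> group_closure S \<and> h (of_nat n *\<^sub>R x) = of_nat n * h x"
proof (induction n)
  case 0 show ?case using additive_on_zero[OF add] by simp
next
  case (Suc n)
  have "of_nat (Suc n) *\<^sub>R x = x + of_nat n *\<^sub>R x" by (simp add: algebra_simps)
  then show ?case
    using Suc x additive_on_add[OF add x, of "of_nat n *\<^sub>R x"] group_closure_add[OF x, of "of_nat n *\<^sub>R x"]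
    by (simp add: algebra_simps)
qed

lemma difference_setI: "x \<in> \<Lambda> \<Longrightarrow> y \<in> \<Lambda> \<Longrightarrow> x - y \<in> difference_set \<Lambda>"
  unfolding difference_set_def by blast

lemma difference_setE:
  assumes "u \<in> difference_set \<Lambda>" obtains x y where "x \<in> \<Lambda>" "y \<in> \<Lambda>" "u = x - y"
  using assms unfolding difference_set_def by blast

lemma difference_set_group: "u \<in> difference_set \<Lambda> \<Longrightarrow> u \<in> difference_group \<Lambda>"
  by (rule group_closure.base) simp

lemma difference_in_group: "x \<in> \<Lambda> \<Longrightarrow> y \<in> \<Lambda> \<Longrightarrow> x - y \<in> difference_group \<Lambda>"
  by (intro difference_set_group difference_setI)

section \<open>Counting in uniformly discrete sets, and walks in a finite set\<close>

lemma uniformly_discrete_card_le: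
  fixes X :: "'a::euclidean_space set"
  assumes r: "r > 0" "\<forall>c. \<forall>x \<in> X \<inter> cball c r. \<forall>y \<in> X \<inter> cball c r. x = y"
  shows "\<exists>N. \<forall>c. finite (X \<inter> cball c R) \<and> card (X \<inter> cball c R) \<le> N"
proof -
  have "compact (cball (0::'a) R)" by simp
  then obtain Z where Z: "finite Z" "cball (0::'a) R \<subseteq> (\<Union>z\<in>Z. ball z r)"
    using r(1) unfolding compact_eq_totally_bounded by meson
  have "finite (X \<inter> cball c R) \<and> card (X \<inter> cball c R) \<le> card Z" for c
  proof -
    have "\<forall>x \<in> X \<inter> cball c R. \<exists>z\<in>Z. x \<in> cball (c + z) r"
    proof
      fix x assume "x \<in> X \<inter> cball c R"
      then have "x - c \<in> cball 0 R" by (simp add: dist_norm norm_minus_commute)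
      then obtain z where "z \<in> Z" "x - c \<in> ball z r" using Z(2) by blast
      then show "\<exists>z\<in>Z. x \<in> cball (c + z) r"
        by (intro bexI[of _ z]) (simp_all add: dist_norm algebra_simps)
    qed
    then obtain p where p: "\<And>x. x \<in> X \<inter> cball c R \<Longrightarrow> p x \<in> Z \<and> x \<in> cball (c + p x) r"
      by metis
    have "inj_on p (X \<inter> cball c R)"
    proof (rule inj_onI)
      fix x y assume x: "x \<in> X \<inter> cball c R" and y: "y \<in> X \<inter> cball c R" and eq: "p x = p y"
      have "x \<in> X \<inter> cball (c + p x) r" "y \<in> X \<inter> cball (c + p x) r"
        using p[OF x] p[OF y] x y eq by auto
      then show "x = y" using r(2) by blast
    qed
    moreover have "p ` (X \<inter> cball c R) \<subseteq> Z" using p by blast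
    ultimately show ?thesis
      using Z(1) by (metis card_inj_on_le inj_on_finite)
  qed
  then show ?thesis by blast
qed

lemma norm_add_diff_le: "norm (a + b - c) \<le> norm a + norm b + norm c"
  by norm

text \<open>A walk whose upward steps are at most \<delta> cannot jump over a half-open interval of
  length \<delta>. If it climbed more than \<open>card V * \<delta>\<close>, it would have a value
  in each of \<open>card V + 1\<close> disjoint intervals of this kind.\<close>

lemma steps_le_card_aux:
  fixes a :: "nat \<Rightarrow> real" and \<delta> :: real
  assumes step: "\<And>i. i < k \<Longrightarrow> a (Suc i) - a i \<le> \<delta>" and "\<delta> > 0"
    and V: "finite V" "\<And>i. i \<le> k \<Longrightarrow> a i \<in> V"
  shows "a k - a 0 \<le> card V * \<delta>"
proof (rule ccontr)
  assume contr: "\<not> a k - a 0 \<le> card V * \<delta>"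
  have "\<exists>v\<in>V. a 0 + j * \<delta> \<le> v \<and> v < a 0 + (real j + 1) * \<delta>" if j: "j \<le> card V" for j :: nat
  proof -
    have "j * \<delta> \<le> card V * \<delta>" using j \<open>\<delta> > 0\<close> by simp
    then have top: "a 0 + j * \<delta> \<le> a k" using contr by linarith
    \<comment> \<open>The first index at which level \<open>j\<close> is reached: the value just
      before lies below the level, so the value here exceeds it by less than \<delta>.\<close>
    define i where "i = (LEAST i. a 0 + j * \<delta> \<le> a i)"
    have i: "a 0 + j * \<delta> \<le> a i" "i \<le> k"
      unfolding i_def using top by (auto intro: LeastI Least_le)
    have "a i < a 0 + (real j + 1) * \<delta>"
    proof (cases i)
      case 0
      have "0 < (real j + 1) * \<delta>" using \<open>\<delta> > 0\<close> by (intro mult_pos_pos) auto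
      then show ?thesis using 0 by simp
    next
      case (Suc m)
      then have "m < (LEAST i. a 0 + j * \<delta> \<le> a i)" unfolding i_def by simp
      then have "\<not> a 0 + j * \<delta> \<le> a m" by (rule not_less_Least)
      moreover have "a i - a m \<le> \<delta>" using step[of m] Suc i(2) by simp
      ultimately show ?thesis by (simp add: algebra_simps)
    qed
    then show ?thesis using i V(2) by blast
  qed
  then obtain v where v: "\<And>j. j \<le> card V \<Longrightarrow> v j \<in> V \<and> a 0 + j * \<delta> \<le> v j \<and> v j < a 0 + (real j + 1) * \<delta>"
    by metis
  have less: "v i < v j" if "i < j" "j \<le> card V" for i j
  proof -
    have "(real i + 1) * \<delta> \<le> j * \<delta>" using that \<open>\<delta> > 0\<close> by (intro mult_right_mono) auto
    then show ?thesis using v[of i] v[of j] that by linarith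
  qed
  have "inj_on v {..card V}"
  proof (rule inj_onI)
    fix i j assume "i \<in> {..card V}" "j \<in> {..card V}" "v i = v j"
    then show "i = j" using less[of i j] less[of j i] by (cases i j rule: linorder_cases) auto
  qed
  moreover have "v ` {..card V} \<subseteq> V" using v by auto
  ultimately have "card {..card V} \<le> card V" using V(1) card_inj_on_le by blast
  then show False by simp
qed

lemma steps_le_card:
  fixes a :: "nat \<Rightarrow> real" and \<delta> :: real
  assumes step: "\<And>i. i < k \<Longrightarrow> \<bar>a (Suc i) - a i\<bar> \<le> \<delta>" and "\<delta> > 0"
    and V: "finite V" "\<And>i. i \<le> k \<Longrightarrow> a i \<in> V"
  shows "\<bar>a k - a 0\<bar> \<le> card V * \<delta>"
proof -
  have "a k - a 0 \<le> card V * \<delta>"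
    using steps_le_card_aux[of k a \<delta> V] step assms(2-) by (simp add: abs_le_iff)
  moreover have "- a k - - a 0 \<le> card (uminus ` V) * \<delta>"
    using steps_le_card_aux[of k "\<lambda>i. - a i" \<delta> "uminus ` V"] step assms(2-) by (simp add: abs_le_iff)
  moreover have "card (uminus ` V) = card V" by (simp add: card_image)
  ultimately show ?thesis by (simp add: abs_le_iff)
qed

text \<open>Subdivide the segment from \<open>y\<close> to \<open>y'\<close> with mesh at most 1 and
  replace each point by a point of \<Lambda> within \<open>R\<close>; a step then has length at most
  \<open>R + 1 + R\<close>.\<close>

lemma relatively_dense_chain:
  fixes \<Lambda> :: "'a::euclidean_space set"
  assumes R: "\<forall>c. \<Lambda> \<inter> cball c R \<noteq> {}" "R > 0" and y: "y \<in> \<Lambda>" "y' \<in> \<Lambda>"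
  obtains k Y where "Y 0 = y" "Y k = y'" "\<And>i. i \<le> k \<Longrightarrow> Y i \<in> \<Lambda>"
    "\<And>i. i < k \<Longrightarrow> norm (Y (Suc i) - Y i) \<le> 2 * R + 1"
proof -
  \<comment> \<open>The summand 1 keeps \<open>k\<close> positive when the two points
    coincide.\<close>
  define k where "k = nat \<lceil>norm (y' - y)\<rceil> + 1"
  define p where "p i = y + (real i / real k) *\<^sub>R (y' - y)" for i
  have k: "k > 0" "norm (y' - y) \<le> k" unfolding k_def by linarith+
  have "\<forall>i. \<exists>z. z \<in> \<Lambda> \<inter> cball (p i) R" using R by blast
  then obtain q where q: "\<And>i. q i \<in> \<Lambda> \<inter> cball (p i) R" by metis
  define Y where "Y i = (if i = 0 then y else if i = k then y' else q i)" for i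
  have p0: "p 0 = y" "p k = y'" unfolding p_def using k by auto
  have Y: "Y i \<in> \<Lambda>" "dist (p i) (Y i) \<le> R" for i
    unfolding Y_def using q[of i] y p0 R(2) by auto
  have "norm (Y (Suc i) - Y i) \<le> 2 * R + 1" for i
  proof -
    have "p (Suc i) - p i = (1 / real k) *\<^sub>R (y' - y)"
      unfolding p_def by (simp add: algebra_simps add_divide_distrib)
    then have "norm (p (Suc i) - p i) \<le> 1" using k by simp
    then have "dist (p (Suc i)) (p i) \<le> 1" by (simp add: dist_norm)
    moreover have "dist (Y (Suc i)) (Y i) \<le> dist (p (Suc i)) (Y (Suc i)) + dist (p (Suc i)) (p i) + dist (p i) (Y i)"
      using dist_triangle3[of "Y (Suc i)" "Y i" "p (Suc i)"] dist_triangle[of "p (Suc i)" "Y i" "p i"] by linarith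
    ultimately show ?thesis using Y(2)[of i] Y(2)[of "Suc i"] by (simp add: dist_norm)
  qed
  then show ?thesis using that[of Y k] Y k unfolding Y_def by auto
qed

lemma meyerE:
  fixes \<Lambda> :: "'a::euclidean_space set"
  assumes "meyer \<Lambda>"
  obtains R where "R > 0" "\<And>c. \<exists>x\<in>\<Lambda>. norm (x - c) \<le> R"
    "\<And>\<rho>. \<exists>N. \<forall>c. finite (difference_set \<Lambda> \<inter> cball c \<rho>) \<and> card (difference_set \<Lambda> \<inter> cball c \<rho>) \<le> N"
proof -
  obtain R where R: "R > 0" "\<forall>c. \<Lambda> \<inter> cball c R \<noteq> {}"
    using assms unfolding meyer_def delone_def by blast
  obtain r where r: "r > 0" "\<forall>c. \<forall>x \<in> difference_set \<Lambda> \<inter> cball c r. \<forall>y \<in> difference_set \<Lambda> \<inter> cball c r. x = y"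
    using assms unfolding meyer_def delone_def by blast
  have "\<exists>x\<in>\<Lambda>. norm (x - c) \<le> R" for c
  proof -
    obtain x where "x \<in> \<Lambda>" "x \<in> cball c R" using R(2) by blast
    then show ?thesis by (auto simp: dist_norm norm_minus_commute)
  qed
  then show ?thesis using that[of R] R(1) uniformly_discrete_card_le[OF r] by blast
qed

text \<open>Only finiteness of the patch matters, so \<open>h\<close> is arbitrary. The summand 1 in
  \<open>K\<close> keeps it positive.\<close>

lemma additive_bounded_on_patch:
  fixes \<Lambda> :: "'a::euclidean_space set" and h :: "'a \<Rightarrow> real"
  assumes "meyer \<Lambda>"
  obtains K where "K > 0" "\<And>u. u \<in> difference_set \<Lambda> \<Longrightarrow> norm u \<le> \<rho> \<Longrightarrow> \<bar>h u\<bar> \<le> K"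
proof -
  have fin: "finite (difference_set \<Lambda> \<inter> cball 0 \<rho>)" using assms by (elim meyerE) blast
  define K where "K = 1 + (\<Sum>u\<in>difference_set \<Lambda> \<inter> cball 0 \<rho>. \<bar>h u\<bar>)"
  have "\<bar>h u\<bar> \<le> K" if "u \<in> difference_set \<Lambda>" "norm u \<le> \<rho>" for u
  proof -
    have "\<bar>h u\<bar> \<le> (\<Sum>u\<in>difference_set \<Lambda> \<inter> cball 0 \<rho>. \<bar>h u\<bar>)"
      by (rule member_le_sum) (use that fin in auto)
    then show ?thesis unfolding K_def by linarith
  qed
  moreover have "K > 0" unfolding K_def by (simp add: add_pos_nonneg sum_nonneg)
  ultimately show ?thesis using that by blast
qed

text \<open>To compare \<open>x - y\<close> with \<open>x' - y'\<close>, move \<open>y\<close> to \<open>y'\<close> inside \<open>\<Lambda>\<close> by bounded steps and let a point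
  of \<open>\<Lambda>\<close> near \<open>y + u\<close> follow. The difference changes by bounded steps and, \<open>\<Lambda> - \<Lambda>\<close> being uniformly
  discrete, takes a bounded number of values.\<close>

lemma additive_difference_bounded:
  fixes \<Lambda> :: "'a::euclidean_space set"
  assumes me: "meyer \<Lambda>" and add: "additive_on (difference_group \<Lambda>) h"
  shows "\<exists>K. \<forall>u\<in>difference_set \<Lambda>. \<forall>v\<in>difference_set \<Lambda>. norm (u - v) \<le> \<rho> \<longrightarrow> \<bar>h u - h v\<bar> \<le> K"
proof -
  obtain R where R: "R > 0" "\<And>c. \<exists>x\<in>\<Lambda>. norm (x - c) \<le> R"
    and N: "\<And>\<rho>. \<exists>N. \<forall>c. finite (difference_set \<Lambda> \<inter> cball c \<rho>) \<and> card (difference_set \<Lambda> \<inter> cball c \<rho>) \<le> N"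
    using meyerE[OF me] by metis
  obtain n where n: "\<And>c. finite (difference_set \<Lambda> \<inter> cball c R)" "\<And>c. card (difference_set \<Lambda> \<inter> cball c R) \<le> n"
    using N[of R] by blast
  \<comment> \<open>The radius covers the three kinds of difference that occur: steps of the leading
    walk (\<open>2 * R + 1\<close>), steps of the following one (\<open>4 * R + 1\<close>), and the
    gap \<open>R + \<rho>\<close> between the end of the latter and \<open>x'\<close>.\<close>
  obtain K where K: "K > 0" "\<And>u. u \<in> difference_set \<Lambda> \<Longrightarrow> norm u \<le> 4 * R + 1 + \<bar>\<rho>\<bar> \<Longrightarrow> \<bar>h u\<bar> \<le> K"
    using additive_bounded_on_patch[OF me, of "4 * R + 1 + \<bar>\<rho>\<bar>" h] by metis
  have ne: "\<forall>c. \<Lambda> \<inter> cball c R \<noteq> {}"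
  proof
    fix c show "\<Lambda> \<inter> cball c R \<noteq> {}" using R(2)[of c] by (auto simp: dist_norm norm_minus_commute)
  qed
  have "\<bar>h u - h v\<bar> \<le> real n * (2 * K) + K"
    if u: "u \<in> difference_set \<Lambda>" and v: "v \<in> difference_set \<Lambda>" and uv: "norm (u - v) \<le> \<rho>" for u v
  proof -
    obtain x y where xy: "x \<in> \<Lambda>" "y \<in> \<Lambda>" "u = x - y" using u by (rule difference_setE)
    obtain x' y' where xy': "x' \<in> \<Lambda>" "y' \<in> \<Lambda>" "v = x' - y'" using v by (rule difference_setE)
    obtain k Y where Y: "Y 0 = y" "Y k = y'" "\<And>i. i \<le> k \<Longrightarrow> Y i \<in> \<Lambda>"
      "\<And>i. i < k \<Longrightarrow> norm (Y (Suc i) - Y i) \<le> 2 * R + 1"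
      using relatively_dense_chain[OF ne R(1) xy(2) xy'(2)] by metis
    have "\<forall>i. \<exists>z\<in>\<Lambda>. norm (z - (Y i + u)) \<le> R" using R(2) by blast
    then obtain q where q: "\<And>i. q i \<in> \<Lambda>" "\<And>i. norm (q i - (Y i + u)) \<le> R" by metis
    define X where "X i = (if i = 0 then x else q i)" for i
    have X: "X i \<in> \<Lambda>" "norm (X i - (Y i + u)) \<le> R" for i
      unfolding X_def using q[of i] xy Y(1) R(1) by auto
    define a where "a i = h (X i - Y i)" for i
    have step: "\<bar>a (Suc i) - a i\<bar> \<le> 2 * K" if "i < k" for i
    proof -
      have Yi: "Y i \<in> \<Lambda>" "Y (Suc i) \<in> \<Lambda>" using Y(3) that by auto
      have g: "X i - Y i \<in> difference_group \<Lambda>" "X (Suc i) - Y (Suc i) \<in> difference_group \<Lambda>"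
        "X (Suc i) - X i \<in> difference_group \<Lambda>" "Y (Suc i) - Y i \<in> difference_group \<Lambda>"
        using Yi X(1) by (auto intro: difference_in_group)
      have "a (Suc i) - a i = h ((X (Suc i) - X i) - (Y (Suc i) - Y i))"
        unfolding a_def additive_on_diff[OF add g(2,1), symmetric] by (simp add: algebra_simps)
      also have "\<dots> = h (X (Suc i) - X i) - h (Y (Suc i) - Y i)"
        by (rule additive_on_diff[OF add g(3,4)])
      finally have eq: "a (Suc i) - a i = h (X (Suc i) - X i) - h (Y (Suc i) - Y i)" .
      have Xeq: "(X (Suc i) - (Y (Suc i) + u)) + (Y (Suc i) - Y i) - (X i - (Y i + u)) = X (Suc i) - X i"
        by simp
      have "norm (X (Suc i) - X i) \<le> R + (2 * R + 1) + R"
        using X(2)[of i] X(2)[of "Suc i"] Y(4)[OF that]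
          norm_add_diff_le[of "X (Suc i) - (Y (Suc i) + u)" "Y (Suc i) - Y i" "X i - (Y i + u)", unfolded Xeq]
        by linarith
      then have "\<bar>h (X (Suc i) - X i)\<bar> \<le> K"
        using R(1) by (intro K(2) difference_setI X(1)) linarith
      moreover have "\<bar>h (Y (Suc i) - Y i)\<bar> \<le> K"
        using Y(4)[OF that] R(1) by (intro K(2) difference_setI Yi) linarith
      ultimately show ?thesis unfolding eq by linarith
    qed
    \<comment> \<open>As \<open>X i\<close> follows \<open>Y i + u\<close> within \<open>R\<close>,
      all differences \<open>X i - Y i\<close> stay in the ball of radius \<open>R\<close> around
      the fixed \<open>u\<close>, which holds at most \<open>n\<close> elements of the difference
      set.\<close>
    have mem: "a i \<in> h ` (difference_set \<Lambda> \<inter> cball u R)" if "i \<le> k" for i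
    proof -
      have "norm (u - (X i - Y i)) \<le> R" using X(2)[of i] by (simp add: norm_minus_commute algebra_simps)
      then show ?thesis unfolding a_def using Y(3)[OF that] X(1)[of i]
        by (auto intro!: imageI difference_setI simp: dist_norm)
    qed
    have "\<bar>a k - a 0\<bar> \<le> card (h ` (difference_set \<Lambda> \<inter> cball u R)) * (2 * K)"
      by (rule steps_le_card) (use step mem K(1) n(1) in auto)
    also have "\<dots> \<le> real n * (2 * K)"
      using card_image_le[OF n(1)[of u], of h] n(2)[of u] K(1) by (intro mult_right_mono) auto
    finally have 1: "\<bar>a k - a 0\<bar> \<le> real n * (2 * K)" .
    have "h v - a k = h (x' - X k)"
    proof -
      have "h (v - (X k - y')) = h v - h (X k - y')"
        by (rule additive_on_diff[OF add]) (use v xy' X(1) in \<open>auto intro: difference_set_group difference_in_group\<close>)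
      then show ?thesis unfolding a_def Y(2) xy'(3) by simp
    qed
    moreover have "norm (x' - X k) \<le> 4 * R + 1 + \<bar>\<rho>\<bar>"
    proof -
      have eq: "((Y k + u) - X k) - (u - v) = x' - X k" using xy' Y(2) by simp
      have "norm (x' - X k) \<le> R + \<rho>"
        using norm_triangle_ineq4[of "(Y k + u) - X k" "u - v", unfolded eq] X(2)[of k] uv
          norm_minus_commute[of "X k" "Y k + u"] by linarith
      then show ?thesis using R(1) by linarith
    qed
    ultimately have "\<bar>h v - a k\<bar> \<le> K" using K(2) xy'(1) X(1) by (auto intro: difference_setI)
    moreover have "a 0 = h u" unfolding a_def X_def using Y(1) xy by simp
    ultimately show ?thesis using 1 by linarith
  qed
  then show ?thesis by blast
qed

section \<open>Approximately additive functions are close to linear ones\<close>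

lemma additive_bounded_imp_linear:
  fixes f :: "'a::euclidean_space \<Rightarrow> real"
  assumes add: "\<And>x y. f (x + y) = f x + f y"
    and bdd: "\<And>\<rho>. \<exists>B. \<forall>x. norm x \<le> \<rho> \<longrightarrow> \<bar>f x\<bar> \<le> B"
  shows "linear f"
proof (rule linearI)
  fix r :: real and x :: 'a
  have zero: "f 0 = 0" using add[of 0 0] by simp
  have minus: "f (- x) = - f x" for x using add[of x "- x"] zero by simp
  have ofnat: "f (of_nat n *\<^sub>R x) = of_nat n * f x" for n x
    by (induction n) (simp_all add: zero add scaleR_add_left algebra_simps)
  have ofint: "f (of_int n *\<^sub>R x) = of_int n * f x" for n x
  proof (cases "n \<ge> 0")
    case True then show ?thesis using ofnat[of "nat n" x] by simp
  next
    case False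
    then have "f (- (of_int n *\<^sub>R x)) = - (of_int n * f x)" using ofnat[of "nat (- n)" x] by simp
    then show ?thesis unfolding minus by simp
  qed
  obtain B where B: "\<And>y. norm y \<le> norm x \<Longrightarrow> \<bar>f y\<bar> \<le> B" using bdd by blast
  \<comment> \<open>The defect of homogeneity. Splitting \<open>n * r\<close> into its integer part
    and a remainder \<open>q\<close> turns \<open>n * D\<close> into
    \<open>f (q *\<^sub>R x) - q * f x\<close>, which is bounded in \<open>n\<close>; hence
    \<open>D = 0\<close>.\<close>
  define D where "D = f (r *\<^sub>R x) - r * f x"
  have bound: "real n * \<bar>D\<bar> \<le> B + \<bar>f x\<bar>" for n
  proof -
    define m where "m = \<lfloor>real n * r\<rfloor>"
    define q where "q = real n * r - m"
    have q: "0 \<le> q" "q < 1" unfolding q_def m_def by linarith+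
    have qx: "\<bar>f (q *\<^sub>R x)\<bar> \<le> B" using q by (intro B) (simp add: mult_left_le_one_le)
    have "real n * f (r *\<^sub>R x) = f (of_int m *\<^sub>R x + q *\<^sub>R x)"
      using ofnat[of n "r *\<^sub>R x"] unfolding q_def by (simp flip: scaleR_add_left)
    also have "\<dots> = m * f x + f (q *\<^sub>R x)" using add ofint by simp
    finally have "real n * D = f (q *\<^sub>R x) - q * f x"
      unfolding D_def q_def by (simp add: algebra_simps)
    moreover have "\<bar>q * f x\<bar> \<le> \<bar>f x\<bar>" using q by (simp add: abs_mult mult_left_le_one_le)
    ultimately have "\<bar>real n * D\<bar> \<le> B + \<bar>f x\<bar>" using qx by linarith
    then show ?thesis by (simp add: abs_mult)
  qed
  have "D = 0"
  proof (rule ccontr)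
    assume "D \<noteq> 0"
    then obtain n where "B + \<bar>f x\<bar> < real n * \<bar>D\<bar>" using reals_Archimedean3[of "\<bar>D\<bar>"] by auto
    then show False using bound[of n] by simp
  qed
  then show "f (r *\<^sub>R x) = r *\<^sub>R f x" unfolding D_def by simp
qed (rule add)

text \<open>The theorem of Hyers and Ulam: the linear function is the limit of \<open>f (2\<^sup>n x) / 2\<^sup>n\<close>.\<close>

lemma quasi_additive_near_linear:
  fixes f :: "'a::euclidean_space \<Rightarrow> real"
  assumes qadd: "\<And>x y. \<bar>f (x + y) - f x - f y\<bar> \<le> K"
    and bdd: "\<And>\<rho>. \<exists>B. \<forall>x. norm x \<le> \<rho> \<longrightarrow> \<bar>f x\<bar> \<le> B"
  shows "\<exists>l. linear l \<and> (\<forall>x. \<bar>f x - l x\<bar> \<le> K)"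
proof -
  have K: "K \<ge> 0" using qadd[of 0 0] by linarith
  define a where "a x n = f (2 ^ n *\<^sub>R x) / 2 ^ n" for x n
  have a_step: "\<bar>a x (Suc n) - a x n\<bar> \<le> K / 2 ^ Suc n" for x n
  proof -
    have "2 ^ n *\<^sub>R x + 2 ^ n *\<^sub>R x = 2 ^ Suc n *\<^sub>R x" by (simp flip: scaleR_add_left)
    then have "\<bar>f (2 ^ Suc n *\<^sub>R x) - 2 * f (2 ^ n *\<^sub>R x)\<bar> \<le> K"
      using qadd[of "2 ^ n *\<^sub>R x" "2 ^ n *\<^sub>R x"] by simp
    then have "\<bar>f (2 ^ Suc n *\<^sub>R x) - 2 * f (2 ^ n *\<^sub>R x)\<bar> / 2 ^ Suc n \<le> K / 2 ^ Suc n"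
      by (intro divide_right_mono) auto
    moreover have "a x (Suc n) - a x n = (f (2 ^ Suc n *\<^sub>R x) - 2 * f (2 ^ n *\<^sub>R x)) / 2 ^ Suc n"
      unfolding a_def by (simp add: diff_divide_distrib)
    ultimately show ?thesis by simp
  qed
  have half: "K / 2 ^ n = 2 * (K / 2 ^ Suc n)" for n by simp
  have Klim: "(\<lambda>n. K / 2 ^ n) \<longlonglongrightarrow> 0"
  proof -
    have eq: "K / 2 ^ n = K * (1 / 2) ^ n" for n by (simp add: power_divide)
    show ?thesis unfolding eq by (intro tendsto_mult_right_zero LIMSEQ_power_zero) simp
  qed
  \<comment> \<open>The steps of \<open>a x\<close> are at most \<open>K / 2 ^ Suc n\<close>, so
    subtracting or adding the remaining error \<open>K / 2 ^ n\<close> gives monotone sequences.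
    Thus the limit exists and lies within \<open>K\<close> of the first term
    \<open>f x\<close>.\<close>
  define lo where "lo x n = a x n - K / 2 ^ n" for x n
  define hi where "hi x n = a x n + K / 2 ^ n" for x n
  have lo: "incseq (lo x)" for x
  proof (rule incseq_SucI)
    fix n show "lo x n \<le> lo x (Suc n)" using a_step[of x n] half[of n] unfolding lo_def by linarith
  qed
  have hi: "decseq (hi x)" for x
  proof (rule decseq_SucI)
    fix n show "hi x (Suc n) \<le> hi x n" using a_step[of x n] half[of n] unfolding hi_def by linarith
  qed
  have lohi: "lo x n \<le> hi x 0" for x n
  proof -
    have "lo x n \<le> hi x n" unfolding lo_def hi_def using K by simp
    also have "\<dots> \<le> hi x 0" using hi by (simp add: decseq_def)
    finally show ?thesis .
  qed
  have "\<exists>l. a x \<longlonglongrightarrow> l \<and> \<bar>f x - l\<bar> \<le> K" for x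
  proof -
    obtain l where l: "lo x \<longlonglongrightarrow> l" "\<And>i. lo x i \<le> l"
      using incseq_convergent[OF lo] lohi by metis
    have "(\<lambda>n. lo x n + K / 2 ^ n) \<longlonglongrightarrow> l + 0" by (rule tendsto_add[OF l(1) Klim])
    then have al: "a x \<longlonglongrightarrow> l" unfolding lo_def by simp
    have "l \<le> hi x 0" using l(1) lohi by (intro LIMSEQ_le_const2) auto
    then have "\<bar>f x - l\<bar> \<le> K" using l(2)[of 0] unfolding lo_def hi_def a_def by simp
    with al show ?thesis by blast
  qed
  then obtain l where l: "\<And>x. a x \<longlonglongrightarrow> l x" "\<And>x. \<bar>f x - l x\<bar> \<le> K" by metis
  have "l (x + y) = l x + l y" for x y
  proof -
    have "(\<lambda>n. a (x + y) n - a x n - a y n) \<longlonglongrightarrow> l (x + y) - l x - l y"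
      by (intro tendsto_diff l)
    moreover have "(\<lambda>n. a (x + y) n - a x n - a y n) \<longlonglongrightarrow> 0"
    proof (rule Lim_null_comparison[OF _ Klim], intro always_eventually allI)
      fix n
      have "a (x + y) n - a x n - a y n = (f (2 ^ n *\<^sub>R x + 2 ^ n *\<^sub>R y) - f (2 ^ n *\<^sub>R x) - f (2 ^ n *\<^sub>R y)) / 2 ^ n"
        unfolding a_def by (simp add: diff_divide_distrib scaleR_add_right)
      also have "norm \<dots> \<le> K / 2 ^ n" using qadd by (simp add: divide_right_mono)
      finally show "norm (a (x + y) n - a x n - a y n) \<le> K / 2 ^ n" .
    qed
    ultimately show ?thesis using LIMSEQ_unique by fastforce
  qed
  moreover have "\<exists>B. \<forall>x. norm x \<le> \<rho> \<longrightarrow> \<bar>l x\<bar> \<le> B" for \<rho>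
  proof -
    obtain B where B: "\<And>x. norm x \<le> \<rho> \<Longrightarrow> \<bar>f x\<bar> \<le> B" using bdd by blast
    have "\<bar>l x\<bar> \<le> B + K" if "norm x \<le> \<rho>" for x using B[OF that] l(2)[of x] by linarith
    then show ?thesis by blast
  qed
  ultimately have "linear l" by (rule additive_bounded_imp_linear)
  then show ?thesis using l(2) by blast
qed

text \<open>\<open>h\<close> is read off along \<open>n\<close>, a choice of nearby elements of the
  difference set, which makes it a function on the whole space. It is additive up to a constant
  because \<open>h\<close> varies boundedly between close differences; the linear function near it
  then also serves \<open>h\<close>.\<close>

lemma additive_near_linear:
  fixes \<Lambda> :: "'a::euclidean_space set"
  assumes me: "meyer \<Lambda>" and add: "additive_on (difference_group \<Lambda>) h"
  shows "\<exists>l C. linear l \<and> (\<forall>u\<in>difference_set \<Lambda>. \<bar>h u - l u\<bar> \<le> C)"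
proof -
  obtain R where R: "R > 0" "\<And>c. \<exists>x\<in>\<Lambda>. norm (x - c) \<le> R" using meyerE[OF me] by metis
  have "\<exists>u\<in>difference_set \<Lambda>. norm (u - t) \<le> R" for t
  proof -
    obtain y where y: "y \<in> \<Lambda>" using R(2) by blast
    obtain x where x: "x \<in> \<Lambda>" "norm (x - (y + t)) \<le> R" using R(2) by blast
    have "norm ((x - y) - t) \<le> R" using x(2) by (simp add: algebra_simps)
    then show ?thesis using x(1) y by (intro bexI[of _ "x - y"]) (auto intro: difference_setI)
  qed
  then obtain n where n: "\<And>t. n t \<in> difference_set \<Lambda>" "\<And>t. norm (n t - t) \<le> R" by metis
  obtain K1 where K1: "\<And>u v. u \<in> difference_set \<Lambda> \<Longrightarrow> v \<in> difference_set \<Lambda> \<Longrightarrow> norm (u - v) \<le> R \<Longrightarrow> \<bar>h u - h v\<bar> \<le> K1"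
    using additive_difference_bounded[OF assms, of R] by blast
  obtain K2 where K2: "\<And>u v. u \<in> difference_set \<Lambda> \<Longrightarrow> v \<in> difference_set \<Lambda> \<Longrightarrow> norm (u - v) \<le> 4 * R \<Longrightarrow> \<bar>h u - h v\<bar> \<le> K2"
    using additive_difference_bounded[OF assms, of "4 * R"] by blast
  have "\<bar>h (n (s + t)) - h (n s) - h (n t)\<bar> \<le> K1 + K2" for s t
  proof -
    obtain x y where xy: "x \<in> \<Lambda>" "y \<in> \<Lambda>" "n s = x - y" using n(1) by (rule difference_setE)
    \<comment> \<open>\<open>n s + n t\<close> need not be a difference of points of \<Lambda>. With
      \<open>n s = x - y\<close> and \<open>z\<close> near \<open>x + n t\<close>, the substitute is
      \<open>z - y = (z - x) + (x - y)\<close>, which is within \<open>4 * R\<close> of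
      \<open>n (s + t)\<close>.\<close>
    obtain z where z: "z \<in> \<Lambda>" "norm (z - (x + n t)) \<le> R" using R(2) by blast
    have "\<bar>h (z - x) - h (n t)\<bar> \<le> K1"
      by (rule K1) (use z xy n(1) in \<open>auto intro: difference_setI simp: algebra_simps\<close>)
    moreover have "\<bar>h (n (s + t)) - h (z - y)\<bar> \<le> K2"
    proof (rule K2)
      have eq: "((n (s + t) - (s + t)) - (n s - s)) + (t - n t) - (z - (x + n t)) = n (s + t) - (z - y)"
        using xy(3) by (simp add: algebra_simps)
      show "norm (n (s + t) - (z - y)) \<le> 4 * R"
        using norm_add_diff_le[of "(n (s + t) - (s + t)) - (n s - s)" "t - n t" "z - (x + n t)", unfolded eq]
          norm_triangle_ineq4[of "n (s + t) - (s + t)" "n s - s"] norm_minus_commute[of t "n t"]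
          n(2)[of s] n(2)[of t] n(2)[of "s + t"] z(2) by linarith
    qed (use z xy n(1) in \<open>auto intro: difference_setI\<close>)
    moreover have "h ((z - x) + (x - y)) = h (z - x) + h (x - y)"
      by (rule additive_on_add[OF add]) (use z xy in \<open>auto intro: difference_in_group\<close>)
    ultimately show ?thesis using xy(3) by simp
  qed
  moreover have "\<exists>B. \<forall>x. norm x \<le> \<rho> \<longrightarrow> \<bar>h (n x)\<bar> \<le> B" for \<rho>
  proof -
    obtain K where K: "\<And>u. u \<in> difference_set \<Lambda> \<Longrightarrow> norm u \<le> \<rho> + R \<Longrightarrow> \<bar>h u\<bar> \<le> K"
      using additive_bounded_on_patch[OF me, of "\<rho> + R" h] by metis
    have "\<bar>h (n x)\<bar> \<le> K" if "norm x \<le> \<rho>" for x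
    proof (rule K[OF n(1)])
      show "norm (n x) \<le> \<rho> + R" using norm_triangle_ineq[of "n x - x" x] n(2)[of x] that by simp
    qed
    then show ?thesis by blast
  qed
  ultimately obtain l where l: "linear l" "\<And>x. \<bar>h (n x) - l x\<bar> \<le> K1 + K2"
    using quasi_additive_near_linear[of "\<lambda>t. h (n t)" "K1 + K2"] by blast
  have "\<bar>h u - l u\<bar> \<le> K1 + (K1 + K2)" if "u \<in> difference_set \<Lambda>" for u
  proof -
    have "\<bar>h (n u) - h u\<bar> \<le> K1" using K1[OF n(1) that n(2)] .
    then show ?thesis using l(2)[of u] by linarith
  qed
  then show ?thesis using l(1) by blast
qed

text \<open>The difference set is relatively dense, so a linear map bounded on it is bounded
  everywhere and hence zero. This yields uniqueness of the linear part and exact identities such as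
  \<open>combine_lin\<close> and \<open>project_lin\<close>.\<close>

lemma linear_bounded_on_difference_set:
  fixes \<Lambda> :: "'a::euclidean_space set" and l :: "'a \<Rightarrow> 'b::real_normed_vector"
  assumes me: "meyer \<Lambda>" and l: "linear l" and C: "\<And>u. u \<in> difference_set \<Lambda> \<Longrightarrow> norm (l u) \<le> C"
  shows "l t = 0"
proof -
  obtain R where R: "R > 0" "\<And>c. \<exists>x\<in>\<Lambda>. norm (x - c) \<le> R" using meyerE[OF me] by metis
  obtain B where B: "\<And>x. norm (l x) \<le> B * norm x" "B > 0" using linear_bounded_pos[OF l] by blast
  have bound: "norm (l t) \<le> C + B * R" for t
  proof -
    obtain y where y: "y \<in> \<Lambda>" using R(2) by blast
    obtain x where x: "x \<in> \<Lambda>" "norm (x - (y + t)) \<le> R" using R(2) by blast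
    have t: "t = (x - y) - (x - (y + t))" by simp
    have "norm (l t) \<le> norm (l (x - y)) + norm (l (x - (y + t)))"
      by (subst t, subst linear_diff[OF l]) (rule norm_triangle_ineq4)
    also have "\<dots> \<le> C + B * R"
    proof (rule add_mono[OF C[OF difference_setI[OF x(1) y]]])
      have "B * norm (x - (y + t)) \<le> B * R" using x(2) B(2) by simp
      then show "norm (l (x - (y + t))) \<le> B * R" using B(1)[of "x - (y + t)"] by linarith
    qed
    finally show ?thesis .
  qed
  show ?thesis
  proof (rule ccontr)
    assume "l t \<noteq> 0"
    then have "norm (l t) > 0" by simp
    then obtain n where n: "C + B * R < real n * norm (l t)" using reals_Archimedean3 by blast
    have "norm (l (real n *\<^sub>R t)) = real n * norm (l t)" using linear_cmul[OF l, of "real n" t] by simp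
    then show False using bound[of "real n *\<^sub>R t"] n by linarith
  qed
qed

section \<open>Patches and the transversal\<close>

definition agree :: "real \<Rightarrow> 'a::euclidean_space set \<Rightarrow> 'a set \<Rightarrow> bool"
  where "agree \<rho> A B \<longleftrightarrow> A \<inter> cball 0 \<rho> = B \<inter> cball 0 \<rho>"

lemma agree_iff: "agree \<rho> A B \<longleftrightarrow> (\<forall>x. norm x \<le> \<rho> \<longrightarrow> (x \<in> A \<longleftrightarrow> x \<in> B))"
  unfolding agree_def by (auto simp: set_eq_iff)

lemma agree_refl: "agree \<rho> A A"
  by (simp add: agree_def)

lemma agree_sym: "agree \<rho> A B \<Longrightarrow> agree \<rho> B A"
  by (simp add: agree_def)

lemma agree_trans: "agree \<rho> A B \<Longrightarrow> agree \<rho> B C \<Longrightarrow> agree \<rho> A C"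
  by (simp add: agree_def)

lemma agree_mono: "agree \<rho> A B \<Longrightarrow> \<rho>' \<le> \<rho> \<Longrightarrow> agree \<rho>' A B"
  unfolding agree_iff by auto

lemma agreeD: "agree \<rho> A B \<Longrightarrow> norm x \<le> \<rho> \<Longrightarrow> x \<in> A \<longleftrightarrow> x \<in> B"
  unfolding agree_iff by blast

lemma agree_translate:
  assumes "agree \<rho> A B" "\<rho>' + norm t \<le> \<rho>"
  shows "agree \<rho>' (translate A t) (translate B t)"
proof (unfold agree_iff mem_translate, intro allI impI)
  fix x :: 'a assume "norm x \<le> \<rho>'"
  then have "norm (x + t) \<le> \<rho>" using norm_triangle_ineq[of x t] assms(2) by linarith
  then show "x + t \<in> A \<longleftrightarrow> x + t \<in> B" using assms(1) agreeD by blast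
qed

lemma translate_0: "translate A 0 = A"
  unfolding translate_def by simp

lemma translate_cancel [simp]: "translate (translate A t) (- t) = A" "translate (translate A (- t)) t = A"
  by (simp_all add: translate_translate translate_0)

lemma translate_patch_eq: "translate (patch A t \<rho>) t = translate A t \<inter> cball 0 \<rho>"
  by (auto simp: mem_translate patch_def dist_norm)

lemma hull_of_iff:
  "A \<in> hull_of \<Lambda> \<longleftrightarrow> delone A \<and> (\<forall>\<rho>>0. \<forall>t. \<exists>t'. agree \<rho> (translate A t) (translate \<Lambda> t'))"
  unfolding hull_of_def agree_def translate_patch_eq by blast

lemma repetitive_iff:
  "repetitive \<Lambda> \<longleftrightarrow> (\<forall>\<rho>>0. \<exists>M>0. \<forall>c t. \<exists>t'. norm (t' - c) \<le> M \<and> agree \<rho> (translate \<Lambda> t') (translate \<Lambda> t))"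
  unfolding repetitive_def agree_def translate_patch_eq by (simp add: Bex_def dist_norm norm_minus_commute)

text \<open>The normalisation \<open>0 \<in> \<Lambda>\<close> puts \<Lambda> into its own
  transversal and its points into \<open>L\<close>, so that each of them has coordinates and a
  star.\<close>

locale repetitive_meyer =
  fixes \<Lambda> :: "'a::euclidean_space set"
  assumes meyer: "meyer \<Lambda>" and repetitive: "repetitive \<Lambda>" and zero_mem: "0 \<in> \<Lambda>"
begin

abbreviation D :: "'a set" where "D \<equiv> difference_set \<Lambda>"
abbreviation L :: "'a set" where "L \<equiv> difference_group \<Lambda>"
abbreviation \<Xi> :: "'a set set" where "\<Xi> \<equiv> transversal \<Lambda>"

lemma mem_L: "x \<in> \<Lambda> \<Longrightarrow> x \<in> L"
  using difference_in_group[of x \<Lambda> 0] zero_mem by simp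

lemma base_hull: "\<Lambda> \<in> hull_of \<Lambda>"
  unfolding hull_of_iff using meyer agree_refl unfolding meyer_def by blast

lemma base_transversal: "\<Lambda> \<in> \<Xi>"
  unfolding transversal_def using base_hull zero_mem by simp

lemma transversal_hull: "A \<in> \<Xi> \<Longrightarrow> A \<in> hull_of \<Lambda>"
  by (simp add: transversal_def)

lemma transversal_zero: "A \<in> \<Xi> \<Longrightarrow> 0 \<in> A"
  by (simp add: transversal_def)

lemma hull_translate_transversal: "A \<in> hull_of \<Lambda> \<Longrightarrow> x \<in> A \<Longrightarrow> translate A x \<in> \<Xi>"
  by (simp add: transversal_def hull_of_translate mem_translate)

lemma transversal_translate: "A \<in> \<Xi> \<Longrightarrow> x \<in> A \<Longrightarrow> translate A x \<in> \<Xi>"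
  by (rule hull_translate_transversal[OF transversal_hull])

lemma transversal_patch:
  assumes "A \<in> \<Xi>" shows "\<exists>x\<in>\<Lambda>. agree \<rho> A (translate \<Lambda> x)"
proof -
  have "max \<rho> 1 > 0" by simp
  then obtain x where x: "agree (max \<rho> 1) (translate A 0) (translate \<Lambda> x)"
    using transversal_hull[OF assms] unfolding hull_of_iff by blast
  then have "0 \<in> translate \<Lambda> x" using agreeD[OF x, of 0] transversal_zero[OF assms] by (simp add: translate_0)
  then have "x \<in> \<Lambda>" by (simp add: mem_translate)
  then show ?thesis using agree_mono[OF x, of \<rho>] by (auto simp: translate_0)
qed

lemma relatively_dense: "\<exists>R>0. \<forall>c. \<exists>x\<in>\<Lambda>. norm (x - c) \<le> R"
  using meyerE[OF meyer] by metis

text \<open>Being Delone is checked on single patches, with the constants of \<Lambda>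
  itself.\<close>

lemma transversalI:
  assumes 0: "0 \<in> A" and patch: "\<And>\<rho>. \<exists>x\<in>\<Lambda>. agree \<rho> A (translate \<Lambda> x)"
  shows "A \<in> \<Xi>"
proof -
  obtain r R where r: "r > 0" "\<And>c x y. x \<in> \<Lambda> \<inter> cball c r \<Longrightarrow> y \<in> \<Lambda> \<inter> cball c r \<Longrightarrow> x = y"
    and R: "R > 0" "\<And>c. \<Lambda> \<inter> cball c R \<noteq> {}"
    using meyer unfolding meyer_def delone_def by metis
  have norm_le: "norm x \<le> norm c + \<rho>" if "x \<in> cball c \<rho>" for x c :: 'a and \<rho>
    using that norm_triangle_ineq[of c "x - c"] by (simp add: dist_norm norm_minus_commute)
  have "x = y" if "x \<in> A \<inter> cball c r" "y \<in> A \<inter> cball c r" for c x y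
  proof -
    obtain z where z: "agree (norm c + r) A (translate \<Lambda> z)" using patch by blast
    have "x + z \<in> \<Lambda>" "y + z \<in> \<Lambda>"
      using that agreeD[OF z, of x] agreeD[OF z, of y] norm_le by (auto simp: mem_translate)
    then have "x + z \<in> \<Lambda> \<inter> cball (c + z) r" "y + z \<in> \<Lambda> \<inter> cball (c + z) r"
      using that by (auto simp: dist_norm)
    then have "x + z = y + z" by (rule r(2))
    then show ?thesis by simp
  qed
  moreover have "A \<inter> cball c R \<noteq> {}" for c
  proof -
    obtain z where z: "agree (norm c + R) A (translate \<Lambda> z)" using patch by blast
    obtain y where "y \<in> \<Lambda> \<inter> cball (c + z) R" using R(2) by blast
    then have "y - z \<in> cball c R" "y - z \<in> translate \<Lambda> z" by (auto simp: dist_norm mem_translate algebra_simps)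
    then have "y - z \<in> A \<inter> cball c R" using agreeD[OF z norm_le] by blast
    then show ?thesis by blast
  qed
  ultimately have "delone A" unfolding delone_def using r(1) R(1) by blast
  moreover have "\<exists>t'. agree \<rho> (translate A t) (translate \<Lambda> t')" for \<rho> t
  proof -
    obtain z where "agree (\<rho> + norm t) A (translate \<Lambda> z)" using patch by blast
    then have "agree \<rho> (translate A t) (translate \<Lambda> (z + t))"
      using agree_translate[of "\<rho> + norm t" A "translate \<Lambda> z" \<rho> t] by (simp add: translate_translate)
    then show ?thesis by blast
  qed
  ultimately show ?thesis using 0 unfolding transversal_def hull_of_iff by blast
qed

lemma transversal_diff:
  assumes A: "A \<in> \<Xi>" and x: "x \<in> A" and y: "y \<in> A" shows "x - y \<in> D"
proof -
  obtain z where z: "agree (max (norm x) (norm y)) A (translate \<Lambda> z)" using transversal_patch[OF A] by blast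
  have "x + z \<in> \<Lambda>" "y + z \<in> \<Lambda>"
    using agreeD[OF z, of x] agreeD[OF z, of y] x y by (auto simp: mem_translate)
  then show ?thesis using difference_setI[of "x + z" \<Lambda> "y + z"] by simp
qed

lemma transversal_subset: "A \<in> \<Xi> \<Longrightarrow> A \<subseteq> D"
  using transversal_diff[of A _ 0] transversal_zero by auto

lemma transversal_subset_L: "A \<in> \<Xi> \<Longrightarrow> A \<subseteq> L"
  using transversal_subset difference_set_group by blast

lemma hull_dense:
  "\<exists>R>0. \<forall>A\<in>hull_of \<Lambda>. \<forall>c. \<exists>x\<in>A. norm (x - c) \<le> R"
proof -
  obtain R where R: "R > 0" "\<And>c. \<exists>x\<in>\<Lambda>. norm (x - c) \<le> R" using relatively_dense by blast
  have "\<exists>x\<in>A. norm (x - c) \<le> R" if A: "A \<in> hull_of \<Lambda>" for A c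
  proof -
    obtain z where z: "agree R (translate A c) (translate \<Lambda> z)"
      using A R(1) unfolding hull_of_iff by blast
    obtain x where x: "x \<in> \<Lambda>" "norm (x - z) \<le> R" using R(2) by blast
    then have "x - z \<in> translate A c" using agreeD[OF z, of "x - z"] by (simp add: mem_translate)
    then show ?thesis using x(2) by (intro bexI[of _ "x - z + c"]) (auto simp: mem_translate)
  qed
  then show ?thesis using R(1) by blast
qed

lemma hull_nonempty: "A \<in> hull_of \<Lambda> \<Longrightarrow> A \<noteq> {}"
  using hull_dense by blast

text \<open>A large patch of \<open>B\<close> around 0 is a patch of \<Lambda>, and repetitivity
  finds the patch of \<open>A\<close> inside it. As \<open>M\<close> depends on \<rho> only, this is
  minimality in uniform form.\<close>

lemma transversal_minimal:
  "\<exists>M. \<forall>A\<in>\<Xi>. \<forall>B\<in>\<Xi>. \<exists>z\<in>B. norm z \<le> M \<and> agree \<rho> (translate B z) A"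
proof -
  \<comment> \<open>Positive, as \<open>repetitive\<close> demands; then agreement at 0 shows that
    the place found is a point of \<open>B\<close>.\<close>
  define \<rho>' where "\<rho>' = max \<rho> 1"
  have "\<rho>' > 0" "\<rho> \<le> \<rho>'" unfolding \<rho>'_def by auto
  then obtain M where M: "M > 0" "\<And>c t. \<exists>t'. norm (t' - c) \<le> M \<and> agree \<rho>' (translate \<Lambda> t') (translate \<Lambda> t)"
    using repetitive unfolding repetitive_iff by blast
  have "\<exists>z\<in>B. norm z \<le> M \<and> agree \<rho> (translate B z) A" if A: "A \<in> \<Xi>" and B: "B \<in> \<Xi>" for A B
  proof -
    obtain x where x: "x \<in> \<Lambda>" "agree \<rho>' A (translate \<Lambda> x)" using transversal_patch[OF A] by blast
    obtain y where y: "y \<in> \<Lambda>" "agree (\<rho>' + M) B (translate \<Lambda> y)" using transversal_patch[OF B] by blast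
    obtain t where t: "norm (t - y) \<le> M" "agree \<rho>' (translate \<Lambda> t) (translate \<Lambda> x)" using M(2) by blast
    have "agree \<rho>' (translate B (t - y)) (translate (translate \<Lambda> y) (t - y))"
      by (rule agree_translate[OF y(2)]) (use t(1) in simp)
    then have *: "agree \<rho>' (translate B (t - y)) A"
      using t(2) x(2) by (auto simp: translate_translate intro: agree_trans agree_sym)
    then have "t - y \<in> B"
      using agreeD[OF *, of 0] transversal_zero[OF A] \<open>\<rho>' > 0\<close> by (simp add: mem_translate)
    then show ?thesis using t(1) agree_mono[OF * \<open>\<rho> \<le> \<rho>'\<close>] by blast
  qed
  then show ?thesis by blast
qed

subsection \<open>Patch-continuous functions\<close>

text \<open>Uniform continuity for the local topology, phrased without a metric. Members of the
  transversal lie in the uniformly discrete difference set, so closeness is agreement on a large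
  ball, without small translations.\<close>

definition patch_continuous :: "('a set \<Rightarrow> real) \<Rightarrow> bool"
  where "patch_continuous f \<longleftrightarrow> (\<forall>\<epsilon>>0. \<exists>\<rho>. \<forall>A\<in>\<Xi>. \<forall>B\<in>\<Xi>. agree \<rho> A B \<longrightarrow> \<bar>f A - f B\<bar> < \<epsilon>)"

lemma patch_continuousD:
  assumes "patch_continuous f" "\<epsilon> > 0"
  obtains \<rho> where "\<And>A B. A \<in> \<Xi> \<Longrightarrow> B \<in> \<Xi> \<Longrightarrow> agree \<rho> A B \<Longrightarrow> \<bar>f A - f B\<bar> < \<epsilon>"
  using assms unfolding patch_continuous_def by blast

lemma patch_continuous_const: "patch_continuous (\<lambda>_. c)"
  unfolding patch_continuous_def by simp

lemma patch_continuous_add: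
  assumes "patch_continuous f" "patch_continuous g" shows "patch_continuous (\<lambda>A. f A + g A)"
  unfolding patch_continuous_def
proof (intro allI impI)
  fix \<epsilon> :: real assume "\<epsilon> > 0"
  then have e: "\<epsilon> / 2 > 0" by simp
  obtain \<rho>1 where 1: "\<And>A B. A \<in> \<Xi> \<Longrightarrow> B \<in> \<Xi> \<Longrightarrow> agree \<rho>1 A B \<Longrightarrow> \<bar>f A - f B\<bar> < \<epsilon> / 2"
    using patch_continuousD[OF assms(1) e] by metis
  obtain \<rho>2 where 2: "\<And>A B. A \<in> \<Xi> \<Longrightarrow> B \<in> \<Xi> \<Longrightarrow> agree \<rho>2 A B \<Longrightarrow> \<bar>g A - g B\<bar> < \<epsilon> / 2"
    using patch_continuousD[OF assms(2) e] by metis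
  have "\<bar>f A + g A - (f B + g B)\<bar> < \<epsilon>" if "A \<in> \<Xi>" "B \<in> \<Xi>" "agree (max \<rho>1 \<rho>2) A B" for A B
  proof -
    have "\<bar>f A - f B\<bar> < \<epsilon> / 2" "\<bar>g A - g B\<bar> < \<epsilon> / 2"
      using 1 2 that agree_mono[OF that(3), of \<rho>1] agree_mono[OF that(3), of \<rho>2] by auto
    then show ?thesis by linarith
  qed
  then show "\<exists>\<rho>. \<forall>A\<in>\<Xi>. \<forall>B\<in>\<Xi>. agree \<rho> A B \<longrightarrow> \<bar>f A + g A - (f B + g B)\<bar> < \<epsilon>" by blast
qed

lemma patch_continuous_cmult:
  assumes "patch_continuous f" shows "patch_continuous (\<lambda>A. c * f A)"
  unfolding patch_continuous_def
proof (intro allI impI)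
  fix \<epsilon> :: real assume "\<epsilon> > 0"
  then have e: "\<epsilon> / (\<bar>c\<bar> + 1) > 0" by simp
  obtain \<rho> where \<rho>: "\<And>A B. A \<in> \<Xi> \<Longrightarrow> B \<in> \<Xi> \<Longrightarrow> agree \<rho> A B \<Longrightarrow> \<bar>f A - f B\<bar> < \<epsilon> / (\<bar>c\<bar> + 1)"
    using patch_continuousD[OF assms e] by metis
  have "\<bar>c * f A - c * f B\<bar> < \<epsilon>" if "A \<in> \<Xi>" "B \<in> \<Xi>" "agree \<rho> A B" for A B
  proof -
    have "\<bar>c * f A - c * f B\<bar> = \<bar>c\<bar> * \<bar>f A - f B\<bar>" by (simp flip: right_diff_distrib add: abs_mult)
    also have "\<dots> \<le> (\<bar>c\<bar> + 1) * \<bar>f A - f B\<bar>" by (simp add: mult_right_mono)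
    also have "\<dots> < \<epsilon>" using \<rho>[OF that] by (simp add: field_simps)
    finally show ?thesis .
  qed
  then show "\<exists>\<rho>. \<forall>A\<in>\<Xi>. \<forall>B\<in>\<Xi>. agree \<rho> A B \<longrightarrow> \<bar>c * f A - c * f B\<bar> < \<epsilon>" by blast
qed

lemma patch_continuous_abs:
  assumes "patch_continuous f" shows "patch_continuous (\<lambda>A. \<bar>f A\<bar>)"
  unfolding patch_continuous_def
proof (intro allI impI)
  fix \<epsilon> :: real assume e: "\<epsilon> > 0"
  obtain \<rho> where \<rho>: "\<And>A B. A \<in> \<Xi> \<Longrightarrow> B \<in> \<Xi> \<Longrightarrow> agree \<rho> A B \<Longrightarrow> \<bar>f A - f B\<bar> < \<epsilon>"
    using patch_continuousD[OF assms e] by metis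
  have "\<bar>\<bar>f A\<bar> - \<bar>f B\<bar>\<bar> < \<epsilon>" if "A \<in> \<Xi>" "B \<in> \<Xi>" "agree \<rho> A B" for A B
    using \<rho>[OF that] by linarith
  then show "\<exists>\<rho>. \<forall>A\<in>\<Xi>. \<forall>B\<in>\<Xi>. agree \<rho> A B \<longrightarrow> \<bar>\<bar>f A\<bar> - \<bar>f B\<bar>\<bar> < \<epsilon>" by blast
qed

lemma patch_continuous_diff:
  assumes "patch_continuous f" "patch_continuous g" shows "patch_continuous (\<lambda>A. f A - g A)"
  using patch_continuous_add[OF assms(1) patch_continuous_cmult[OF assms(2), of "-1"]] by simp

lemma patch_continuous_sum:
  assumes "\<And>i. i \<in> I \<Longrightarrow> patch_continuous (f i)" shows "patch_continuous (\<lambda>A. \<Sum>i\<in>I. f i A)"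
  using assms by (induction I rule: infinite_finite_induct)
    (auto intro: patch_continuous_const patch_continuous_add)

text \<open>The translates of \<Lambda> by its own points are dense in the transversal, so
  identities between continuous functions can be checked on them.\<close>

lemma patch_continuous_eq_0:
  assumes f: "patch_continuous f" and 0: "\<And>x. x \<in> \<Lambda> \<Longrightarrow> f (translate \<Lambda> x) = 0" and A: "A \<in> \<Xi>"
  shows "f A = 0"
proof (rule ccontr)
  assume "f A \<noteq> 0"
  then have "\<bar>f A\<bar> > 0" by simp
  then obtain \<rho> where \<rho>: "\<And>A' B. A' \<in> \<Xi> \<Longrightarrow> B \<in> \<Xi> \<Longrightarrow> agree \<rho> A' B \<Longrightarrow> \<bar>f A' - f B\<bar> < \<bar>f A\<bar>"
    using patch_continuousD[OF f] by metis
  obtain x where "x \<in> \<Lambda>" "agree \<rho> A (translate \<Lambda> x)" using transversal_patch[OF A] by blast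
  then show False using \<rho>[OF A transversal_translate[OF base_transversal]] 0 by force
qed

text \<open>A bounded cocycle over a minimal system is a coboundary (Gottschalk and Hedlund). Here the
  coboundary is minus the supremum of \<open>\<psi>\<close>; it is continuous since a pair in \<open>\<Lambda>\<close> whose difference
  nearly maximises \<open>\<psi>\<close> on \<open>\<Lambda> - \<Lambda>\<close> recurs with bounded gaps.\<close>

lemma bounded_additive_coboundary:
  assumes add: "additive_on L \<psi>" and C: "\<And>u. u \<in> D \<Longrightarrow> \<bar>\<psi> u\<bar> \<le> C"
  obtains g where "g \<Lambda> = 0" "\<And>A x. A \<in> \<Xi> \<Longrightarrow> x \<in> A \<Longrightarrow> g (translate A x) = g A + \<psi> x" "patch_continuous g"
proof -
  define \<tau> where "\<tau> A = Sup (\<psi> ` A)" for A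
  have bdd: "bdd_above (\<psi> ` A)" if "A \<in> \<Xi>" for A
    unfolding bdd_above_def using C transversal_subset[OF that]
    by (intro exI[of _ C]) (auto simp: abs_le_iff)
  have le_\<tau>: "\<psi> x \<le> \<tau> A" if "A \<in> \<Xi>" "x \<in> A" for A x
    unfolding \<tau>_def by (rule cSup_upper) (use that bdd in auto)
  have \<tau>_le: "\<tau> A \<le> m" if "A \<in> \<Xi>" "\<And>x. x \<in> A \<Longrightarrow> \<psi> x \<le> m" for A m
    unfolding \<tau>_def by (rule cSup_least) (use that transversal_zero in auto)
  have coc: "\<tau> (translate A x) = \<tau> A - \<psi> x" if A: "A \<in> \<Xi>" and x: "x \<in> A" for A x
  proof (rule antisym)
    have AL: "A \<subseteq> L" using transversal_subset_L[OF A] .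
    note Ax = transversal_translate[OF A x]
    show "\<tau> (translate A x) \<le> \<tau> A - \<psi> x"
    proof (rule \<tau>_le[OF Ax])
      fix y assume "y \<in> translate A x"
      then have y: "y + x \<in> A" by (simp add: mem_translate)
      have "\<psi> ((y + x) - x) = \<psi> (y + x) - \<psi> x" by (rule additive_on_diff[OF add]) (use y x AL in auto)
      then show "\<psi> y \<le> \<tau> A - \<psi> x" using le_\<tau>[OF A y] by simp
    qed
    have "\<tau> A \<le> \<tau> (translate A x) + \<psi> x"
    proof (rule \<tau>_le[OF A])
      fix y assume y: "y \<in> A"
      have "\<psi> (y - x) = \<psi> y - \<psi> x" by (rule additive_on_diff[OF add]) (use y x AL in auto)
      moreover have "y - x \<in> translate A x" using y by (simp add: mem_translate)
      ultimately show "\<psi> y \<le> \<tau> (translate A x) + \<psi> x" using le_\<tau>[OF Ax, of "y - x"] by simp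
    qed
    then show "\<tau> A - \<psi> x \<le> \<tau> (translate A x)" by simp
  qed
  \<comment> \<open>For \<open>x \<in> B\<close> the value \<open>\<psi> x - \<psi> (e + z)\<close>
    is at most the supremum over \<open>D\<close>, while
    \<open>\<psi> (f + z) - \<psi> (e + z) = \<psi> u\<close> misses that supremum by less than
    \<epsilon>. So \<open>f + z\<close>, found within a bounded distance, nearly maximises \<psi> on
    \<open>B\<close>.\<close>
  have near: "\<exists>\<rho>. \<forall>B\<in>\<Xi>. \<exists>x\<in>B. norm x \<le> \<rho> \<and> \<tau> B \<le> \<psi> x + \<epsilon>" if "\<epsilon> > 0" for \<epsilon>
  proof -
    have ne: "D \<noteq> {}" using difference_setI[OF zero_mem zero_mem] by blast
    have bD: "bdd_above (\<psi> ` D)" unfolding bdd_above_def using C by (intro exI[of _ C]) (auto simp: abs_le_iff)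
    have "Sup (\<psi> ` D) - \<epsilon> < Sup (\<psi> ` D)" using that by simp
    then obtain v where "v \<in> \<psi> ` D" "Sup (\<psi> ` D) - \<epsilon> < v"
      using less_cSupE[of "Sup (\<psi> ` D) - \<epsilon>" "\<psi> ` D"] ne by blast
    then obtain u where u: "u \<in> D" "Sup (\<psi> ` D) - \<epsilon> < \<psi> u" by blast
    obtain f e where fe: "f \<in> \<Lambda>" "e \<in> \<Lambda>" "u = f - e" using u(1) by (rule difference_setE)
    obtain M where M: "\<And>B. B \<in> \<Xi> \<Longrightarrow> \<exists>z\<in>B. norm z \<le> M \<and> agree (max (norm f) (norm e)) (translate B z) \<Lambda>"
      using transversal_minimal[of "max (norm f) (norm e)"] base_transversal by blast
    have "\<exists>x\<in>B. norm x \<le> M + norm f \<and> \<tau> B \<le> \<psi> x + \<epsilon>" if B: "B \<in> \<Xi>" for B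
    proof -
      obtain z where z: "z \<in> B" "norm z \<le> M" "agree (max (norm f) (norm e)) (translate B z) \<Lambda>"
        using M[OF B] by blast
      have BL: "B \<subseteq> L" using transversal_subset_L[OF B] .
      have zf: "f + z \<in> B" using agreeD[OF z(3), of f] fe by (simp add: mem_translate)
      have ze: "e + z \<in> B" using agreeD[OF z(3), of e] fe by (simp add: mem_translate)
      have "\<psi> ((f + z) - (e + z)) = \<psi> (f + z) - \<psi> (e + z)" by (rule additive_on_diff[OF add]) (use zf ze BL in auto)
      then have 1: "\<psi> (f + z) - \<psi> (e + z) = \<psi> u" using fe by simp
      have "\<tau> B \<le> \<psi> (f + z) + \<epsilon>"
      proof (rule \<tau>_le[OF B])
        fix x assume x: "x \<in> B"
        have "\<psi> (x - (e + z)) = \<psi> x - \<psi> (e + z)" by (rule additive_on_diff[OF add]) (use x ze BL in auto)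
        moreover have "\<psi> (x - (e + z)) \<le> Sup (\<psi> ` D)"
          by (rule cSup_upper) (use transversal_diff[OF B x ze] bD in auto)
        ultimately show "\<psi> x \<le> \<psi> (f + z) + \<epsilon>" using 1 u(2) by linarith
      qed
      moreover have "norm (f + z) \<le> M + norm f" using z(2) norm_triangle_ineq[of f z] by linarith
      ultimately show ?thesis using zf by blast
    qed
    then show ?thesis by blast
  qed
  define g where "g A = \<tau> \<Lambda> - \<tau> A" for A
  have "patch_continuous g"
    unfolding patch_continuous_def
  proof (intro allI impI)
    fix \<epsilon> :: real assume "\<epsilon> > 0"
    then obtain \<rho> where \<rho>: "\<And>B. B \<in> \<Xi> \<Longrightarrow> \<exists>x\<in>B. norm x \<le> \<rho> \<and> \<tau> B \<le> \<psi> x + \<epsilon> / 2"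
      using near[of "\<epsilon> / 2"] by auto
    have one: "\<tau> A \<le> \<tau> B + \<epsilon> / 2" if AB: "A \<in> \<Xi>" "B \<in> \<Xi>" "agree \<rho> A B" for A B
    proof -
      obtain x where x: "x \<in> A" "norm x \<le> \<rho>" "\<tau> A \<le> \<psi> x + \<epsilon> / 2" using \<rho>[OF AB(1)] by blast
      then have "x \<in> B" using agreeD[OF AB(3)] by blast
      then have "\<psi> x \<le> \<tau> B" by (rule le_\<tau>[OF AB(2)])
      then show ?thesis using x(3) by linarith
    qed
    have "\<bar>g A - g B\<bar> < \<epsilon>" if "A \<in> \<Xi>" "B \<in> \<Xi>" "agree \<rho> A B" for A B
      using one[OF that] one[OF that(2,1) agree_sym[OF that(3)]] \<open>\<epsilon> > 0\<close> unfolding g_def by linarith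
    then show "\<exists>\<rho>. \<forall>A\<in>\<Xi>. \<forall>B\<in>\<Xi>. agree \<rho> A B \<longrightarrow> \<bar>g A - g B\<bar> < \<epsilon>" by blast
  qed
  then show ?thesis using that[of g] coc unfolding g_def by simp
qed

subsection \<open>Compactness\<close>

text \<open>Subsets of the transversal are represented by their characteristic functions.\<close>

definition patch_topology :: "('a \<Rightarrow> bool) topology"
  where "patch_topology = subtopology (product_topology (\<lambda>_. discrete_topology UNIV) UNIV) {f. Collect f \<in> \<Xi>}"

lemma topspace_patch_topology: "topspace patch_topology = {f. Collect f \<in> \<Xi>}"
  unfolding patch_topology_def by simp

lemma finite_patch: "finite (D \<inter> cball 0 \<rho>)"
  using meyerE[OF meyer] by metis

lemma clopen_coordinate:
  "openin (product_topology (\<lambda>_. discrete_topology UNIV) UNIV) {f :: 'a \<Rightarrow> bool. f x = v}"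
  "closedin (product_topology (\<lambda>_. discrete_topology UNIV) UNIV) {f :: 'a \<Rightarrow> bool. f x = v}"
proof -
  have c: "continuous_map (product_topology (\<lambda>_::'a. discrete_topology (UNIV::bool set)) UNIV) (discrete_topology UNIV) (\<lambda>f. f x)"
    by (rule continuous_map_product_projection) simp
  show "openin (product_topology (\<lambda>_. discrete_topology UNIV) UNIV) {f :: 'a \<Rightarrow> bool. f x = v}"
    using openin_continuous_map_preimage[OF c, of "{v}"] by simp
  show "closedin (product_topology (\<lambda>_. discrete_topology UNIV) UNIV) {f :: 'a \<Rightarrow> bool. f x = v}"
    using closedin_continuous_map_preimage[OF c, of "{v}"] by simp
qed

text \<open>By Tychonoff's theorem it suffices that the transversal is closed in the product. It is
  cut out by \<open>T\<close>, support in \<open>D\<close>, and by the conditions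
  \<open>S m\<close>, that the \<open>m\<close>-patch is one of those of \<Lambda>; each
  \<open>S m\<close> is closed because there are only finitely many such patches.\<close>

lemma compact_patch_topology: "compact_space patch_topology"
proof -
  let ?X = "product_topology (\<lambda>_::'a. discrete_topology (UNIV::bool set)) UNIV"
  define P where "P m = (\<lambda>x. translate \<Lambda> x \<inter> cball 0 (real m)) ` \<Lambda>" for m :: nat
  have P_sub: "p \<subseteq> D \<inter> cball 0 (real m)" if "p \<in> P m" for p m
    using that transversal_subset[OF transversal_translate[OF base_transversal]] unfolding P_def by auto
  have finP: "finite (P m)" for m
    by (rule finite_subset[OF _ finite_Pow_iff[THEN iffD2, OF finite_patch[of "real m"]]]) (use P_sub in blast)
  \<comment> \<open>Inserting 0 makes the index set of the intersection visibly nonempty and lets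
    the value \<open>f 0\<close> be read off.\<close>
  define S where "S m = (\<Union>p\<in>P m. \<Inter>x\<in>insert 0 (D \<inter> cball 0 (real m)). {f. f x = (x \<in> p)})" for m
  have closedS: "closedin ?X (S m)" for m
    unfolding S_def
  proof (rule closedin_Union)
    show "finite ((\<lambda>p. \<Inter>x\<in>insert 0 (D \<inter> cball 0 (real m)). {f. f x = (x \<in> p)}) ` P m)"
      using finP by blast
    fix T assume "T \<in> (\<lambda>p. \<Inter>x\<in>insert 0 (D \<inter> cball 0 (real m)). {f. f x = (x \<in> p)}) ` P m"
    then obtain p where T: "T = (\<Inter>x\<in>insert 0 (D \<inter> cball 0 (real m)). {f. f x = (x \<in> p)})" by blast
    show "closedin ?X T"
      unfolding T by (rule closedin_INT, rule insert_not_empty, rule clopen_coordinate(2))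
  qed
  define T where "T = (\<Inter>x. if x \<in> D then UNIV else {f. f x = False})"
  have closedT: "closedin ?X T"
    unfolding T_def
  proof (rule closedin_INT, rule UNIV_not_empty)
    fix x
    show "closedin ?X (if x \<in> D then UNIV else {f. f x = False})"
      using clopen_coordinate(2)[of x False] closedin_topspace[of ?X] by simp
  qed
  have eq: "{f. Collect f \<in> \<Xi>} = T \<inter> (\<Inter>m. S m)"
  proof (intro set_eqI iffI)
    fix f assume "f \<in> {f. Collect f \<in> \<Xi>}"
    then have f: "Collect f \<in> \<Xi>" by simp
    then have "f \<in> (if x \<in> D then UNIV else {f. f x = False})" for x using transversal_subset by auto
    then have "f \<in> T" unfolding T_def by (intro INT_I)
    moreover have "f \<in> S m" for m
    proof -
      obtain x where x: "x \<in> \<Lambda>" "agree (real m) (Collect f) (translate \<Lambda> x)" using transversal_patch[OF f] by blast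
      have "f y = (y \<in> translate \<Lambda> x \<inter> cball 0 (real m))" if "y \<in> insert 0 (D \<inter> cball 0 (real m))" for y
        using agreeD[OF x(2), of y] that by auto
      then have "f \<in> (\<Inter>y\<in>insert 0 (D \<inter> cball 0 (real m)). {f. f y = (y \<in> translate \<Lambda> x \<inter> cball 0 (real m))})"
        by (intro INT_I) simp
      then show ?thesis unfolding S_def P_def using x(1) by (intro UN_I[of "translate \<Lambda> x \<inter> cball 0 (real m)"]) auto
    qed
    ultimately show "f \<in> T \<inter> (\<Inter>m. S m)" by blast
  next
    fix f assume f: "f \<in> T \<inter> (\<Inter>m. S m)"
    have fD: "x \<in> D" if "f x" for x
    proof (rule ccontr)
      assume "x \<notin> D"
      have "f \<in> T" using f by (rule IntD1)
      then have "f \<in> (if x \<in> D then UNIV else {f. f x = False})" unfolding T_def by (rule INT_D) simp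
      then show False using \<open>x \<notin> D\<close> that by simp
    qed
    have "\<exists>x\<in>\<Lambda>. agree (real m) (Collect f) (translate \<Lambda> x) \<and> f 0" for m
    proof -
      have "f \<in> S m" using f by (meson IntD2 INT_D UNIV_I)
      then obtain p where p: "p \<in> P m" "f \<in> (\<Inter>x\<in>insert 0 (D \<inter> cball 0 (real m)). {f. f x = (x \<in> p)})"
        unfolding S_def by (rule UN_E)
      have fp: "f y = (y \<in> p)" if "y \<in> insert 0 (D \<inter> cball 0 (real m))" for y
        using INT_D[OF p(2) that] by simp
      obtain x where "x \<in> \<Lambda>" "p = translate \<Lambda> x \<inter> cball 0 (real m)" using p(1) unfolding P_def by blast
      with fp have x: "x \<in> \<Lambda>" "\<And>y. y \<in> insert 0 (D \<inter> cball 0 (real m)) \<Longrightarrow> f y = (y \<in> translate \<Lambda> x \<inter> cball 0 (real m))"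
        by simp_all
      have "f 0" using x by (simp add: mem_translate)
      moreover have "agree (real m) (Collect f) (translate \<Lambda> x)"
        unfolding agree_iff
      proof (intro allI impI)
        fix y :: 'a assume "norm y \<le> real m"
        then show "y \<in> Collect f \<longleftrightarrow> y \<in> translate \<Lambda> x"
          using x(2)[of y] fD[of y] transversal_subset[OF transversal_translate[OF base_transversal x(1)]]
          by (cases "y \<in> D") auto
      qed
      ultimately show ?thesis using x(1) by blast
    qed
    then have "\<exists>x\<in>\<Lambda>. agree \<rho> (Collect f) (translate \<Lambda> x)" "f 0" for \<rho>
    proof -
      obtain m :: nat where "\<rho> \<le> real m" using real_arch_simple by blast
      with \<open>\<And>m. \<exists>x\<in>\<Lambda>. agree (real m) (Collect f) (translate \<Lambda> x) \<and> f 0\<close>[of m]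
      show "\<exists>x\<in>\<Lambda>. agree \<rho> (Collect f) (translate \<Lambda> x)" "f 0" using agree_mono by blast+
    qed
    then show "f \<in> {f. Collect f \<in> \<Xi>}" using transversalI[of "Collect f"] by simp
  qed
  have "closedin ?X {f. Collect f \<in> \<Xi>}"
    unfolding eq by (intro closedin_Int closedT closedin_INT closedS) auto
  moreover have "compact_space ?X" by (simp add: compact_space_product_topology compact_space_discrete_topology)
  ultimately show ?thesis
    unfolding patch_topology_def compact_space_subtopology[OF closedin_compact_space] 
    by (meson closedin_compact_space compact_space_subtopology)
qed

text \<open>Members of the transversal are subsets of \<open>D\<close>, so agreement on a ball
  restricts only finitely many coordinates.\<close>

lemma openin_agree:
  assumes "A \<in> \<Xi>" shows "openin patch_topology {f. Collect f \<in> \<Xi> \<and> agree \<rho> (Collect f) A}"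
proof -
  let ?X = "product_topology (\<lambda>_::'a. discrete_topology (UNIV::bool set)) UNIV"
  have eq: "{f. Collect f \<in> \<Xi> \<and> agree \<rho> (Collect f) A}
      = ((\<Inter>x\<in>D \<inter> cball 0 \<rho>. {f. f x = (x \<in> A)}) \<inter> topspace ?X) \<inter> {f. Collect f \<in> \<Xi>}"
    (is "?l = ?r")
  proof (intro set_eqI iffI)
    fix f assume "f \<in> ?l" then show "f \<in> ?r" unfolding agree_iff by auto
  next
    fix f assume f: "f \<in> ?r"
    then have "Collect f \<subseteq> D" "A \<subseteq> D" using transversal_subset assms by auto
    with f show "f \<in> ?l" unfolding agree_iff by auto
  qed
  have "openin ?X ((\<Inter>x\<in>D \<inter> cball 0 \<rho>. {f. f x = (x \<in> A)}) \<inter> topspace ?X)"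
    by (rule openin_INT[OF finite_patch]) (rule clopen_coordinate(1))
  then show ?thesis unfolding eq patch_topology_def openin_subtopology by blast
qed

lemma patch_continuous_continuous_map:
  assumes "patch_continuous h" shows "continuous_map patch_topology euclideanreal (\<lambda>f. h (Collect f))"
proof -
  have "\<exists>U. openin patch_topology U \<and> f \<in> U \<and> (\<forall>f'\<in>U. h (Collect f') \<in> ball (h (Collect f)) \<epsilon>)"
    if f: "f \<in> topspace patch_topology" and e: "\<epsilon> > 0" for f \<epsilon>
  proof -
    obtain \<rho> where \<rho>: "\<And>A B. A \<in> \<Xi> \<Longrightarrow> B \<in> \<Xi> \<Longrightarrow> agree \<rho> A B \<Longrightarrow> \<bar>h A - h B\<bar> < \<epsilon>"
      using patch_continuousD[OF assms e] by metis
    have f': "Collect f \<in> \<Xi>" using f by (simp add: topspace_patch_topology)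
    show ?thesis
      using \<rho>[OF f'] f'
      by (intro exI[of _ "{f'. Collect f' \<in> \<Xi> \<and> agree \<rho> (Collect f') (Collect f)}"])
        (auto intro: openin_agree simp: agree_refl dist_real_def agree_sym)
  qed
  then show ?thesis
    using Met_TC.continuous_map_to_metric[of patch_topology "\<lambda>f. h (Collect f)"] by simp
qed

text \<open>The image of a closed part of the compact transversal is closed, hence contains 0 if it
  comes arbitrarily close. The case \<open>Q = \<Xi>\<close> serves surjectivity of the address map;
  the sets missing \<open>u\<close> serve to force \<open>u\<close> to be present
  (\<open>determined_near\<close>).\<close>

lemma patch_continuous_attains_0:
  assumes h: "patch_continuous h" and Q: "Q = \<Xi> \<or> (\<exists>u. Q = {A\<in>\<Xi>. u \<notin> A})"
    and 0: "\<And>\<epsilon>. \<epsilon> > 0 \<Longrightarrow> \<exists>A\<in>Q. \<bar>h A\<bar> < \<epsilon>"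
  shows "\<exists>A\<in>Q. h A = 0"
proof -
  have "closedin patch_topology {f. Collect f \<in> Q}"
    using Q
  proof (elim disjE exE)
    assume "Q = \<Xi>" then show ?thesis using closedin_topspace[of patch_topology] by (simp add: topspace_patch_topology)
  next
    fix u assume "Q = {A\<in>\<Xi>. u \<notin> A}"
    then have "{f. Collect f \<in> Q} = {f. f u = False} \<inter> {f. Collect f \<in> \<Xi>}" by auto
    then show ?thesis unfolding patch_topology_def closedin_subtopology using clopen_coordinate(2)[of u False] by blast
  qed
  then have "compactin patch_topology {f. Collect f \<in> Q}"
    using closedin_compact_space compact_patch_topology by blast
  then have "compactin euclideanreal ((\<lambda>f. h (Collect f)) ` {f. Collect f \<in> Q})"
    using image_compactin patch_continuous_continuous_map[OF h] by blast
  moreover have "(\<lambda>f. h (Collect f)) ` {f. Collect f \<in> Q} = h ` Q"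
  proof -
    have "A \<in> Collect ` {f. Collect f \<in> Q}" if "A \<in> Q" for A
      using that by (intro image_eqI[of _ _ "\<lambda>x. x \<in> A"]) auto
    then have Q': "Collect ` {f. Collect f \<in> Q} = Q" by blast
    have "(\<lambda>f. h (Collect f)) ` {f. Collect f \<in> Q} = h ` Collect ` {f. Collect f \<in> Q}"
      by (simp only: image_image)
    also have "\<dots> = h ` Q" by (rule arg_cong[OF Q'])
    finally show ?thesis .
  qed
  ultimately have "closed (h ` Q)" by (simp add: compact_imp_closed)
  moreover have "0 \<in> closure (h ` Q)"
    unfolding closure_approachable
  proof (intro allI impI)
    fix \<epsilon> :: real assume "\<epsilon> > 0"
    then obtain A where "A \<in> Q" "\<bar>h A\<bar> < \<epsilon>" using 0 by blast
    then show "\<exists>y\<in>h ` Q. dist y 0 < \<epsilon>" by (intro bexI[of _ "h A"]) auto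
  qed
  ultimately have "0 \<in> h ` Q" by (simp add: closure_closed)
  then obtain A where "A \<in> Q" "0 = h A" by blast
  then show ?thesis by (intro bexI[of _ A]) auto
qed

section \<open>Compactness of the hull\<close>

lemma openin_hull_topology_agree:
  "openin (hull_topology \<Lambda>) U \<longleftrightarrow> U \<subseteq> hull_of \<Lambda> \<and>
    (\<forall>A\<in>U. \<exists>\<rho>. \<exists>\<epsilon>>0. \<forall>B\<in>hull_of \<Lambda>. agree \<rho> B A \<longrightarrow> (\<forall>t. norm t < \<epsilon> \<longrightarrow> translate B t \<in> U))"
proof -
  have "(\<exists>R \<epsilon>. 0 < \<epsilon> \<and> \<epsilon> < R / 2 \<and> hull_nbhd \<Lambda> A R \<epsilon> \<subseteq> U) \<longleftrightarrow>
      (\<exists>\<rho>. \<exists>\<epsilon>>0. \<forall>B\<in>hull_of \<Lambda>. agree \<rho> B A \<longrightarrow> (\<forall>t. norm t < \<epsilon> \<longrightarrow> translate B t \<in> U))" (is "?l \<longleftrightarrow> ?r") for A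
  proof
    assume ?l
    then obtain R \<epsilon> where e: "0 < \<epsilon>" "hull_nbhd \<Lambda> A R \<epsilon> \<subseteq> U" by blast
    have "translate B t \<in> U" if "B \<in> hull_of \<Lambda>" "agree R B A" "norm t < \<epsilon>" for B t
    proof -
      have "translate B t \<in> hull_nbhd \<Lambda> A R \<epsilon>"
        unfolding hull_nbhd_def using that by (auto simp: agree_def)
      then show ?thesis using e(2) by blast
    qed
    then show ?r using e(1) by blast
  next
    assume ?r
    then obtain \<rho> \<epsilon> where e: "\<epsilon> > 0"
      "\<And>B t. B \<in> hull_of \<Lambda> \<Longrightarrow> agree \<rho> B A \<Longrightarrow> norm t < \<epsilon> \<Longrightarrow> translate B t \<in> U" by blast
    \<comment> \<open>Enlarging the radius only shrinks the neighbourhood, so the coupling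
      \<open>\<epsilon> < R / 2\<close> can always be met.\<close>
    have "hull_nbhd \<Lambda> A (max \<rho> (3 * \<epsilon>)) \<epsilon> \<subseteq> U"
    proof
      fix X assume "X \<in> hull_nbhd \<Lambda> A (max \<rho> (3 * \<epsilon>)) \<epsilon>"
      then obtain B t where B: "X = translate B t" "B \<in> hull_of \<Lambda>" "agree (max \<rho> (3 * \<epsilon>)) B A" "norm t < \<epsilon>"
        unfolding hull_nbhd_def agree_def by auto
      then show "X \<in> U" using e(2)[OF B(2) agree_mono[OF B(3)]] by simp
    qed
    then show ?l using e(1) by (intro exI[of _ "max \<rho> (3 * \<epsilon>)"] exI[of _ \<epsilon>]) auto
  qed
  then show ?thesis unfolding openin_hull_topology by blast
qed

text \<open>All members of the hull have a point within a common distance \<open>R\<close> of the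
  origin. So the hull is the image of the transversal times a closed ball under
  \<open>translate\<close>, which is jointly continuous.\<close>

lemma compact_hull_topology: "compact_space (hull_topology \<Lambda>)"
proof -
  obtain R where R: "R > 0" "\<And>A c. A \<in> hull_of \<Lambda> \<Longrightarrow> \<exists>x\<in>A. norm (x - c) \<le> R"
    using hull_dense by blast
  let ?P = "prod_topology patch_topology (top_of_set (cball (0::'a) R))"
  let ?q = "\<lambda>(f, t). translate (Collect f) t"
  have comp: "compact_space ?P"
    by (simp add: compact_space_prod_topology compact_patch_topology compact_space_subtopology)
  have "continuous_map ?P (hull_topology \<Lambda>) ?q"
    unfolding continuous_map_def
  proof (intro conjI allI impI)
    show "?q \<in> topspace ?P \<rightarrow> topspace (hull_topology \<Lambda>)"
      by (auto simp: topspace_hull_topology topspace_patch_topology intro: hull_of_translate transversal_hull)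
    fix U assume U: "openin (hull_topology \<Lambda>) U"
    show "openin ?P {x \<in> topspace ?P. ?q x \<in> U}"
    proof (subst openin_subopen, intro ballI)
      fix x assume x: "x \<in> {x \<in> topspace ?P. ?q x \<in> U}"
      obtain f t where ft: "x = (f, t)" by (cases x)
      have f: "Collect f \<in> \<Xi>" and t: "t \<in> cball 0 R" and qU: "translate (Collect f) t \<in> U"
        using x unfolding ft by (auto simp: topspace_patch_topology)
      obtain \<rho> \<epsilon> where e: "\<epsilon> > 0"
        "\<And>B s. B \<in> hull_of \<Lambda> \<Longrightarrow> agree \<rho> B (translate (Collect f) t) \<Longrightarrow> norm s < \<epsilon> \<Longrightarrow> translate B s \<in> U"
        using U qU unfolding openin_hull_topology_agree by blast
      define V where "V = {f'. Collect f' \<in> \<Xi> \<and> agree (\<rho> + norm t) (Collect f') (Collect f)}"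
      have "openin ?P (V \<times> (cball 0 R \<inter> ball t \<epsilon>))"
        unfolding openin_prod_Times_iff V_def
        using openin_agree[OF f] by (auto intro: openin_open_Int)
      moreover have "x \<in> V \<times> (cball 0 R \<inter> ball t \<epsilon>)"
        unfolding ft V_def using f t e(1) by (simp add: agree_refl)
      moreover have "V \<times> (cball 0 R \<inter> ball t \<epsilon>) \<subseteq> {x \<in> topspace ?P. ?q x \<in> U}"
      proof
        fix y assume y: "y \<in> V \<times> (cball 0 R \<inter> ball t \<epsilon>)"
        obtain f' t' where y_eq: "y = (f', t')" by (cases y)
        have f': "f' \<in> V" and t': "t' \<in> cball 0 R" "t' \<in> ball t \<epsilon>" using y unfolding y_eq by auto
        have F: "Collect f' \<in> \<Xi>" "agree (\<rho> + norm t) (Collect f') (Collect f)" using f' unfolding V_def by auto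
        have "agree \<rho> (translate (Collect f') t) (translate (Collect f) t)"
          by (rule agree_translate[OF F(2)]) simp
        moreover have "norm (t' - t) < \<epsilon>" using t'(2) by (simp add: dist_norm norm_minus_commute)
        ultimately have "translate (translate (Collect f') t) (t' - t) \<in> U"
          using e(2) F(1) by (blast intro: hull_of_translate transversal_hull)
        then show "y \<in> {x \<in> topspace ?P. ?q x \<in> U}"
          unfolding y_eq using F(1) t'(1) by (simp add: translate_translate topspace_patch_topology)
      qed
      ultimately show "\<exists>T. openin ?P T \<and> x \<in> T \<and> T \<subseteq> {x \<in> topspace ?P. ?q x \<in> U}" by blast
    qed
  qed
  then have "compactin (hull_topology \<Lambda>) (?q ` topspace ?P)"
    by (rule image_compactin[OF comp[unfolded compact_space_def]])
  moreover have "?q ` topspace ?P = hull_of \<Lambda>"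
  proof (intro equalityI subsetI)
    fix A assume "A \<in> ?q ` topspace ?P"
    then show "A \<in> hull_of \<Lambda>" by (auto simp: topspace_patch_topology intro: hull_of_translate transversal_hull)
  next
    fix A assume A: "A \<in> hull_of \<Lambda>"
    obtain x where x: "x \<in> A" "norm x \<le> R" using R(2)[OF A, of 0] by auto
    have "translate A x \<in> \<Xi>" using A x(1) by (rule hull_translate_transversal)
    then have "(\<lambda>y. y \<in> translate A x, - x) \<in> topspace ?P" "?q (\<lambda>y. y \<in> translate A x, - x) = A"
      using x(2) by (simp_all add: topspace_patch_topology)
    then show "A \<in> ?q ` topspace ?P" by (metis (no_types, lifting) imageI)
  qed
  ultimately show ?thesis unfolding compact_space_def topspace_hull_topology by simp
qed

end

section \<open>Euclidean space of sequences\<close>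

abbreviation E :: "nat \<Rightarrow> (nat \<Rightarrow> real) topology" where "E \<equiv> Euclidean_space"

lemma mem_E: "x \<in> topspace (E n) \<longleftrightarrow> (\<forall>i\<ge>n. x i = 0)"
  by (simp add: topspace_Euclidean_space)

lemma E_eqI: "x \<in> topspace (E n) \<Longrightarrow> y \<in> topspace (E n) \<Longrightarrow> (\<And>i. i < n \<Longrightarrow> x i = y i) \<Longrightarrow> x = y"
  by (rule ext) (metis mem_E not_le)

text \<open>The type of sequences carries no norm, so cubes play the role of balls.\<close>

definition box :: "nat \<Rightarrow> (nat \<Rightarrow> real) \<Rightarrow> real \<Rightarrow> (nat \<Rightarrow> real) set"
  where "box n x \<epsilon> = {y \<in> topspace (E n). \<forall>i<n. \<bar>y i - x i\<bar> < \<epsilon>}"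

lemma continuous_map_E_coordinate: "continuous_map (E n) euclideanreal (\<lambda>x. x i)"
  unfolding Euclidean_space_def
  by (rule continuous_map_from_subtopology) (rule continuous_map_product_coordinates, simp)

lemma continuous_map_into_E:
  assumes "\<And>x i. x \<in> topspace X \<Longrightarrow> n \<le> i \<Longrightarrow> f x i = 0"
    and "\<And>i. i < n \<Longrightarrow> continuous_map X euclideanreal (\<lambda>x. f x i)"
  shows "continuous_map X (E n) f"
proof (rule continuous_map_eq)
  show "continuous_map X (E n) (\<lambda>x i. if i < n then f x i else 0)"
    unfolding continuous_map_componentwise_Euclidean_space using assms(2) by blast
  fix x assume "x \<in> topspace X"
  then show "(\<lambda>i. if i < n then f x i else 0) = f x" using assms(1) by (intro ext) simp
qed

lemma openin_box: "openin (E n) (box n x \<epsilon>)"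
proof -
  have "box n x \<epsilon> = (\<Inter>i\<in>{..<n}. {y \<in> topspace (E n). y i \<in> ball (x i) \<epsilon>}) \<inter> topspace (E n)"
    unfolding box_def by (auto simp: dist_real_def abs_minus_commute)
  moreover have "openin (E n) {y \<in> topspace (E n). y i \<in> ball (x i) \<epsilon>}" for i
    by (rule openin_continuous_map_preimage[OF continuous_map_E_coordinate]) simp
  ultimately show ?thesis by (simp add: openin_INT)
qed

lemma box_centre: "x \<in> topspace (E n) \<Longrightarrow> \<epsilon> > 0 \<Longrightarrow> x \<in> box n x \<epsilon>"
  unfolding box_def by simp

lemma openin_E_box:
  "openin (E n) U \<longleftrightarrow> U \<subseteq> topspace (E n) \<and> (\<forall>x\<in>U. \<exists>\<epsilon>>0. box n x \<epsilon> \<subseteq> U)"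
proof (intro iffI conjI ballI)
  assume U: "openin (E n) U"
  show sub: "U \<subseteq> topspace (E n)" using openin_subset[OF U] .
  fix x assume x: "x \<in> U"
  obtain T where T: "openin (powertop_real UNIV) T" "U = T \<inter> {x. \<forall>i\<ge>n. x i = 0}"
    using U unfolding Euclidean_space_def openin_subtopology by blast
  have "x \<in> T" using x T(2) by blast
  obtain V where V: "\<forall>i\<in>UNIV. openin euclideanreal (V i)" "x \<in> Pi\<^sub>E UNIV V" "Pi\<^sub>E UNIV V \<subseteq> T"
    using T(1)[unfolded openin_product_topology_alt, rule_format, OF \<open>x \<in> T\<close>] by (elim exE conjE)
  have xV: "x i \<in> V i" for i using V(2) by (rule PiE_mem) simp
  have "\<exists>e>0. ball (x i) e \<subseteq> V i" for i
    using V(1) xV[of i] unfolding open_openin[symmetric] open_contains_ball by blast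
  then obtain e where e: "\<And>i. e i > 0" "\<And>i. ball (x i) (e i) \<subseteq> V i" by metis
  \<comment> \<open>The inserted 1 keeps the minimum defined for \<open>n = 0\<close>.\<close>
  define \<epsilon> where "\<epsilon> = Min (insert 1 (e ` {..<n}))"
  have \<epsilon>: "\<epsilon> > 0" "\<And>i. i < n \<Longrightarrow> \<epsilon> \<le> e i" unfolding \<epsilon>_def using e(1) by auto
  have "box n x \<epsilon> \<subseteq> U"
  proof
    fix y assume y: "y \<in> box n x \<epsilon>"
    then have yE: "y \<in> topspace (E n)" unfolding box_def by blast
    have "y i \<in> V i" for i
    proof (cases "i < n")
      case True
      then have "\<bar>y i - x i\<bar> < e i" using y \<epsilon>(2)[OF True] unfolding box_def by force
      then show ?thesis using e(2)[of i] by (auto simp: dist_real_def abs_minus_commute)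
    next
      case False
      then have "y i = x i" using yE x sub by (metis mem_E not_le subsetD)
      then show ?thesis using xV by simp
    qed
    then have "y \<in> Pi\<^sub>E UNIV V" by (simp add: PiE_UNIV_domain)
    then have "y \<in> T" using V(3) by blast
    then show "y \<in> U" using T(2) yE by (simp add: mem_E)
  qed
  then show "\<exists>\<epsilon>>0. box n x \<epsilon> \<subseteq> U" using \<epsilon>(1) by blast
next
  assume U: "U \<subseteq> topspace (E n) \<and> (\<forall>x\<in>U. \<exists>\<epsilon>>0. box n x \<epsilon> \<subseteq> U)"
  show "openin (E n) U"
  proof (subst openin_subopen, intro ballI)
    fix x assume x: "x \<in> U"
    then obtain \<epsilon> where \<epsilon>: "\<epsilon> > 0" "box n x \<epsilon> \<subseteq> U" using U by blast
    have "x \<in> topspace (E n)" using x U by blast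
    then show "\<exists>T. openin (E n) T \<and> x \<in> T \<and> T \<subseteq> U"
      using openin_box[of n x \<epsilon>] box_centre[of x n \<epsilon>] \<epsilon> by (intro exI[of _ "box n x \<epsilon>"]) simp
  qed
qed

lemma closure_of_E_box:
  "x \<in> E n closure_of S \<longleftrightarrow> x \<in> topspace (E n) \<and> (\<forall>\<epsilon>>0. \<exists>y\<in>S. y \<in> box n x \<epsilon>)"
proof (intro iffI conjI allI impI)
  assume x: "x \<in> E n closure_of S"
  then show xE: "x \<in> topspace (E n)" by (simp add: in_closure_of)
  fix \<epsilon> :: real assume "\<epsilon> > 0"
  then show "\<exists>y\<in>S. y \<in> box n x \<epsilon>"
    using x openin_box[of n x \<epsilon>] box_centre[OF xE] unfolding in_closure_of by blast
next
  assume x: "x \<in> topspace (E n) \<and> (\<forall>\<epsilon>>0. \<exists>y\<in>S. y \<in> box n x \<epsilon>)"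
  show "x \<in> E n closure_of S"
    unfolding in_closure_of
  proof (intro conjI allI impI)
    fix T assume T: "x \<in> T \<and> openin (E n) T"
    then obtain \<epsilon> where "\<epsilon> > 0" "box n x \<epsilon> \<subseteq> T" unfolding openin_E_box by blast
    then show "\<exists>y. y \<in> S \<and> y \<in> T" using x by blast
  qed (use x in blast)
qed

lemma interior_of_E_box:
  "x \<in> E n interior_of S \<longleftrightarrow> x \<in> topspace (E n) \<and> (\<exists>\<epsilon>>0. box n x \<epsilon> \<subseteq> S)"
proof
  assume "x \<in> E n interior_of S"
  then obtain T where T: "openin (E n) T" "x \<in> T" "T \<subseteq> S" unfolding interior_of_def by blast
  then obtain \<epsilon> where "\<epsilon> > 0" "box n x \<epsilon> \<subseteq> T" unfolding openin_E_box by blast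
  then show "x \<in> topspace (E n) \<and> (\<exists>\<epsilon>>0. box n x \<epsilon> \<subseteq> S)" using T openin_subset by blast
next
  assume "x \<in> topspace (E n) \<and> (\<exists>\<epsilon>>0. box n x \<epsilon> \<subseteq> S)"
  then obtain \<epsilon> where "x \<in> topspace (E n)" "\<epsilon> > 0" "box n x \<epsilon> \<subseteq> S" by blast
  then show "x \<in> E n interior_of S"
    using interior_of_maximal[OF _ openin_box] box_centre subsetD by metis
qed

lemma compactin_E_cube:
  "compactin (E n) {x \<in> topspace (E n). \<forall>i<n. x i \<in> {a..b}}"
proof -
  have "compactin (powertop_real UNIV) (Pi\<^sub>E UNIV (\<lambda>i. if i < n then {a..b} else {0}))"
    by (simp add: compactin_PiE)
  moreover have "Pi\<^sub>E UNIV (\<lambda>i. if i < n then {a..b} else {0}) = {x \<in> topspace (E n). \<forall>i<n. x i \<in> {a..b}}"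
    by (auto simp: mem_E PiE_UNIV_domain Pi_iff split: if_splits)
  ultimately have "compactin (powertop_real UNIV) {x \<in> topspace (E n). \<forall>i<n. x i \<in> {a..b}}" by simp
  then show ?thesis
    unfolding Euclidean_space_def compactin_subtopology by auto
qed

section \<open>The torus as a metric space\<close>

definition dist_int :: "real \<Rightarrow> real"
  where "dist_int r = \<bar>r - of_int (round r)\<bar>"

lemma dist_int_le: "dist_int r \<le> \<bar>r - of_int m\<bar>"
  unfolding dist_int_def by (rule round_diff_minimal)

lemma dist_int_nonneg [simp]: "dist_int r \<ge> 0"
  by (simp add: dist_int_def)

lemma dist_int_le_abs: "dist_int r \<le> \<bar>r\<bar>"
  using dist_int_le[of r 0] by simp

lemma dist_int_triangle: "dist_int (a + b) \<le> dist_int a + dist_int b"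
  using dist_int_le[of "a + b" "round a + round b"] unfolding dist_int_def by simp

lemma dist_int_minus_le: "dist_int (- a) \<le> dist_int a"
  using dist_int_le[of "- a" "- round a"] unfolding dist_int_def by simp

lemma dist_int_minus: "dist_int (- a) = dist_int a"
  using dist_int_minus_le[of a] dist_int_minus_le[of "- a"] by simp

lemma dist_int_commute: "dist_int (a - b) = dist_int (b - a)"
  using dist_int_minus[of "a - b"] by simp

lemma dist_int_eq_0_iff: "dist_int a = 0 \<longleftrightarrow> a \<in> \<int>"
proof
  assume "dist_int a = 0"
  then have "a = of_int (round a)" unfolding dist_int_def by simp
  then show "a \<in> \<int>" by (metis Ints_of_int)
next
  assume "a \<in> \<int>"
  then obtain m where "a = of_int m" by (rule Ints_cases)
  then show "dist_int a = 0" using dist_int_le[of a m] by (intro antisym) simp_all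
qed

lemma dist_int_add_Ints:
  assumes "k \<in> \<int>" shows "dist_int (a + k) = dist_int a"
proof (rule antisym)
  have k: "dist_int k = 0" "dist_int (- k) = 0" using assms by (simp_all add: dist_int_eq_0_iff)
  show "dist_int (a + k) \<le> dist_int a" using dist_int_triangle[of a k] k by simp
  show "dist_int a \<le> dist_int (a + k)" using dist_int_triangle[of "a + k" "- k"] k by simp
qed

definition torus_pre_dist :: "nat \<Rightarrow> (nat \<Rightarrow> real) \<Rightarrow> (nat \<Rightarrow> real) \<Rightarrow> real"
  where "torus_pre_dist s x y = (\<Sum>i<s. dist_int (x i - y i))"

text \<open>The choice of representatives is harmless: by \<open>torus_pre_dist_cong\<close> the
  value depends only on the classes.\<close>

definition torus_dist :: "nat \<Rightarrow> (nat \<Rightarrow> real) set \<Rightarrow> (nat \<Rightarrow> real) set \<Rightarrow> real"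
  where "torus_dist s v w = torus_pre_dist s (SOME x. x \<in> v) (SOME y. y \<in> w)"

lemma topspace_torus: "topspace (torus s) = torus_class s ` topspace (E s)"
  unfolding torus_def using quotient_imp_surjective_map[OF quotient_map_quotient_topology] by metis

lemma torus_class_in: "x \<in> topspace (E s) \<Longrightarrow> torus_class s x \<in> topspace (torus s)"
  by (simp add: topspace_torus)

lemma continuous_map_torus_class: "continuous_map (E s) (torus s) (torus_class s)"
  unfolding torus_def by (rule quotient_imp_continuous_map[OF quotient_map_quotient_topology])

lemma openin_torus:
  "openin (torus s) U \<longleftrightarrow> U \<subseteq> topspace (torus s) \<and> openin (E s) {x \<in> topspace (E s). torus_class s x \<in> U}"
  unfolding topspace_torus unfolding torus_def openin_quotient_topology by blast

lemma mem_torus_class: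
  assumes x: "x \<in> topspace (E s)"
  shows "y \<in> torus_class s x \<longleftrightarrow> y \<in> topspace (E s) \<and> (\<forall>i<s. y i - x i \<in> \<int>)"
proof
  assume "y \<in> torus_class s x"
  then obtain k where "k \<in> integer_lattice s" "y = (\<lambda>i. x i + k i)"
    unfolding torus_class_def mem_Collect_eq by (elim exE conjE)
  then show "y \<in> topspace (E s) \<and> (\<forall>i<s. y i - x i \<in> \<int>)"
    using x unfolding integer_lattice_def by (simp add: mem_E)
next
  assume y: "y \<in> topspace (E s) \<and> (\<forall>i<s. y i - x i \<in> \<int>)"
  have "(\<lambda>i. y i - x i) \<in> integer_lattice s"
  proof -
    have "y i - x i \<in> \<int>" for i using x y by (cases "i < s") (auto simp: mem_E)
    then show ?thesis unfolding integer_lattice_def using x y by (simp add: mem_E)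
  qed
  then show "y \<in> torus_class s x"
    unfolding torus_class_def mem_Collect_eq by (intro exI[of _ "\<lambda>i. y i - x i"]) simp
qed

lemma torus_class_self: "x \<in> topspace (E s) \<Longrightarrow> x \<in> torus_class s x"
  by (simp add: mem_torus_class)

lemma torus_class_eq_iff:
  assumes x: "x \<in> topspace (E s)" and y: "y \<in> topspace (E s)"
  shows "torus_class s x = torus_class s y \<longleftrightarrow> (\<forall>i<s. x i - y i \<in> \<int>)"
proof
  assume "torus_class s x = torus_class s y"
  then have "x \<in> torus_class s y" using torus_class_self[OF x] by simp
  then show "\<forall>i<s. x i - y i \<in> \<int>" using mem_torus_class[OF y] by blast
next
  assume xy: "\<forall>i<s. x i - y i \<in> \<int>"
  have iff: "z i - x i \<in> \<int> \<longleftrightarrow> z i - y i \<in> \<int>" if "i < s" for z i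
  proof -
    have k: "x i - y i \<in> \<int>" using xy that by blast
    have "z i - y i = (z i - x i) + (x i - y i)" "z i - x i = (z i - y i) - (x i - y i)" by simp_all
    then show ?thesis using k by (metis Ints_add Ints_diff)
  qed
  show "torus_class s x = torus_class s y"
    unfolding set_eq_iff mem_torus_class[OF x] mem_torus_class[OF y] using iff by blast
qed

lemma torus_pre_dist_nonneg: "torus_pre_dist s x y \<ge> 0"
  unfolding torus_pre_dist_def by (simp add: sum_nonneg)

lemma torus_pre_dist_commute: "torus_pre_dist s x y = torus_pre_dist s y x"
  unfolding torus_pre_dist_def by (intro sum.cong refl dist_int_commute)

lemma torus_pre_dist_triangle: "torus_pre_dist s x z \<le> torus_pre_dist s x y + torus_pre_dist s y z"
  unfolding torus_pre_dist_def sum.distrib[symmetric]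
proof (rule sum_mono)
  fix i show "dist_int (x i - z i) \<le> dist_int (x i - y i) + dist_int (y i - z i)"
    using dist_int_triangle[of "x i - y i" "y i - z i"] by simp
qed

lemma torus_pre_dist_le: "torus_pre_dist s x y \<le> (\<Sum>i<s. \<bar>x i - y i\<bar>)"
  unfolding torus_pre_dist_def by (intro sum_mono dist_int_le_abs)

lemma torus_pre_dist_cong:
  assumes "\<And>i. i < s \<Longrightarrow> x' i - x i \<in> \<int>" "\<And>i. i < s \<Longrightarrow> y' i - y i \<in> \<int>"
  shows "torus_pre_dist s x' y' = torus_pre_dist s x y"
  unfolding torus_pre_dist_def
proof (rule sum.cong[OF refl])
  fix i assume "i \<in> {..<s}"
  then have "(x' i - x i) - (y' i - y i) \<in> \<int>" using assms[of i] Ints_diff by simp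
  then have "dist_int ((x i - y i) + ((x' i - x i) - (y' i - y i))) = dist_int (x i - y i)"
    by (rule dist_int_add_Ints)
  then show "dist_int (x' i - y' i) = dist_int (x i - y i)" by simp
qed

lemma torus_dist_class:
  assumes x: "x \<in> topspace (E s)" and y: "y \<in> topspace (E s)"
  shows "torus_dist s (torus_class s x) (torus_class s y) = torus_pre_dist s x y"
  unfolding torus_dist_def
proof (rule torus_pre_dist_cong)
  have "(SOME z. z \<in> torus_class s x) \<in> torus_class s x" "(SOME z. z \<in> torus_class s y) \<in> torus_class s y"
    using someI[of "\<lambda>z. z \<in> torus_class s x", OF torus_class_self[OF x]]
      someI[of "\<lambda>z. z \<in> torus_class s y", OF torus_class_self[OF y]] by simp_all
  then show "(SOME z. z \<in> torus_class s x) i - x i \<in> \<int>" "(SOME z. z \<in> torus_class s y) i - y i \<in> \<int>" if "i < s" for i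
    using that unfolding mem_torus_class[OF x] mem_torus_class[OF y] by blast+
qed

lemma torus_Metric_space: "Metric_space (topspace (torus s)) (torus_dist s)"
proof
  fix v w assume v: "v \<in> topspace (torus s)" and w: "w \<in> topspace (torus s)"
  then obtain x y where x: "x \<in> topspace (E s)" "v = torus_class s x" and y: "y \<in> topspace (E s)" "w = torus_class s y"
    unfolding topspace_torus by blast
  show "torus_dist s v w = 0 \<longleftrightarrow> v = w"
    unfolding x(2) y(2) torus_dist_class[OF x(1) y(1)] torus_class_eq_iff[OF x(1) y(1)]
    unfolding torus_pre_dist_def by (simp add: sum_nonneg_eq_0_iff dist_int_eq_0_iff Ball_def)
  fix u assume "u \<in> topspace (torus s)"
  then obtain z where z: "z \<in> topspace (E s)" "u = torus_class s z" unfolding topspace_torus by blast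
  show "torus_dist s v u \<le> torus_dist s v w + torus_dist s w u"
    unfolding x(2) y(2) z(2) torus_dist_class[OF x(1) y(1)] torus_dist_class[OF x(1) z(1)] torus_dist_class[OF y(1) z(1)]
    by (rule torus_pre_dist_triangle)
qed (simp_all add: torus_dist_def torus_pre_dist_nonneg torus_pre_dist_commute)

interpretation torus: Metric_space "topspace (torus s)" "torus_dist s" for s
  by (rule torus_Metric_space)

lemma torus_pre_dist_lessD:
  assumes "torus_pre_dist s x y < \<epsilon>" "i < s" shows "\<bar>x i - y i - of_int (round (x i - y i))\<bar> < \<epsilon>"
proof -
  have "dist_int (x i - y i) \<le> torus_pre_dist s x y"
    unfolding torus_pre_dist_def by (rule member_le_sum) (use assms(2) in auto)
  then show ?thesis using assms(1) unfolding dist_int_def by linarith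
qed

lemma torus_mtopology: "torus.mtopology s = torus s"
proof (rule topology_eq[THEN iffD2], intro allI iffI)
  fix U assume U: "openin (torus s) U"
  show "openin (torus.mtopology s) U"
    unfolding torus.openin_mtopology
  proof (intro conjI allI impI)
    show sub: "U \<subseteq> topspace (torus s)" using U by (rule openin_subset)
    fix v assume v: "v \<in> U"
    then obtain x where x: "x \<in> topspace (E s)" "v = torus_class s x" using sub unfolding topspace_torus by blast
    have "openin (E s) {x \<in> topspace (E s). torus_class s x \<in> U}" using U unfolding openin_torus by blast
    then obtain \<epsilon> where \<epsilon>: "\<epsilon> > 0" "box s x \<epsilon> \<subseteq> {x \<in> topspace (E s). torus_class s x \<in> U}"
      using v x unfolding openin_E_box by blast
    have "torus.mball s v \<epsilon> \<subseteq> U"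
    proof
      fix w assume "w \<in> torus.mball s v \<epsilon>"
      then have w: "w \<in> topspace (torus s)" "torus_dist s v w < \<epsilon>" by auto
      then obtain y where y: "y \<in> topspace (E s)" "w = torus_class s y" unfolding topspace_torus by blast
      have d: "torus_pre_dist s x y < \<epsilon>" using w(2) x y by (simp add: torus_dist_class)
      \<comment> \<open>The representative of \<open>w\<close> that is closest to \<open>x\<close>
        in every coordinate.\<close>
      define y' where "y' i = (if i < s then y i + of_int (round (x i - y i)) else 0)" for i
      have y'E: "y' \<in> topspace (E s)" unfolding y'_def by (simp add: mem_E)
      have "\<bar>y' i - x i\<bar> < \<epsilon>" if "i < s" for i
        using torus_pre_dist_lessD[OF d that] that unfolding y'_def by simp
      then have "y' \<in> box s x \<epsilon>" unfolding box_def using y'E by blast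
      then have "torus_class s y' \<in> U" using \<epsilon>(2) by blast
      moreover have "torus_class s y' = w"
        unfolding y(2) torus_class_eq_iff[OF y'E y(1)] y'_def by simp
      ultimately show "w \<in> U" by simp
    qed
    then show "\<exists>r>0. torus.mball s v r \<subseteq> U" using \<epsilon>(1) by blast
  qed
next
  fix U assume U: "openin (torus.mtopology s) U"
  show "openin (torus s) U"
    unfolding openin_torus openin_E_box
  proof (intro conjI ballI)
    show "U \<subseteq> topspace (torus s)" using openin_subset[OF U] by simp
    fix x assume x: "x \<in> {x \<in> topspace (E s). torus_class s x \<in> U}"
    then obtain r where r: "r > 0" "torus.mball s (torus_class s x) r \<subseteq> U"
      using U unfolding torus.openin_mtopology by blast
    \<comment> \<open>The denominator \<open>s + 1\<close> keeps a sum of \<open>s\<close> terms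
      strictly below \<open>r\<close>, also for \<open>s = 0\<close>.\<close>
    have "box s x (r / (s + 1)) \<subseteq> {x \<in> topspace (E s). torus_class s x \<in> U}"
    proof
      fix y assume "y \<in> box s x (r / (s + 1))"
      then have y: "y \<in> topspace (E s)" "\<And>i. i < s \<Longrightarrow> \<bar>x i - y i\<bar> \<le> r / (s + 1)"
        unfolding box_def by (auto simp: abs_minus_commute less_imp_le)
      have "torus_pre_dist s x y \<le> (\<Sum>i<s. r / (s + 1))"
        by (rule order_trans[OF torus_pre_dist_le]) (intro sum_mono y, simp)
      also have "\<dots> < r" using r(1) by (simp add: field_simps)
      finally have "torus_class s y \<in> torus.mball s (torus_class s x) r"
        using x y(1) by (simp add: torus_dist_class torus_class_in)
      then show "y \<in> {x \<in> topspace (E s). torus_class s x \<in> U}" using r(2) y(1) by blast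
    qed
    then show "\<exists>\<epsilon>>0. box s x \<epsilon> \<subseteq> {x \<in> topspace (E s). torus_class s x \<in> U}"
      using r(1) by (intro exI[of _ "r / (s + 1)"]) auto
  qed blast
qed

lemma Hausdorff_torus: "Hausdorff_space (torus s)"
  using torus.Hausdorff_space_mtopology[of s] unfolding torus_mtopology .

lemma metrizable_torus: "metrizable_space (torus s)"
  using torus.metrizable_space_mtopology[of s] unfolding torus_mtopology .

lemma compact_torus: "compact_space (torus s)"
proof -
  have "compactin (torus s) (torus_class s ` {x \<in> topspace (E s). \<forall>i<s. x i \<in> {0..1}})"
    by (rule image_compactin[OF compactin_E_cube continuous_map_torus_class])
  moreover have "torus_class s ` {x \<in> topspace (E s). \<forall>i<s. x i \<in> {0..1}} = topspace (torus s)"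
  proof (intro equalityI subsetI)
    fix v assume "v \<in> topspace (torus s)"
    then obtain x where x: "x \<in> topspace (E s)" "v = torus_class s x" unfolding topspace_torus by blast
    have y: "(\<lambda>i. if i < s then frac (x i) else 0) \<in> topspace (E s)" by (simp add: mem_E)
    have "torus_class s (\<lambda>i. if i < s then frac (x i) else 0) = v"
      unfolding x(2) torus_class_eq_iff[OF y x(1)] by (simp add: frac_def)
    then show "v \<in> torus_class s ` {x \<in> topspace (E s). \<forall>i<s. x i \<in> {0..1}}"
      using y frac_lt_1 by (intro image_eqI[of _ _ "\<lambda>i. if i < s then frac (x i) else 0"]) (auto intro: less_imp_le)
  qed (auto simp: topspace_torus)
  ultimately show ?thesis unfolding compact_space_def by simp
qed

lemma torus_add_class:
  assumes x: "x \<in> topspace (E s)" and y: "y \<in> topspace (E s)"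
  shows "torus_add (torus_class s x) (torus_class s y) = torus_class s (\<lambda>i. x i + y i)"
proof (intro equalityI subsetI)
  have xy: "(\<lambda>i. x i + y i) \<in> topspace (E s)" using x y by (simp add: mem_E)
  {
    fix z assume "z \<in> torus_add (torus_class s x) (torus_class s y)"
    then obtain x' y' where z: "z = (\<lambda>i. x' i + y' i)" "x' \<in> torus_class s x" "y' \<in> torus_class s y"
      unfolding torus_add_def mem_Collect_eq by (elim exE conjE)
    have x': "x' \<in> topspace (E s)" "\<And>i. i < s \<Longrightarrow> x' i - x i \<in> \<int>" using z(2) mem_torus_class[OF x] by simp_all
    have y': "y' \<in> topspace (E s)" "\<And>i. i < s \<Longrightarrow> y' i - y i \<in> \<int>" using z(3) mem_torus_class[OF y] by simp_all
    have "z i - (x i + y i) \<in> \<int>" if "i < s" for i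
      using Ints_add[OF x'(2)[OF that] y'(2)[OF that]] unfolding z(1) by (simp add: algebra_simps)
    moreover have "z \<in> topspace (E s)" using x'(1) y'(1) unfolding z(1) by (simp add: mem_E)
    ultimately show "z \<in> torus_class s (\<lambda>i. x i + y i)" using mem_torus_class[OF xy] by simp
  next
    fix z assume z: "z \<in> torus_class s (\<lambda>i. x i + y i)"
    have "(\<lambda>i. z i - y i) \<in> torus_class s x"
      using z y unfolding mem_torus_class[OF xy] mem_torus_class[OF x] by (simp add: mem_E algebra_simps)
    then show "z \<in> torus_add (torus_class s x) (torus_class s y)"
      unfolding torus_add_def mem_Collect_eq using torus_class_self[OF y]
      by (intro exI[of _ "\<lambda>i. z i - y i"] exI[of _ y]) simp
  }
qed

lemma torus_rotation:
  fixes l :: "'a::euclidean_space \<Rightarrow> nat \<Rightarrow> real"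
  assumes lE: "\<And>t. l t \<in> topspace (E s)" and lin: "\<And>i. linear (\<lambda>t. l t i)"
  defines "\<beta> \<equiv> \<lambda>w t. torus_add w (torus_class s (l t))"
  shows "dynamical_system (torus s) \<beta>" "equicontinuous_action (torus s) \<beta>"
proof -
  have \<beta>: "\<beta> (torus_class s x) t = torus_class s (\<lambda>i. x i + l t i)" "(\<lambda>i. x i + l t i) \<in> topspace (E s)"
    if "x \<in> topspace (E s)" for x t
    unfolding \<beta>_def using torus_add_class[OF that lE] that lE[of t] by (auto simp: mem_E)
  have l0: "l 0 i = 0" for i using linear_0[OF lin] .
  have ladd: "l (t + u) i = l t i + l u i" for t u i using linear_add[OF lin] .
  \<comment> \<open>One estimate for both claims: for equal times it says that distances do not
    increase, which is equicontinuity, and the last term controls the dependence on the time, which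
    gives joint continuity.\<close>
  have dist: "torus_dist s (\<beta> v t) (\<beta> w u) \<le> torus_dist s v w + (\<Sum>i<s. \<bar>l (t - u) i\<bar>)"
    if v: "v \<in> topspace (torus s)" and w: "w \<in> topspace (torus s)" for v w t u
  proof -
    obtain x y where x: "x \<in> topspace (E s)" "v = torus_class s x" and y: "y \<in> topspace (E s)" "w = torus_class s y"
      using v w unfolding topspace_torus by blast
    have "torus_dist s (\<beta> v t) (\<beta> w u) = torus_pre_dist s (\<lambda>i. x i + l t i) (\<lambda>i. y i + l u i)"
      unfolding x(2) y(2) using \<beta> x(1) y(1) by (simp add: torus_dist_class)
    also have "\<dots> \<le> torus_pre_dist s (\<lambda>i. x i + l t i) (\<lambda>i. y i + l t i) + torus_pre_dist s (\<lambda>i. y i + l t i) (\<lambda>i. y i + l u i)"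
      by (rule torus_pre_dist_triangle)
    also have "torus_pre_dist s (\<lambda>i. x i + l t i) (\<lambda>i. y i + l t i) = torus_dist s v w"
      unfolding x(2) y(2) torus_dist_class[OF x(1) y(1)] by (simp add: torus_pre_dist_def)
    also have "torus_pre_dist s (\<lambda>i. y i + l t i) (\<lambda>i. y i + l u i) \<le> (\<Sum>i<s. \<bar>l (t - u) i\<bar>)"
      by (rule order_trans[OF torus_pre_dist_le]) (simp add: linear_diff[OF lin])
    finally show ?thesis by simp
  qed
  have top: "\<beta> v t \<in> topspace (torus s)" if "v \<in> topspace (torus s)" for v t
    using that \<beta> unfolding topspace_torus by blast
  have "continuous_map (prod_topology (torus s) euclidean) (torus.mtopology s) (\<lambda>(v, t). \<beta> v t)"
    unfolding torus.continuous_map_to_metric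
  proof (intro ballI allI impI)
    fix p and \<epsilon> :: real assume p: "p \<in> topspace (prod_topology (torus s) (euclidean :: 'a topology))" and "\<epsilon> > 0"
    obtain v t where vt: "p = (v, t)" by (cases p)
    have v: "v \<in> topspace (torus s)" using p unfolding vt by simp
    have "\<forall>i. \<exists>B>0. \<forall>x. \<bar>l x i\<bar> \<le> B * norm x"
      using linear_bounded_pos[OF lin] by (metis real_norm_def)
    then obtain B where B: "\<And>i. B i > 0" "\<And>i x. \<bar>l x i\<bar> \<le> B i * norm x" by metis
    define b where "b = (\<Sum>i<s. B i) + 1"
    have b: "b > 0" unfolding b_def using B(1) by (simp add: add_nonneg_pos sum_nonneg less_imp_le)
    define \<delta> where "\<delta> = \<epsilon> / (2 * b)"
    have \<delta>: "\<delta> > 0" "\<And>u. dist u t < \<delta> \<Longrightarrow> (\<Sum>i<s. \<bar>l (t - u) i\<bar>) < \<epsilon> / 2"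
    proof -
      show "\<delta> > 0" unfolding \<delta>_def using b \<open>\<epsilon> > 0\<close> by simp
      fix u assume u: "dist u t < \<delta>"
      have "(\<Sum>i<s. \<bar>l (t - u) i\<bar>) \<le> (\<Sum>i<s. B i * norm (t - u))" by (intro sum_mono B(2))
      also have "\<dots> = (\<Sum>i<s. B i) * norm (t - u)" by (simp add: sum_distrib_right)
      also have "\<dots> \<le> b * norm (t - u)" unfolding b_def by (intro mult_right_mono) auto
      also have "\<dots> < b * \<delta>" using u b by (simp add: dist_norm norm_minus_commute)
      also have "\<dots> = \<epsilon> / 2" unfolding \<delta>_def using b by simp
      finally show "(\<Sum>i<s. \<bar>l (t - u) i\<bar>) < \<epsilon> / 2" .
    qed
    define U where "U = torus.mball s v (\<epsilon> / 2) \<times> ball t \<delta>"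
    have "openin (prod_topology (torus s) euclidean) U"
      unfolding U_def openin_prod_Times_iff
      using torus.openin_mball[of s v "\<epsilon> / 2"] unfolding torus_mtopology by simp
    moreover have "p \<in> U" unfolding U_def vt using v \<open>\<epsilon> > 0\<close> \<delta>(1) by simp
    moreover have "(\<lambda>(v, t). \<beta> v t) q \<in> torus.mball s ((\<lambda>(v, t). \<beta> v t) p) \<epsilon>" if q: "q \<in> U" for q
    proof -
      obtain w u where wu: "q = (w, u)" by (cases q)
      have w: "w \<in> topspace (torus s)" "torus_dist s v w < \<epsilon> / 2" and u: "dist u t < \<delta>"
        using q unfolding wu U_def by (auto simp: dist_commute)
      have "torus_dist s (\<beta> v t) (\<beta> w u) < \<epsilon>" using dist[OF v w(1), of t u] w(2) \<delta>(2)[OF u] by linarith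
      then show ?thesis unfolding vt wu using top v w(1) by simp
    qed
    ultimately show "\<exists>U. openin (prod_topology (torus s) euclidean) U \<and> p \<in> U \<and>
        (\<forall>q\<in>U. (\<lambda>(v, t). \<beta> v t) q \<in> torus.mball s ((\<lambda>(v, t). \<beta> v t) p) \<epsilon>)" by blast
  qed
  then have cont: "continuous_map (prod_topology (torus s) euclidean) (torus s) (\<lambda>(v, t). \<beta> v t)"
    unfolding torus_mtopology .
  show "dynamical_system (torus s) \<beta>"
    unfolding dynamical_system_def
  proof (intro conjI ballI allI compact_torus metrizable_torus cont)
    fix v t u assume "v \<in> topspace (torus s)"
    then obtain x where x: "x \<in> topspace (E s)" "v = torus_class s x" unfolding topspace_torus by blast
    show "\<beta> v 0 = v" unfolding x(2) using \<beta>(1)[OF x(1)] l0 by simp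
    show "\<beta> (\<beta> v t) u = \<beta> v (t + u)"
      unfolding x(2) \<beta>(1)[OF x(1)] \<beta>(1)[OF \<beta>(2)[OF x(1)]] ladd by (simp add: add.assoc)
  qed
  define m where "m = metric (topspace (torus s), torus_dist s)"
  have m: "mtopology_of m = torus s" "mdist m = torus_dist s"
    unfolding m_def using torus_mtopology[of s] by (simp_all add: mtopology_of_def torus.mspace_metric torus.mdist_metric)
  have "torus_dist s (\<beta> v t) (\<beta> w t) < \<epsilon>" if "v \<in> topspace (torus s)" "w \<in> topspace (torus s)" "torus_dist s v w < \<epsilon>" for v w t \<epsilon>
    using dist[OF that(1,2), of t t] that(3) by (simp add: l0)
  then show "equicontinuous_action (torus s) \<beta>"
    unfolding equicontinuous_action_def using m by (intro exI[of _ m]) auto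
qed

section \<open>Coordinates and the address map\<close>

locale address_system = repetitive_meyer \<Lambda> for \<Lambda> :: "'a::euclidean_space set" +
  fixes b :: "nat \<Rightarrow> 'a"
  assumes basis: "zbasis (difference_group \<Lambda>) b"
begin

abbreviation s :: nat where "s \<equiv> difference_rank \<Lambda>"

definition coord :: "'a \<Rightarrow> nat \<Rightarrow> real"
  where "coord t i = (if i < s then of_int (zcoord L b t i) else 0)"

text \<open>A left inverse of \<open>coord\<close> on \<open>L\<close> and, by
  \<open>combine_lin\<close>, of \<open>lin\<close> on the whole space; its kernel therefore
  contains all stars.\<close>

definition combine :: "(nat \<Rightarrow> real) \<Rightarrow> 'a"
  where "combine v = (\<Sum>i<s. v i *\<^sub>R b i)"

lemma inj_b: "inj_on b {..<s}"
  and indep_b: "zmod.independent (b ` {..<s})"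
  and span_b: "zmod.span (b ` {..<s}) = L"
  using basis unfolding zbasis_def by auto

lemma b_mem: "i < s \<Longrightarrow> b i \<in> L"
  using zmod.span_base[of "b i" "b ` {..<s}"] span_b by auto

lemma coord_E: "coord t \<in> topspace (E s)"
  by (simp add: mem_E coord_def)

lemma coord_Ints: "coord t i \<in> \<int>"
  by (simp add: coord_def)

lemma coord_add: "x \<in> L \<Longrightarrow> y \<in> L \<Longrightarrow> coord (x + y) i = coord x i + coord y i"
  unfolding coord_def zcoord_def using zmod.representation_add[OF indep_b, of x y] span_b
  by (simp add: add.commute)

lemma additive_coord: "additive_on L (\<lambda>t. coord t i)"
  unfolding additive_on_def using coord_add by blast

lemma coord_b: "i < s \<Longrightarrow> j < s \<Longrightarrow> coord (b i) j = (if i = j then 1 else 0)"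
  unfolding coord_def zcoord_def using zmod.representation_basis[OF indep_b, of "b i"] inj_b
  by (auto simp: inj_on_def)

lemma combine_coord:
  assumes "t \<in> L" shows "combine (coord t) = t"
proof -
  have "(\<Sum>x\<in>b ` {..<s}. of_int (zmod.representation (b ` {..<s}) t x) *\<^sub>R x) = t"
    by (rule zmod.sum_representation_eq[OF indep_b]) (use assms span_b in auto)
  then show ?thesis
    unfolding sum.reindex[OF inj_b] combine_def coord_def zcoord_def by simp
qed

lemma coord_inject: "x \<in> L \<Longrightarrow> y \<in> L \<Longrightarrow> (\<And>i. i < s \<Longrightarrow> coord x i = coord y i) \<Longrightarrow> x = y"
  using combine_coord[of x] combine_coord[of y] unfolding combine_def by (metis (no_types, lifting) lessThan_iff sum.cong)

lemma combine_add: "combine (\<lambda>i. v i + w i) = combine v + combine w"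
  unfolding combine_def by (simp add: scaleR_add_left sum.distrib)

lemma combine_diff: "combine (\<lambda>i. v i - w i) = combine v - combine w"
  unfolding combine_def by (simp add: scaleR_diff_left sum_subtractf)

lemma combine_scale: "combine (\<lambda>i. c * v i) = c *\<^sub>R combine v"
  unfolding combine_def by (simp add: scaleR_sum_right)

lemma combine_cong: "(\<And>i. i < s \<Longrightarrow> v i = w i) \<Longrightarrow> combine v = combine w"
  unfolding combine_def by (intro sum.cong) auto

lemma additive_scale:
  assumes add: "additive_on L h" and x: "x \<in> L"
  shows "of_int k *\<^sub>R x \<in> L \<and> h (of_int k *\<^sub>R x) = of_int k * h x"
proof -
  note nat = additive_on_of_nat[OF add x]
  show ?thesis
  proof (cases "k \<ge> 0")
    case True then show ?thesis using nat[of "nat k"] by simp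
  next
    case False
    then have eq: "of_int k *\<^sub>R x = - (of_nat (nat (- k)) *\<^sub>R x)" by simp
    show ?thesis unfolding eq using nat[of "nat (- k)"] False additive_on_minus[OF add, of "of_nat (nat (- k)) *\<^sub>R x"] by simp
  qed
qed

lemma additive_sum:
  assumes add: "additive_on L h" and x: "\<And>i. i \<in> I \<Longrightarrow> x i \<in> L"
  shows "(\<Sum>i\<in>I. x i) \<in> L \<and> h (\<Sum>i\<in>I. x i) = (\<Sum>i\<in>I. h (x i))"
  using x
proof (induction I rule: infinite_finite_induct)
  case (insert i I)
  then have m: "x i \<in> L" "(\<Sum>i\<in>I. x i) \<in> L" "h (\<Sum>i\<in>I. x i) = (\<Sum>i\<in>I. h (x i))" by auto
  then show ?case using insert(1,2) group_closure_add[OF m(1,2)] additive_on_add[OF add m(1,2)] by simp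
qed (use additive_on_zero[OF add] in auto)

lemma combine_Ints:
  assumes k: "\<And>i. i < s \<Longrightarrow> k i \<in> \<int>" and add: "additive_on L h"
  shows "combine k \<in> L \<and> h (combine k) = (\<Sum>i<s. k i * h (b i))"
proof -
  have k': "k i = of_int \<lfloor>k i\<rfloor>" if "i < s" for i using k[OF that] by (metis Ints_cases floor_of_int)
  have eq: "combine k = (\<Sum>i<s. of_int \<lfloor>k i\<rfloor> *\<^sub>R b i)" unfolding combine_def using k' by (intro sum.cong) auto
  have m: "of_int \<lfloor>k i\<rfloor> *\<^sub>R b i \<in> L" "h (of_int \<lfloor>k i\<rfloor> *\<^sub>R b i) = k i * h (b i)" if "i \<in> {..<s}" for i
    using additive_scale[OF add b_mem, of i "\<lfloor>k i\<rfloor>"] k'[of i] that by auto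
  have "(\<Sum>i<s. of_int \<lfloor>k i\<rfloor> *\<^sub>R b i) \<in> L \<and> h (\<Sum>i<s. of_int \<lfloor>k i\<rfloor> *\<^sub>R b i) = (\<Sum>i<s. h (of_int \<lfloor>k i\<rfloor> *\<^sub>R b i))"
    by (rule additive_sum[OF add m(1)])
  then show ?thesis unfolding eq using m(2) by simp
qed

lemma additive_combine:
  assumes "additive_on L h" "t \<in> L" shows "h t = (\<Sum>i<s. coord t i * h (b i))"
  using combine_Ints[of "coord t" h] assms combine_coord coord_Ints by simp

lemma coord_surj:
  assumes k: "\<And>i. i < s \<Longrightarrow> k i \<in> \<int>"
  shows "combine k \<in> L" "i < s \<Longrightarrow> coord (combine k) i = k i"
proof -
  show "combine k \<in> L" using combine_Ints[of k, OF k additive_coord] by blast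
  assume i: "i < s"
  have "coord (combine k) i = (\<Sum>j<s. k j * coord (b j) i)" using combine_Ints[of k, OF k additive_coord] by blast
  also have "\<dots> = (\<Sum>j<s. if j = i then k j else 0)" using i by (intro sum.cong) (auto simp: coord_b)
  also have "\<dots> = k i" using i by simp
  finally show "coord (combine k) i = k i" .
qed

subsection \<open>The linear part\<close>

definition lin :: "'a \<Rightarrow> nat \<Rightarrow> real" where "lin = address_linear_map \<Lambda> b"

text \<open>The members of the transversal together cover exactly \<open>D\<close>, so the condition
  that defines the linear part may be read on \<open>D\<close>.\<close>

lemma transversal_points: "(\<forall>A\<in>\<Xi>. \<forall>t\<in>A. Q t) \<longleftrightarrow> (\<forall>t\<in>D. Q t)"
proof
  assume Q: "\<forall>A\<in>\<Xi>. \<forall>t\<in>A. Q t"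
  show "\<forall>t\<in>D. Q t"
  proof
    fix t assume "t \<in> D"
    then obtain x y where "x \<in> \<Lambda>" "y \<in> \<Lambda>" "t = x - y" by (rule difference_setE)
    then show "Q t" using Q transversal_translate[OF base_transversal, of y] by (auto simp: mem_translate)
  qed
qed (use transversal_subset in blast)

text \<open>Existence comes from \<open>additive_near_linear\<close> in each coordinate, uniqueness
  from \<open>linear_bounded_on_difference_set\<close>; together they make the definite description
  meaningful.\<close>

lemma lin_spec:
  "(\<forall>t. lin t \<in> topspace (E s)) \<and> (\<forall>i. linear (\<lambda>t. lin t i)) \<and>
    (\<exists>C>0. \<forall>t\<in>D. L2_set (\<lambda>i. of_int (zcoord L b t i) - lin t i) {..<s} \<le> C)"
proof -
  define spec where "spec l \<longleftrightarrow> (\<forall>t. l t \<in> topspace (E s)) \<and> (\<forall>i. linear (\<lambda>t. l t i)) \<and>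
      (\<exists>C>0. \<forall>t\<in>D. L2_set (\<lambda>i. of_int (zcoord L b t i) - l t i) {..<s} \<le> C)" for l
  have "\<forall>i. \<exists>l C. linear l \<and> (\<forall>u\<in>D. \<bar>coord u i - l u\<bar> \<le> C)"
    using additive_near_linear[OF meyer additive_coord] by blast
  then obtain l C where l: "\<And>i. linear (l i)" "\<And>i u. u \<in> D \<Longrightarrow> \<bar>coord u i - l i u\<bar> \<le> C i" by metis
  define m where "m t i = (if i < s then l i t else 0)" for t i
  have "spec m"
    unfolding spec_def
  proof (intro conjI allI)
    fix t show "m t \<in> topspace (E s)" unfolding m_def by (simp add: mem_E)
  next
    fix i show "linear (\<lambda>t. m t i)"
      unfolding m_def using l(1) by (cases "i < s") (auto intro: linear_zero)
  next
    have "L2_set (\<lambda>i. of_int (zcoord L b t i) - m t i) {..<s} \<le> 1 + (\<Sum>i<s. \<bar>C i\<bar>)" if "t \<in> D" for t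
    proof -
      have "L2_set (\<lambda>i. of_int (zcoord L b t i) - m t i) {..<s} \<le> (\<Sum>i<s. \<bar>of_int (zcoord L b t i) - m t i\<bar>)"
        by (rule L2_set_le_sum_abs)
      also have "\<dots> \<le> (\<Sum>i<s. \<bar>C i\<bar>)"
      proof (rule sum_mono)
        fix i assume "i \<in> {..<s}"
        then show "\<bar>of_int (zcoord L b t i) - m t i\<bar> \<le> \<bar>C i\<bar>"
          using l(2)[OF that, of i] unfolding m_def coord_def by simp
      qed
      finally show ?thesis by simp
    qed
    then show "\<exists>C>0. \<forall>t\<in>D. L2_set (\<lambda>i. of_int (zcoord L b t i) - m t i) {..<s} \<le> C"
      by (intro exI[of _ "1 + (\<Sum>i<s. \<bar>C i\<bar>)"]) (auto simp: add_pos_nonneg sum_nonneg)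
  qed
  moreover have "l1 = l2" if l1: "spec l1" and l2: "spec l2" for l1 l2
  proof (intro ext)
    fix t i
    show "l1 t i = l2 t i"
    proof (cases "i < s")
      case False
      then show ?thesis using l1 l2 unfolding spec_def by (simp add: mem_E)
    next
      case True
      have le: "\<bar>of_int (zcoord L b u i) - k u i\<bar> \<le> L2_set (\<lambda>i. of_int (zcoord L b u i) - k u i) {..<s}" for k u
      proof -
        have "(of_int (zcoord L b u i) - k u i)\<^sup>2 \<le> (\<Sum>i<s. (of_int (zcoord L b u i) - k u i)\<^sup>2)"
          by (rule member_le_sum) (use True in auto)
        then show ?thesis unfolding L2_set_def using real_le_rsqrt[of "\<bar>of_int (zcoord L b u i) - k u i\<bar>"] by simp
      qed
      obtain C1 where C1: "\<And>u. u \<in> D \<Longrightarrow> L2_set (\<lambda>i. of_int (zcoord L b u i) - l1 u i) {..<s} \<le> C1"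
        using l1 unfolding spec_def by blast
      obtain C2 where C2: "\<And>u. u \<in> D \<Longrightarrow> L2_set (\<lambda>i. of_int (zcoord L b u i) - l2 u i) {..<s} \<le> C2"
        using l2 unfolding spec_def by blast
      have "l1 t i - l2 t i = 0"
      proof (rule linear_bounded_on_difference_set[OF meyer])
        show "linear (\<lambda>t. l1 t i - l2 t i)" using l1 l2 unfolding spec_def by (intro linear_compose_sub) auto
        fix u assume u: "u \<in> D"
        show "norm (l1 u i - l2 u i) \<le> C1 + C2"
          using le[of u l1] le[of u l2] C1[OF u] C2[OF u] by simp
      qed
      then show ?thesis by simp
    qed
  qed
  ultimately have "\<exists>!l. spec l" by blast
  then have "spec (THE l. spec l)" by (rule theI')
  moreover have "lin = (THE l. spec l)"
    unfolding lin_def address_linear_map_def spec_def transversal_points ..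
  ultimately show ?thesis unfolding spec_def by simp
qed

lemma lin_E: "lin t \<in> topspace (E s)"
  and linear_lin: "linear (\<lambda>t. lin t i)"
  using lin_spec by blast+

lemma lin_add: "lin (t + u) i = lin t i + lin u i"
  and lin_diff: "lin (t - u) i = lin t i - lin u i"
  and lin_minus: "lin (- t) i = - lin t i"
  and lin_0: "lin 0 i = 0"
  and lin_scale: "lin (c *\<^sub>R t) i = c * lin t i"
  using linear_add[OF linear_lin] linear_diff[OF linear_lin] linear_neg[OF linear_lin]
    linear_0[OF linear_lin] linear_cmul[OF linear_lin] by auto

lemma lin_bound: "\<exists>B>0. \<forall>t. \<forall>i. \<bar>lin t i\<bar> \<le> B * norm t"
proof -
  have "\<forall>i. \<exists>B>0. \<forall>x. \<bar>lin x i\<bar> \<le> B * norm x"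
    using linear_bounded_pos[OF linear_lin] by (metis real_norm_def)
  then obtain B where B: "\<And>i. B i > 0" "\<And>i x. \<bar>lin x i\<bar> \<le> B i * norm x" by metis
  have pos: "(\<Sum>i<s. B i) \<ge> 0" using B(1) by (simp add: sum_nonneg less_imp_le)
  have "\<bar>lin t i\<bar> \<le> (1 + (\<Sum>i<s. B i)) * norm t" for t i
  proof (cases "i < s")
    case True
    have "B i \<le> (\<Sum>i<s. B i)" by (rule member_le_sum) (use True B(1) in \<open>auto simp: less_imp_le\<close>)
    then have "B i * norm t \<le> (1 + (\<Sum>i<s. B i)) * norm t" by (intro mult_right_mono) auto
    then show ?thesis using B(2)[of t i] by linarith
  next
    case False
    then show ?thesis using lin_E[of t] pos by (simp add: mem_E)
  qed
  then show ?thesis using pos by (intro exI[of _ "1 + (\<Sum>i<s. B i)"]) auto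
qed

definition star :: "'a \<Rightarrow> nat \<Rightarrow> real"
  where "star t i = coord t i - lin t i"

lemma star_E: "star t \<in> topspace (E s)"
  using coord_E[of t] lin_E[of t] by (simp add: mem_E star_def)

lemma star_bounded: "\<exists>C>0. \<forall>u\<in>D. \<forall>i. \<bar>star u i\<bar> \<le> C"
proof -
  obtain C where C: "C > 0" "\<And>u. u \<in> D \<Longrightarrow> L2_set (\<lambda>i. of_int (zcoord L b u i) - lin u i) {..<s} \<le> C"
    using lin_spec by blast
  have "\<bar>star u i\<bar> \<le> C" if u: "u \<in> D" for u i
  proof (cases "i < s")
    case True
    have "(of_int (zcoord L b u i) - lin u i)\<^sup>2 \<le> (\<Sum>i<s. (of_int (zcoord L b u i) - lin u i)\<^sup>2)"
      by (rule member_le_sum) (use True in auto)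
    then have "\<bar>star u i\<bar> \<le> L2_set (\<lambda>i. of_int (zcoord L b u i) - lin u i) {..<s}"
      unfolding L2_set_def star_def coord_def using True
        real_le_rsqrt[of "\<bar>of_int (zcoord L b u i) - lin u i\<bar>"] by simp
    then show ?thesis using C(2)[OF u] by linarith
  next
    case False
    then show ?thesis using star_E[of u] C(1) by (simp add: mem_E)
  qed
  then show ?thesis using C(1) by blast
qed

lemma additive_star: "additive_on L (\<lambda>t. star t i)"
  unfolding additive_on_def star_def using coord_add lin_add by simp

lemma star_add: "x \<in> L \<Longrightarrow> y \<in> L \<Longrightarrow> star (x + y) i = star x i + star y i"
  and star_diff: "x \<in> L \<Longrightarrow> y \<in> L \<Longrightarrow> star (x - y) i = star x i - star y i"
  and star_minus: "x \<in> L \<Longrightarrow> star (- x) i = - star x i"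
  using additive_on_add[OF additive_star] additive_on_diff[OF additive_star]
    additive_on_minus[OF additive_star] by auto

lemma combine_bound: "\<exists>B>0. \<forall>v. \<forall>m\<ge>0. (\<forall>i<s. \<bar>v i\<bar> \<le> m) \<longrightarrow> norm (combine v) \<le> B * m"
proof -
  have le: "norm (combine v) \<le> (\<Sum>i<s. norm (b i)) * m" if "\<forall>i<s. \<bar>v i\<bar> \<le> m" for v m
  proof -
    have "norm (combine v) \<le> (\<Sum>i<s. norm (v i *\<^sub>R b i))" unfolding combine_def by (rule norm_sum)
    also have "\<dots> \<le> (\<Sum>i<s. norm (b i) * m)"
      using that by (intro sum_mono) (simp add: mult.commute[of "norm _"] mult_right_mono)
    finally show ?thesis by (simp add: sum_distrib_right)
  qed
  have "norm (combine v) \<le> (1 + (\<Sum>i<s. norm (b i))) * m" if v: "\<forall>i<s. \<bar>v i\<bar> \<le> m" and "m \<ge> 0" for v m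
    using le[OF v] \<open>m \<ge> 0\<close> by (simp add: algebra_simps)
  then show ?thesis by (intro exI[of _ "1 + (\<Sum>i<s. norm (b i))"]) (auto simp: add_pos_nonneg sum_nonneg)
qed

end

context address_system
begin

text \<open>The difference of the two sides is linear in \<open>t\<close>, and on \<open>D\<close>
  it equals \<open>- combine (star t)\<close>, which is bounded.\<close>

lemma combine_lin: "combine (lin t) = t"
proof -
  have linear: "linear (\<lambda>t. combine (lin t) - t)"
  proof (rule linearI)
    fix x y show "combine (lin (x + y)) - (x + y) = combine (lin x) - x + (combine (lin y) - y)"
      using combine_add[of "lin x" "lin y"] combine_cong[of "lin (x + y)" "\<lambda>i. lin x i + lin y i"]
      by (simp add: lin_add)
  next
    fix c x show "combine (lin (c *\<^sub>R x)) - c *\<^sub>R x = c *\<^sub>R (combine (lin x) - x)"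
      using combine_scale[of c "lin x"] combine_cong[of "lin (c *\<^sub>R x)" "\<lambda>i. c * lin x i"]
      by (simp add: lin_scale algebra_simps)
  qed
  obtain C where C: "C > 0" "\<And>u i. u \<in> D \<Longrightarrow> \<bar>star u i\<bar> \<le> C" using star_bounded by blast
  obtain B where B: "\<And>v m. m \<ge> 0 \<Longrightarrow> (\<And>i. i < s \<Longrightarrow> \<bar>v i\<bar> \<le> m) \<Longrightarrow> norm (combine v) \<le> B * m"
    using combine_bound by blast
  have "norm (combine (lin u) - u) \<le> B * C" if u: "u \<in> D" for u
  proof -
    have "combine (\<lambda>i. coord u i - star u i) = u - combine (star u)"
      unfolding combine_diff using combine_coord[OF difference_set_group[OF u]] by simp
    then have "combine (lin u) - u = - combine (star u)" by (simp add: star_def)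
    then show ?thesis using B[of C "star u"] C u by (simp add: less_imp_le)
  qed
  then show ?thesis using linear_bounded_on_difference_set[OF meyer linear, of "B * C" t] by simp
qed

lemma combine_star: "t \<in> L \<Longrightarrow> combine (star t) = 0"
  using combine_diff[of "coord t" "lin t"] combine_coord[of t] combine_lin[of t]
    combine_cong[of "star t" "\<lambda>i. coord t i - lin t i"] by (simp add: star_def)

text \<open>The internal space; its dimension is the rank minus the dimension of the ambient space,
  since \<open>combine\<close> is onto by \<open>combine_lin\<close>.\<close>

definition kern :: "(nat \<Rightarrow> real) set"
  where "kern = {v \<in> topspace (E s). combine v = 0}"

lemma star_kern: "t \<in> L \<Longrightarrow> star t \<in> kern"
  unfolding kern_def using star_E combine_star by simp

subsection \<open>The coboundary of the star map\<close>

definition is_cobound :: "nat \<Rightarrow> ('a set \<Rightarrow> real) \<Rightarrow> bool"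
  where "is_cobound i g \<longleftrightarrow> g \<Lambda> = 0 \<and> (\<forall>A\<in>\<Xi>. \<forall>x\<in>A. g (translate A x) = g A + star x i) \<and> patch_continuous g"

definition cobound :: "'a set \<Rightarrow> nat \<Rightarrow> real"
  where "cobound A i = (if i < s then (SOME g. is_cobound i g) A else 0)"

lemma cobound_spec: "i < s \<Longrightarrow> is_cobound i (\<lambda>A. cobound A i)"
proof -
  assume "i < s"
  obtain C where C: "\<And>u. u \<in> D \<Longrightarrow> \<bar>star u i\<bar> \<le> C" using star_bounded by blast
  obtain g where "is_cobound i g"
    using bounded_additive_coboundary[OF additive_star C] unfolding is_cobound_def by metis
  then have "is_cobound i (SOME g. is_cobound i g)" by (rule someI[of "is_cobound i"])
  then show ?thesis unfolding cobound_def using \<open>i < s\<close> by simp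
qed

lemma cobound_E: "cobound A \<in> topspace (E s)"
  by (simp add: mem_E cobound_def)

lemma cobound_base: "cobound \<Lambda> i = 0"
  using cobound_spec[of i] unfolding is_cobound_def by (cases "i < s") (auto simp: cobound_def)

lemma cobound_translate: "A \<in> \<Xi> \<Longrightarrow> x \<in> A \<Longrightarrow> cobound (translate A x) i = cobound A i + star x i"
  using cobound_spec[of i] star_E[of x] unfolding is_cobound_def
  by (cases "i < s") (auto simp: cobound_def mem_E)

lemma patch_continuous_cobound: "patch_continuous (\<lambda>A. cobound A i)"
  using cobound_spec[of i] patch_continuous_const[of 0] unfolding is_cobound_def
  by (cases "i < s") (auto simp: cobound_def)

lemma cobound_point: "x \<in> \<Lambda> \<Longrightarrow> cobound (translate \<Lambda> x) i = star x i"
  using cobound_translate[OF base_transversal] cobound_base by simp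

text \<open>It holds on the translates of \<Lambda> by \<open>combine_star\<close> and extends by
  continuity. Continuity is available for real functions, so the vector is tested against
  \<open>e\<close>, its own value at \<open>A\<close>.\<close>

lemma combine_cobound:
  assumes A: "A \<in> \<Xi>" shows "combine (cobound A) = 0"
proof -
  define e where "e = combine (cobound A)"
  have inner: "combine v \<bullet> e = (\<Sum>i<s. (b i \<bullet> e) * v i)" for v
    unfolding combine_def by (simp add: inner_sum_left mult.commute)
  have "combine (cobound A) \<bullet> e = 0"
  proof (rule patch_continuous_eq_0[OF _ _ A])
    show "patch_continuous (\<lambda>A. combine (cobound A) \<bullet> e)"
      unfolding inner by (intro patch_continuous_sum patch_continuous_cmult patch_continuous_cobound)
    fix x assume x: "x \<in> \<Lambda>"
    have "combine (cobound (translate \<Lambda> x)) = combine (star x)"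
      using cobound_point[OF x] by (intro combine_cong) simp
    then show "combine (cobound (translate \<Lambda> x)) \<bullet> e = 0" using combine_star[OF mem_L[OF x]] by simp
  qed
  then show ?thesis unfolding e_def by simp
qed

lemma cobound_kern: "A \<in> \<Xi> \<Longrightarrow> cobound A \<in> kern"
  unfolding kern_def using cobound_E combine_cobound by simp

lemma patch_continuous_modulus:
  fixes n :: nat
  assumes f: "\<And>i. i < n \<Longrightarrow> patch_continuous (f i)" and "\<epsilon> > 0"
  shows "\<exists>\<rho>. \<forall>A\<in>\<Xi>. \<forall>B\<in>\<Xi>. agree \<rho> A B \<longrightarrow> (\<forall>i<n. \<bar>f i A - f i B\<bar> < \<epsilon>)"
proof -
  have "\<forall>i. \<exists>\<rho>. i < n \<longrightarrow> (\<forall>A\<in>\<Xi>. \<forall>B\<in>\<Xi>. agree \<rho> A B \<longrightarrow> \<bar>f i A - f i B\<bar> < \<epsilon>)"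
    using f \<open>\<epsilon> > 0\<close> unfolding patch_continuous_def by blast
  then obtain \<rho> where \<rho>: "\<And>i A B. i < n \<Longrightarrow> A \<in> \<Xi> \<Longrightarrow> B \<in> \<Xi> \<Longrightarrow> agree (\<rho> i) A B \<Longrightarrow> \<bar>f i A - f i B\<bar> < \<epsilon>"
    by metis
  have "\<bar>f i A - f i B\<bar> < \<epsilon>" if "A \<in> \<Xi>" "B \<in> \<Xi>" "agree (Max (insert 0 (\<rho> ` {..<n}))) A B" "i < n" for A B i
    by (rule \<rho>[OF that(4,1,2) agree_mono[OF that(3)]], rule Max_ge) (use that(4) in auto)
  then show ?thesis by blast
qed

lemma cobound_modulus:
  assumes "\<epsilon> > 0"
  obtains \<rho> where "\<And>A B i. A \<in> \<Xi> \<Longrightarrow> B \<in> \<Xi> \<Longrightarrow> agree \<rho> A B \<Longrightarrow> i < s \<Longrightarrow> \<bar>cobound A i - cobound B i\<bar> < \<epsilon>"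
  using patch_continuous_modulus[of s "\<lambda>i A. cobound A i", OF patch_continuous_cobound assms] by blast

text \<open>Several coordinates are reduced to one real function, the sum of the deviations.\<close>

lemma patch_continuous_attains:
  fixes n :: nat
  assumes f: "\<And>j. j < n \<Longrightarrow> patch_continuous (f j)" and Q: "Q = \<Xi> \<or> (\<exists>u. Q = {A\<in>\<Xi>. u \<notin> A})"
    and near: "\<And>\<epsilon>. \<epsilon> > 0 \<Longrightarrow> \<exists>A\<in>Q. \<forall>j<n. \<bar>f j A - y j\<bar> < \<epsilon>"
  shows "\<exists>A\<in>Q. \<forall>j<n. f j A = y j"
proof -
  define h where "h A = (\<Sum>j<n. \<bar>f j A - y j\<bar>)" for A
  have "patch_continuous h"
    unfolding h_def
    by (intro patch_continuous_sum patch_continuous_abs patch_continuous_diff patch_continuous_const f) simp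
  moreover have "\<exists>A\<in>Q. \<bar>h A\<bar> < \<epsilon>" if e: "\<epsilon> > 0" for \<epsilon>
  proof -
    have "\<epsilon> / (n + 1) > 0" using e by simp
    then obtain A where A: "A \<in> Q" "\<And>j. j < n \<Longrightarrow> \<bar>f j A - y j\<bar> < \<epsilon> / (n + 1)" using near by blast
    have "h A \<le> (\<Sum>j<n. \<epsilon> / (n + 1))" unfolding h_def using A(2) by (intro sum_mono) (auto intro: less_imp_le)
    also have "\<dots> < \<epsilon>" using e by (simp add: field_simps)
    finally have "h A < \<epsilon>" .
    moreover have "h A \<ge> 0" unfolding h_def by (simp add: sum_nonneg)
    ultimately show ?thesis using A(1) by (intro bexI[of _ A]) auto
  qed
  ultimately obtain A where A: "A \<in> Q" "h A = 0" using patch_continuous_attains_0[OF _ Q] by blast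
  then have "\<forall>j\<in>{..<n}. \<bar>f j A - y j\<bar> = 0" unfolding h_def by (subst (asm) sum_nonneg_eq_0_iff) auto
  then show ?thesis using A(1) by auto
qed

lemmas cobound_attains = patch_continuous_attains[of s "\<lambda>i A. cobound A i", OF patch_continuous_cobound]

section \<open>Elements of \<open>L\<close> with prescribed star\<close>

lemma finite_bounded_star: "finite {u \<in> L. norm u \<le> R \<and> (\<forall>i<s. \<bar>star u i\<bar> \<le> C)}"
proof -
  obtain B where B: "B > 0" "\<And>t i. \<bar>lin t i\<bar> \<le> B * norm t" using lin_bound by blast
  \<comment> \<open>Since \<open>coord\<close> is the sum of \<open>star\<close> and
    \<open>lin\<close>, bounds on the star and on the norm bound the integer coordinates. This is
    the discreteness of the lattice of pairs \<open>(u, star u)\<close>.\<close>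
  define N where "N = \<lceil>C + B * R\<rceil>"
  define \<phi> where "\<phi> u = restrict (zcoord L b u) {..<s}" for u
  have sub: "\<phi> ` {u \<in> L. norm u \<le> R \<and> (\<forall>i<s. \<bar>star u i\<bar> \<le> C)} \<subseteq> Pi\<^sub>E {..<s} (\<lambda>_. {-N..N})"
  proof
    fix f assume "f \<in> \<phi> ` {u \<in> L. norm u \<le> R \<and> (\<forall>i<s. \<bar>star u i\<bar> \<le> C)}"
    then obtain u where u: "f = \<phi> u" "norm u \<le> R" "\<And>i. i < s \<Longrightarrow> \<bar>star u i\<bar> \<le> C" by blast
    have "zcoord L b u i \<in> {-N..N}" if i: "i < s" for i
    proof -
      have "B * norm u \<le> B * R" using u(2) B(1) by simp
      then have "\<bar>coord u i\<bar> \<le> C + B * R" using u(3)[OF i] B(2)[of u i] unfolding star_def by linarith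
      then have "\<bar>of_int (zcoord L b u i)\<bar> \<le> C + B * R" unfolding coord_def using i by simp
      then have "of_int \<bar>zcoord L b u i\<bar> \<le> C + B * R" by simp
      then have "\<bar>zcoord L b u i\<bar> \<le> N" unfolding N_def by linarith
      then show ?thesis by auto
    qed
    then show "f \<in> Pi\<^sub>E {..<s} (\<lambda>_. {-N..N})" unfolding u(1) \<phi>_def by auto
  qed
  have fin: "finite (Pi\<^sub>E {..<s} (\<lambda>_. {-N..N}))" by (simp add: finite_PiE)
  have "inj_on \<phi> L"
  proof (rule inj_onI)
    fix x y assume xy: "x \<in> L" "y \<in> L" "\<phi> x = \<phi> y"
    show "x = y"
    proof (rule coord_inject[OF xy(1,2)])
      fix i assume i: "i < s"
      then have "zcoord L b x i = zcoord L b y i" using fun_cong[OF xy(3), of i] unfolding \<phi>_def by simp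
      then show "coord x i = coord y i" unfolding coord_def by simp
    qed
  qed
  then have inj: "inj_on \<phi> {u \<in> L. norm u \<le> R \<and> (\<forall>i<s. \<bar>star u i\<bar> \<le> C)}"
    by (rule inj_on_subset) blast
  show ?thesis by (rule inj_on_finite[OF inj sub fin])
qed

text \<open>Take \<open>x \<in> \<Lambda>\<close> near \<gamma>. The remainder is short, and its
  star differs from that of \<gamma> by \<open>star x\<close>, which is bounded since
  \<open>x \<in> D\<close>.\<close>

lemma approximate_by_point:
  obtains R C where "\<And>\<gamma>. \<gamma> \<in> L \<Longrightarrow> \<exists>x\<in>\<Lambda>. \<exists>u\<in>L. \<gamma> = x + u \<and> norm u \<le> R \<and> (\<forall>i<s. \<bar>star u i\<bar> \<le> \<bar>star \<gamma> i\<bar> + C)"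
proof -
  obtain R where R: "\<And>c. \<exists>x\<in>\<Lambda>. norm (x - c) \<le> R" using relatively_dense by blast
  obtain C where C: "C > 0" "\<And>u i. u \<in> D \<Longrightarrow> \<bar>star u i\<bar> \<le> C" using star_bounded by blast
  have "\<exists>x\<in>\<Lambda>. \<exists>u\<in>L. \<gamma> = x + u \<and> norm u \<le> R \<and> (\<forall>i<s. \<bar>star u i\<bar> \<le> \<bar>star \<gamma> i\<bar> + C)" if \<gamma>: "\<gamma> \<in> L" for \<gamma>
  proof -
    obtain x where x: "x \<in> \<Lambda>" "norm (x - \<gamma>) \<le> R" using R by blast
    have "\<bar>star (\<gamma> - x) i\<bar> \<le> \<bar>star \<gamma> i\<bar> + C" for i
      using C(2)[of x i] difference_setI[OF x(1) zero_mem] star_diff[OF \<gamma> mem_L[OF x(1)], of i] by simp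
    then show ?thesis
      using x mem_L[OF x(1)] \<gamma> by (intro bexI[of _ x] bexI[of _ "\<gamma> - x"]) (auto simp: norm_minus_commute group_closure.diff)
  qed
  then show ?thesis using that by blast
qed

text \<open>The algebraic content of surjectivity: it implies \<open>address_surj\<close>, and it
  follows from the existence of any factor map onto the torus
  (\<open>factor_map_star_dense\<close>).\<close>

definition star_dense :: bool
  where "star_dense \<longleftrightarrow> (\<forall>y\<in>kern. \<forall>\<epsilon>>0. \<exists>\<gamma>\<in>L. \<forall>i<s. \<bar>star \<gamma> i - y i\<bar> < \<epsilon>)"

text \<open>By \<open>approximate_by_point\<close> and \<open>finite_bounded_star\<close> only finitely many \<open>u\<close> matter, and for each of them
  the values of the coboundary on \<open>Q u\<close> form a closed set.\<close>

lemma near_decomposition: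
  assumes Q: "\<And>u. Q u = \<Xi> \<or> (\<exists>x. Q u = {A\<in>\<Xi>. x \<notin> A})"
    and none: "\<And>u A. u \<in> L \<Longrightarrow> A \<in> Q u \<Longrightarrow> \<not> (\<forall>i<s. cobound A i = y i - star u i)"
  shows "\<exists>\<delta>>0. \<forall>\<gamma>\<in>L. (\<forall>i<s. \<bar>star \<gamma> i - y i\<bar> < \<delta>) \<longrightarrow>
    (\<exists>x\<in>\<Lambda>. \<exists>u\<in>L. \<gamma> = x + u \<and> translate \<Lambda> x \<notin> Q u)"
proof -
  obtain R C where RC: "\<And>\<gamma>. \<gamma> \<in> L \<Longrightarrow> \<exists>x\<in>\<Lambda>. \<exists>u\<in>L. \<gamma> = x + u \<and> norm u \<le> R \<and> (\<forall>i<s. \<bar>star u i\<bar> \<le> \<bar>star \<gamma> i\<bar> + C)"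
    using approximate_by_point by metis
  \<comment> \<open>Bounds the star of the remainder as soon as the star of \<gamma> is within 1 of
    \<open>y\<close>; this is why \<delta> is taken at most 1.\<close>
  define K where "K = (\<Sum>i<s. \<bar>y i\<bar>) + 1 + C"
  define F where "F = {u \<in> L. norm u \<le> R \<and> (\<forall>i<s. \<bar>star u i\<bar> \<le> K)}"
  have fin: "finite F" unfolding F_def by (rule finite_bounded_star)
  have "\<exists>\<delta>>0. \<forall>A\<in>Q u. \<not> (\<forall>i<s. \<bar>cobound A i - (y i - star u i)\<bar> < \<delta>)" if u: "u \<in> F" for u
  proof (rule ccontr)
    assume no: "\<not> (\<exists>\<delta>>0. \<forall>A\<in>Q u. \<not> (\<forall>i<s. \<bar>cobound A i - (y i - star u i)\<bar> < \<delta>))"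
    have near: "\<exists>A\<in>Q u. \<forall>i<s. \<bar>cobound A i - (y i - star u i)\<bar> < \<delta>" if "\<delta> > 0" for \<delta>
      using no that by blast
    obtain A where "A \<in> Q u" "\<forall>i<s. cobound A i = y i - star u i"
      using cobound_attains[OF Q near] by blast
    then show False using none u unfolding F_def by blast
  qed
  then obtain d where d: "\<And>u. u \<in> F \<Longrightarrow> d u > 0"
    "\<And>u A. u \<in> F \<Longrightarrow> A \<in> Q u \<Longrightarrow> \<not> (\<forall>i<s. \<bar>cobound A i - (y i - star u i)\<bar> < d u)"
    by metis
  define \<delta> where "\<delta> = Min (insert 1 (d ` F))"
  have \<delta>: "\<delta> > 0" "\<delta> \<le> 1" "\<And>u. u \<in> F \<Longrightarrow> \<delta> \<le> d u" unfolding \<delta>_def using fin d(1) by auto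
  have "\<exists>x\<in>\<Lambda>. \<exists>u\<in>L. \<gamma> = x + u \<and> translate \<Lambda> x \<notin> Q u"
    if \<gamma>: "\<gamma> \<in> L" and near: "\<And>i. i < s \<Longrightarrow> \<bar>star \<gamma> i - y i\<bar> < \<delta>" for \<gamma>
  proof -
    obtain x u where xu: "x \<in> \<Lambda>" "u \<in> L" "\<gamma> = x + u" "norm u \<le> R" "\<And>i. i < s \<Longrightarrow> \<bar>star u i\<bar> \<le> \<bar>star \<gamma> i\<bar> + C"
      using RC[OF \<gamma>] by blast
    have "\<bar>star u i\<bar> \<le> K" if i: "i < s" for i
    proof -
      have "\<bar>y i\<bar> \<le> (\<Sum>i<s. \<bar>y i\<bar>)" by (rule member_le_sum) (use i in auto)
      then show ?thesis using xu(5)[OF i] near[OF i] \<delta>(2) unfolding K_def by linarith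
    qed
    then have uF: "u \<in> F" unfolding F_def using xu by blast
    have "\<bar>cobound (translate \<Lambda> x) i - (y i - star u i)\<bar> < d u" if i: "i < s" for i
    proof -
      have "star \<gamma> i = star x i + star u i" unfolding xu(3) by (rule star_add[OF mem_L[OF xu(1)] xu(2)])
      then show ?thesis using near[OF i] \<delta>(3)[OF uF] unfolding cobound_point[OF xu(1)] by linarith
    qed
    then have "translate \<Lambda> x \<notin> Q u" using d(2)[OF uF] by blast
    then show ?thesis using xu by blast
  qed
  then show ?thesis using \<delta>(1) by blast
qed

text \<open>Otherwise \<open>near_decomposition\<close> applies with \<open>Q u = \<Xi>\<close> and,
  for some \<gamma> with star near \<open>y\<close>, produces a point of \<Lambda> whose translate
  lies outside the transversal.\<close>

lemma kern_decompose:
  assumes dense: star_dense and y: "y \<in> kern"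
  shows "\<exists>A\<in>\<Xi>. \<exists>u\<in>L. \<forall>i<s. y i = cobound A i + star u i"
proof (rule ccontr)
  assume none: "\<not> ?thesis"
  have "\<not> (\<forall>i<s. cobound A i = y i - star u i)" if "u \<in> L" "A \<in> \<Xi>" for u A
  proof
    assume "\<forall>i<s. cobound A i = y i - star u i"
    then have "\<forall>i<s. y i = cobound A i + star u i" by simp
    then show False using none that by blast
  qed
  then obtain \<delta> where \<delta>: "\<delta> > 0" "\<And>\<gamma>. \<gamma> \<in> L \<Longrightarrow> (\<forall>i<s. \<bar>star \<gamma> i - y i\<bar> < \<delta>) \<Longrightarrow> \<exists>x\<in>\<Lambda>. translate \<Lambda> x \<notin> \<Xi>"
    using near_decomposition[of "\<lambda>_. \<Xi>" y] by blast
  obtain \<gamma> where "\<gamma> \<in> L" "\<forall>i<s. \<bar>star \<gamma> i - y i\<bar> < \<delta>" using dense y \<delta>(1) unfolding star_dense_def by blast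
  then show False using \<delta>(2) transversal_translate[OF base_transversal] by blast
qed

subsection \<open>The address homomorphism\<close>

definition address_point :: "'a set \<Rightarrow> 'a \<Rightarrow> nat \<Rightarrow> real"
  where "address_point A p i = - cobound (translate A p) i - lin p i"

definition address :: "'a set \<Rightarrow> (nat \<Rightarrow> real) set"
  where "address A = torus_class s (address_point A (SOME p. p \<in> A))"

lemma address_point_E: "address_point A p \<in> topspace (E s)"
  using cobound_E[of "translate A p"] lin_E[of p] by (simp add: mem_E address_point_def)

text \<open>Another choice of \<open>p\<close> changes \<open>address_point\<close> by the star from
  the coboundary and by the linear part; together these are the integer coordinates of an element of
  \<open>L\<close>.\<close>

lemma address_eq:
  assumes A: "A \<in> hull_of \<Lambda>" and p: "p \<in> A"
  shows "address A = torus_class s (address_point A p)"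
  unfolding address_def torus_class_eq_iff[OF address_point_E address_point_E]
proof (intro allI impI)
  fix i assume "i < s"
  define q where "q = (SOME p. p \<in> A)"
  have q: "q \<in> A" unfolding q_def using p by (rule someI)
  have Ap: "translate A p \<in> \<Xi>" using hull_translate_transversal[OF A p] .
  have m: "q - p \<in> translate A p" using q by (simp add: mem_translate)
  have "cobound (translate A q) i = cobound (translate A p) i + star (q - p) i"
    using cobound_translate[OF Ap m, of i] by (simp add: translate_translate)
  then have "address_point A q i - address_point A p i = - coord (q - p) i"
    unfolding address_point_def star_def lin_diff by simp
  then show "address_point A q i - address_point A p i \<in> \<int>" using coord_Ints by simp
qed

lemma address_translate:
  assumes A: "A \<in> hull_of \<Lambda>"
  shows "address (translate A t) = torus_add (address A) (torus_class s (lin t))"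
proof -
  obtain p where p: "p \<in> A" using hull_nonempty[OF A] by blast
  have m: "p - t \<in> translate A t" using p by (simp add: mem_translate)
  have "address_point (translate A t) (p - t) = (\<lambda>i. address_point A p i + lin t i)"
    by (intro ext) (simp add: address_point_def translate_translate lin_diff)
  then show ?thesis
    unfolding address_eq[OF A p] address_eq[OF hull_of_translate[OF A] m]
      torus_add_class[OF address_point_E lin_E] by simp
qed

lemma address_transversal: "A \<in> \<Xi> \<Longrightarrow> address A = torus_class s (\<lambda>i. - cobound A i)"
  using address_eq[OF transversal_hull transversal_zero, of A]
  by (simp add: address_point_def[abs_def] translate_0 lin_0)

lemma address_in: "address A \<in> topspace (torus s)"
  unfolding address_def by (rule torus_class_in[OF address_point_E])

text \<open>\<open>p\<close> is a point of \<open>A\<close> and of every \<open>B\<close> that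
  agrees with \<open>A\<close> far enough, and \<open>p - t\<close> is one of
  \<open>translate B t\<close>. Computed at these points, the addresses differ by a small change of
  the coboundary and by \<open>lin t\<close>.\<close>

lemma address_locally_near:
  assumes A: "A \<in> hull_of \<Lambda>" and "\<delta> > 0"
  shows "\<exists>\<rho>. \<exists>\<epsilon>>0. \<forall>B\<in>hull_of \<Lambda>. agree \<rho> B A \<longrightarrow>
    (\<forall>t. norm t < \<epsilon> \<longrightarrow> torus_dist s (address A) (address (translate B t)) < \<delta>)"
proof -
  obtain p where p: "p \<in> A" using hull_nonempty[OF A] by blast
  \<comment> \<open>Each of the \<open>s\<close> coordinates will contribute at most
    \<open>2 * \<eta>\<close>.\<close>
  define \<eta> where "\<eta> = \<delta> / (2 * (s + 1))"
  have \<eta>: "\<eta> > 0" unfolding \<eta>_def using \<open>\<delta> > 0\<close> by simp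
  obtain \<rho> where \<rho>: "\<And>A B i. A \<in> \<Xi> \<Longrightarrow> B \<in> \<Xi> \<Longrightarrow> agree \<rho> A B \<Longrightarrow> i < s \<Longrightarrow> \<bar>cobound A i - cobound B i\<bar> < \<eta>"
    using cobound_modulus[OF \<eta>] by metis
  obtain K where K: "K > 0" "\<And>t i. \<bar>lin t i\<bar> \<le> K * norm t" using lin_bound by blast
  have "torus_dist s (address A) (address (translate B t)) < \<delta>"
    if B: "B \<in> hull_of \<Lambda>" and ag: "agree (\<bar>\<rho>\<bar> + norm p) B A" and t: "norm t < \<eta> / K" for B t
  proof -
    have pB: "p \<in> B" using agreeD[OF ag, of p] p by simp
    have m: "p - t \<in> translate B t" using pB by (simp add: mem_translate)
    have "agree \<rho> (translate A p) (translate B p)"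
      by (rule agree_translate[OF agree_sym[OF ag]]) simp
    then have near: "\<bar>cobound (translate A p) i - cobound (translate B p) i\<bar> < \<eta>" if "i < s" for i
      using \<rho> hull_translate_transversal[OF A p] hull_translate_transversal[OF B pB] that by blast
    have lt: "\<bar>lin t i\<bar> < \<eta>" for i
    proof -
      have "K * norm t < \<eta>" using t K(1) by (simp add: field_simps)
      then show ?thesis using K(2)[of t i] by linarith
    qed
    have "torus_dist s (address A) (address (translate B t)) =
        torus_pre_dist s (address_point A p) (address_point (translate B t) (p - t))"
      unfolding address_eq[OF A p] address_eq[OF hull_of_translate[OF B] m]
      by (rule torus_dist_class[OF address_point_E address_point_E])
    also have "\<dots> \<le> (\<Sum>i<s. \<bar>address_point A p i - address_point (translate B t) (p - t) i\<bar>)"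
      by (rule torus_pre_dist_le)
    also have "\<dots> \<le> (\<Sum>i<s. 2 * \<eta>)"
    proof (rule sum_mono)
      fix i assume "i \<in> {..<s}"
      then have "i < s" by simp
      have "address_point A p i - address_point (translate B t) (p - t) i
          = (cobound (translate B p) i - cobound (translate A p) i) - lin t i"
        by (simp add: address_point_def translate_translate lin_diff)
      then show "\<bar>address_point A p i - address_point (translate B t) (p - t) i\<bar> \<le> 2 * \<eta>"
        using near[OF \<open>i < s\<close>] lt[of i] by linarith
    qed
    also have "\<dots> < \<delta>" unfolding \<eta>_def using \<open>\<delta> > 0\<close> by (simp add: field_simps)
    finally show ?thesis .
  qed
  then show ?thesis using \<eta> K(1) by (intro exI[of _ "\<bar>\<rho>\<bar> + norm p"] exI[of _ "\<eta> / K"]) auto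
qed

lemma continuous_map_address: "continuous_map (hull_topology \<Lambda>) (torus s) address"
proof -
  have "\<exists>U. openin (hull_topology \<Lambda>) U \<and> A \<in> U \<and> (\<forall>B\<in>U. address B \<in> torus.mball s (address A) \<epsilon>)"
    if A: "A \<in> topspace (hull_topology \<Lambda>)" and e: "\<epsilon> > 0" for A \<epsilon>
  proof -
    define U where "U = {B \<in> hull_of \<Lambda>. torus_dist s (address A) (address B) < \<epsilon>}"
    have "openin (hull_topology \<Lambda>) U"
      unfolding openin_hull_topology_agree
    proof (intro conjI ballI)
      show "U \<subseteq> hull_of \<Lambda>" unfolding U_def by blast
      fix B assume B: "B \<in> U"
      then have B': "B \<in> hull_of \<Lambda>" "\<epsilon> - torus_dist s (address A) (address B) > 0" unfolding U_def by auto
      obtain \<rho> \<delta> where \<rho>: "\<delta> > 0" "\<And>C t. C \<in> hull_of \<Lambda> \<Longrightarrow> agree \<rho> C B \<Longrightarrow> norm t < \<delta> \<Longrightarrow>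
          torus_dist s (address B) (address (translate C t)) < \<epsilon> - torus_dist s (address A) (address B)"
        using address_locally_near[OF B'] by blast
      have "translate C t \<in> U" if "C \<in> hull_of \<Lambda>" "agree \<rho> C B" "norm t < \<delta>" for C t
        using \<rho>(2)[OF that] torus.triangle[OF address_in[of A] address_in[of B] address_in[of "translate C t"]]
          hull_of_translate[OF that(1)] unfolding U_def by simp
      then show "\<exists>\<rho>. \<exists>\<epsilon>>0. \<forall>C\<in>hull_of \<Lambda>. agree \<rho> C B \<longrightarrow> (\<forall>t. norm t < \<epsilon> \<longrightarrow> translate C t \<in> U)"
        using \<rho>(1) by blast
    qed
    moreover have "A \<in> U" unfolding U_def using A e address_in by (simp add: topspace_hull_topology)
    moreover have "\<forall>B\<in>U. address B \<in> torus.mball s (address A) \<epsilon>" unfolding U_def using address_in by simp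
    ultimately show ?thesis by blast
  qed
  then have "continuous_map (hull_topology \<Lambda>) (torus.mtopology s) address"
    unfolding torus.continuous_map_to_metric by blast
  then show ?thesis unfolding torus_mtopology .
qed

text \<open>A lift has the form \<open>x = lin t - y\<close> with \<open>t = combine x\<close> and
  \<open>y\<close> in the kernel. If \<open>y = cobound A + star u\<close>, then
  \<open>translate A (t + u)\<close> is a preimage, since its lift differs from \<open>x\<close> by
  \<open>coord u\<close>.\<close>

lemma address_surj:
  assumes star_dense shows "address ` hull_of \<Lambda> = topspace (torus s)"
proof (intro equalityI subsetI)
  fix w assume "w \<in> topspace (torus s)"
  then obtain x where x: "x \<in> topspace (E s)" "w = torus_class s x" unfolding topspace_torus by blast
  define t where "t = combine x"
  define y where "y = (\<lambda>i. lin t i - x i)"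
  have "y \<in> kern"
    unfolding kern_def using x(1) lin_E[of t] combine_diff[of "lin t" x] combine_lin[of t]
    by (simp add: mem_E y_def t_def)
  then obtain A u where A: "A \<in> \<Xi>" "u \<in> L" "\<And>i. i < s \<Longrightarrow> y i = cobound A i + star u i"
    using kern_decompose[OF assms] by blast
  have E: "(\<lambda>i. - cobound A i) \<in> topspace (E s)" "(\<lambda>i. - cobound A i + lin (t + u) i) \<in> topspace (E s)"
    using cobound_E[of A] lin_E[of "t + u"] by (auto simp: mem_E)
  have "address (translate A (t + u)) = torus_class s (\<lambda>i. - cobound A i + lin (t + u) i)"
    unfolding address_translate[OF transversal_hull[OF A(1)]] address_transversal[OF A(1)]
    by (rule torus_add_class[OF E(1) lin_E])
  also have "\<dots> = w"
    unfolding x(2) torus_class_eq_iff[OF E(2) x(1)]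
  proof (intro allI impI)
    fix i assume "i < s"
    then have "- cobound A i + lin (t + u) i - x i = coord u i"
      using A(3)[of i] unfolding y_def star_def lin_add by simp
    then show "- cobound A i + lin (t + u) i - x i \<in> \<int>" using coord_Ints by simp
  qed
  finally show "w \<in> address ` hull_of \<Lambda>"
    using hull_of_translate[OF transversal_hull[OF A(1)]] by blast
qed (use address_in in blast)

lemma address_action_eq: "address_action \<Lambda> b w t = torus_add w (torus_class s (lin t))"
  unfolding address_action_def lin_def ..

lemma address_factor_map:
  assumes star_dense
  shows "factor_map (hull_topology \<Lambda>) translate (address_space \<Lambda>) (address_action \<Lambda> b) address"
  unfolding factor_map_def address_space_def topspace_hull_topology address_action_eq
  using continuous_map_address address_surj[OF assms] address_translate by blast

end

section \<open>From inter-model sets to the address system\<close>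

lemma group_closure_ident:
  assumes "0 \<in> G" "\<And>x y. x \<in> G \<Longrightarrow> y \<in> G \<Longrightarrow> x - y \<in> G"
  shows "group_closure G = G"
proof (intro equalityI subsetI)
  fix x assume "x \<in> group_closure G"
  then show "x \<in> G" by induction (use assms in auto)
qed (auto intro: group_closure.base)

lemma compactin_E_bounded:
  assumes "compactin (E n) W" shows "\<exists>K. \<forall>v\<in>W. \<bar>v j\<bar> \<le> K"
proof -
  have "compactin euclideanreal ((\<lambda>v. v j) ` W)" using assms continuous_map_E_coordinate by (rule image_compactin)
  then have "bounded ((\<lambda>v. v j) ` W)" by (simp add: compact_imp_bounded)
  then show ?thesis unfolding bounded_iff by auto
qed

context address_system
begin

text \<open>Equality in the torus gives an integer vector \<open>k\<close> between the lifts.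
  Applying \<open>combine\<close> kills the coboundaries and leaves \<open>combine k = - p\<close>,
  so \<open>p\<close> lies in \<open>L\<close> and has coordinates \<open>- k\<close>.\<close>

lemma address_eq_transversal:
  assumes A: "A \<in> \<Xi>" and B: "B \<in> hull_of \<Lambda>" and p: "p \<in> B" and eq: "address B = address A"
  shows "p \<in> L" "cobound (translate B p) i = cobound A i + star p i"
proof -
  define k where "k = (\<lambda>i. cobound A i - cobound (translate B p) i - lin p i)"
  have E: "(\<lambda>i. - cobound A i) \<in> topspace (E s)" using cobound_E[of A] by (simp add: mem_E)
  have "\<forall>i<s. address_point B p i - - cobound A i \<in> \<int>"
    using eq unfolding address_eq[OF B p] address_transversal[OF A] torus_class_eq_iff[OF address_point_E E] .
  then have k: "k i \<in> \<int>" if "i < s" for i using that unfolding k_def address_point_def by (simp add: algebra_simps)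
  have "combine k = combine (cobound A) - combine (cobound (translate B p)) - combine (lin p)"
    unfolding k_def combine_diff ..
  also have "\<dots> = - p"
    using combine_cobound[OF A] combine_cobound[OF hull_translate_transversal[OF B p]] combine_lin by simp
  finally have kp: "combine k = - p" .
  then have mp: "- p \<in> L" using coord_surj(1)[of k, OF k] by simp
  then show pL: "p \<in> L" by simp
  show "cobound (translate B p) i = cobound A i + star p i"
  proof (cases "i < s")
    case True
    have "coord (- p) i = k i" using coord_surj(2)[of k, OF k True] kp by simp
    moreover have "coord (- p) i = - coord p i" by (rule additive_on_minus[OF additive_coord pL])
    ultimately show ?thesis unfolding k_def star_def by simp
  next
    case False
    then show ?thesis using cobound_E[of A] cobound_E[of "translate B p"] star_E[of p] by (simp add: mem_E)
  qed
qed

lemma countable_L: "countable L"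
proof -
  have "u \<in> (\<Union>m. {u \<in> L. norm u \<le> real m \<and> (\<forall>i<s. \<bar>star u i\<bar> \<le> real m)})" if u: "u \<in> L" for u
  proof -
    obtain m :: nat where m: "norm u + (\<Sum>i<s. \<bar>star u i\<bar>) \<le> real m" using real_arch_simple by blast
    have sum: "(\<Sum>i<s. \<bar>star u i\<bar>) \<ge> 0" by (simp add: sum_nonneg)
    have "\<bar>star u i\<bar> \<le> real m" if "i < s" for i
    proof -
      have "\<bar>star u i\<bar> \<le> (\<Sum>i<s. \<bar>star u i\<bar>)" by (rule member_le_sum) (use that in auto)
      then show ?thesis using m norm_ge_zero[of u] by linarith
    qed
    moreover have "norm u \<le> real m" using m sum by linarith
    ultimately show ?thesis using u by blast
  qed
  then have "L \<subseteq> (\<Union>m. {u \<in> L. norm u \<le> real m \<and> (\<forall>i<s. \<bar>star u i\<bar> \<le> real m)})" by blast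
  moreover have "countable (\<Union>m. {u \<in> L. norm u \<le> real m \<and> (\<forall>i<s. \<bar>star u i\<bar> \<le> real m)})"
    by (rule countable_UN[OF countableI_type countable_finite[OF finite_bounded_star]])
  ultimately show ?thesis by (rule countable_subset)
qed

end

text \<open>The scheme after its group has been identified with \<open>L\<close> and its two shifts
  have been merged into \<open>c\<close>. \<open>small_D\<close> reflects that the window has
  interior: an element with small image is the difference of two points over the interior.\<close>

locale inter_model = address_system \<Lambda> b for \<Lambda> :: "'a::euclidean_space set" and b +
  fixes n :: nat and \<sigma> :: "'a \<Rightarrow> nat \<Rightarrow> real" and W :: "(nat \<Rightarrow> real) set" and c :: "nat \<Rightarrow> real"
  assumes n_pos: "0 < n"
    and sigma_E: "\<And>x. x \<in> L \<Longrightarrow> \<sigma> x \<in> topspace (E n)"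
    and additive_sigma: "\<And>j. additive_on L (\<lambda>x. \<sigma> x j)"
    and sigma_dense: "\<And>y \<epsilon>. y \<in> topspace (E n) \<Longrightarrow> \<epsilon> > 0 \<Longrightarrow> \<exists>\<gamma>\<in>L. \<sigma> \<gamma> \<in> box n y \<epsilon>"
    and window_W: "window n W"
    and c_E: "c \<in> topspace (E n)"
    and window_upper: "\<And>x. x \<in> \<Lambda> \<Longrightarrow> (\<lambda>j. \<sigma> x j - c j) \<in> W"
    and window_lower: "\<And>x. x \<in> L \<Longrightarrow> (\<lambda>j. \<sigma> x j - c j) \<in> E n interior_of W \<Longrightarrow> x \<in> \<Lambda>"
    and small_D: "\<exists>\<epsilon>>0. \<forall>\<gamma>\<in>L. (\<forall>j<n. \<bar>\<sigma> \<gamma> j\<bar> < \<epsilon>) \<longrightarrow> \<gamma> \<in> D"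
begin

lemmas sigma_add = additive_on_add[OF additive_sigma]
lemmas sigma_diff = additive_on_diff[OF additive_sigma]

lemma W_closed: "closedin (E n) W"
  using window_W unfolding window_def by (metis closedin_closure_of)

lemma interior_W_nonempty: "E n interior_of W \<noteq> {}"
proof
  assume "E n interior_of W = {}"
  then have "W = {}" using window_W unfolding window_def by (metis closure_of_empty)
  then show False using window_upper[OF zero_mem] by simp
qed

text \<open>The linear map from the coordinate space to the internal space of the scheme that
  extends \<sigma> along \<open>coord\<close>.\<close>

definition project :: "(nat \<Rightarrow> real) \<Rightarrow> nat \<Rightarrow> real"
  where "project v j = (\<Sum>i<s. \<sigma> (b i) j * v i)"

lemma project_add: "project (\<lambda>i. v i + w i) j = project v j + project w j"
  unfolding project_def by (simp add: distrib_left sum.distrib)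

lemma project_diff: "project (\<lambda>i. v i - w i) j = project v j - project w j"
  unfolding project_def by (simp add: right_diff_distrib sum_subtractf)

lemma project_cong: "(\<And>i. i < s \<Longrightarrow> v i = w i) \<Longrightarrow> project v j = project w j"
  unfolding project_def by (intro sum.cong) auto

lemma project_coord: "\<gamma> \<in> L \<Longrightarrow> project (coord \<gamma>) j = \<sigma> \<gamma> j"
  unfolding project_def using additive_combine[OF additive_sigma, of \<gamma> j] by (simp add: mult.commute)

text \<open>On \<open>D\<close> both \<sigma>, by compactness of the window, and the stars are
  bounded. So the linear map on the left is bounded there and vanishes; consequently \<sigma> is the
  image of the star.\<close>

lemma project_lin: "project (lin t) j = 0"
proof -
  have linear: "linear (\<lambda>t. project (lin t) j)"
    unfolding project_def
    by (rule linearI) (simp_all add: lin_add lin_scale distrib_left sum.distrib sum_distrib_left mult.left_commute)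
  obtain K where K: "\<And>v. v \<in> W \<Longrightarrow> \<bar>v j\<bar> \<le> K"
    using compactin_E_bounded window_W unfolding window_def by metis
  obtain C where C: "\<And>u i. u \<in> D \<Longrightarrow> \<bar>star u i\<bar> \<le> C" using star_bounded by blast
  have bound: "norm (project (lin u) j) \<le> 2 * K + (\<Sum>i<s. \<bar>\<sigma> (b i) j\<bar> * C)" if u: "u \<in> D" for u
  proof -
    obtain x y where xy: "x \<in> \<Lambda>" "y \<in> \<Lambda>" "u = x - y" using u by (rule difference_setE)
    have "\<bar>\<sigma> u j\<bar> \<le> 2 * K"
      using K[OF window_upper[OF xy(1)]] K[OF window_upper[OF xy(2)]]
        sigma_diff[OF mem_L[OF xy(1)] mem_L[OF xy(2)], of j] xy(3) by simp
    moreover have "\<bar>project (star u) j\<bar> \<le> (\<Sum>i<s. \<bar>\<sigma> (b i) j\<bar> * C)"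
      unfolding project_def
      by (rule order_trans[OF sum_abs]) (auto intro!: sum_mono mult_left_mono C[OF u] simp: abs_mult)
    moreover have "project (star u) j = \<sigma> u j - project (lin u) j"
      using project_coord[OF difference_set_group[OF u]] project_diff[of "coord u" "lin u"]
        project_cong[of "star u" "\<lambda>i. coord u i - lin u i"] by (simp add: star_def)
    ultimately show ?thesis by simp
  qed
  show ?thesis by (rule linear_bounded_on_difference_set[OF meyer linear bound])
qed

lemma project_star: "\<gamma> \<in> L \<Longrightarrow> project (star \<gamma>) j = \<sigma> \<gamma> j"
  using project_diff[of "coord \<gamma>" "lin \<gamma>" j] project_cong[of "star \<gamma>" "\<lambda>i. coord \<gamma> i - lin \<gamma> i" j]
    project_coord project_lin by (simp add: star_def)

text \<open>The vectors \<open>b i\<close> span the ambient space. If there were no more of them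
  than its dimension, they would be linearly independent over the reals, so
  \<open>combine_star\<close> would make all stars and then \<sigma> vanish, against density in a
  space of positive dimension.\<close>

lemma rank_gt_dim: "DIM('a) < s"
proof (rule ccontr)
  assume "\<not> DIM('a) < s"
  have span: "t \<in> span (b ` {..<s})" for t
  proof -
    have "combine (lin t) \<in> span (b ` {..<s})"
      unfolding combine_def by (intro span_sum span_scale span_base) auto
    then show ?thesis unfolding combine_lin .
  qed
  have indep: "independent (b ` {..<s})"
    by (rule card_le_dim_spanning[where V = UNIV])
      (use span \<open>\<not> DIM('a) < s\<close> inj_b in \<open>auto simp: card_image\<close>)
  have "star \<gamma> i = 0" if "\<gamma> \<in> L" "i < s" for \<gamma> i
  proof -
    define v where "v x = star \<gamma> (the_inv_into {..<s} b x)" for x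
    have "(\<Sum>x\<in>b ` {..<s}. v x *\<^sub>R x) = combine (star \<gamma>)"
      unfolding sum.reindex[OF inj_b] combine_def v_def by (intro sum.cong) (auto simp: the_inv_into_f_f[OF inj_b])
    then have "(\<Sum>x\<in>b ` {..<s}. v x *\<^sub>R x) = 0" using combine_star[OF that(1)] by simp
    then have "\<forall>x\<in>b ` {..<s}. v x = 0" using indep unfolding independent_explicit by blast
    then show ?thesis unfolding v_def using that(2) by (auto simp: the_inv_into_f_f[OF inj_b])
  qed
  then have zero: "\<sigma> \<gamma> j = 0" if "\<gamma> \<in> L" for \<gamma> j
    using project_star[OF that, of j] that unfolding project_def by simp
  have "(\<lambda>j. if j = 0 then 1 else 0) \<in> topspace (E n)" using n_pos by (simp add: mem_E)
  then obtain \<gamma> where "\<gamma> \<in> L" "\<sigma> \<gamma> \<in> box n (\<lambda>j. if j = 0 then 1 else 0) 1"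
    using sigma_dense[of _ 1] by force
  then show False using zero n_pos unfolding box_def by force
qed

text \<open>If \<open>\<sigma> \<gamma>\<close> is smaller than \<open>\<epsilon> / N\<close> then \<open>N \<gamma>\<close> lies in \<open>\<Lambda> - \<Lambda>\<close>, so the star of \<open>\<gamma>\<close> is of order \<open>1 / N\<close>.
  This lets one divide by \<open>N\<close> approximately, and replaces the discreteness of the lattice.\<close>

lemma star_dense: star_dense
  unfolding star_dense_def
proof (intro ballI allI impI)
  fix y and \<epsilon> :: real assume y: "y \<in> kern" and e: "\<epsilon> > 0"
  obtain \<epsilon>0 where e0: "\<epsilon>0 > 0" "\<And>\<gamma>. \<gamma> \<in> L \<Longrightarrow> (\<And>j. j < n \<Longrightarrow> \<bar>\<sigma> \<gamma> j\<bar> < \<epsilon>0) \<Longrightarrow> \<gamma> \<in> D"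
    using small_D by blast
  obtain C where C: "C > 0" "\<And>u i. u \<in> D \<Longrightarrow> \<bar>star u i\<bar> \<le> C" using star_bounded by blast
  define K where "K = (\<Sum>i<s. \<Sum>j<s. \<bar>star (b j) i\<bar>)"
  have K: "K \<ge> 0" unfolding K_def by (simp add: sum_nonneg)
  \<comment> \<open>The final error is \<open>K / N\<close> from rounding \<open>N * y\<close> and
    \<open>C / N\<close> from an element of \<open>D\<close>.\<close>
  obtain N :: nat where N: "(K + C) / \<epsilon> < real N" using reals_Archimedean2 by blast
  have N0: "real N > 0" using N K C(1) e by (meson add_nonneg_pos divide_pos_pos less_trans)
  have Ne: "(K + C) / N < \<epsilon>" using N N0 e by (simp add: field_simps)
  define k where "k i = (of_int \<lfloor>N * y i\<rfloor> :: real)" for i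
  have k: "\<bar>y i - k i / N\<bar> \<le> 1 / N" for i
  proof -
    have "\<bar>N * y i - k i\<bar> \<le> 1" unfolding k_def by linarith
    moreover have "y i - k i / N = (N * y i - k i) / N" using N0 by (simp add: diff_divide_distrib)
    ultimately show ?thesis using N0 by (simp add: abs_divide divide_right_mono)
  qed
  define \<gamma>0 where "\<gamma>0 = combine k"
  have \<gamma>0: "\<gamma>0 \<in> L" "\<And>i. star \<gamma>0 i = (\<Sum>j<s. k j * star (b j) i)"
    unfolding \<gamma>0_def using combine_Ints[of k, OF _ additive_star] unfolding k_def by auto
  \<comment> \<open>The star extends linearly to the coordinate space as the identity minus
    \<open>lin\<close> after \<open>combine\<close>, and this map fixes the kernel.\<close>
  have y_sum: "y i = (\<Sum>j<s. y j * star (b j) i)" if i: "i < s" for i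
  proof -
    have "lin (combine y) i = (\<Sum>j<s. y j * lin (b j) i)"
      unfolding combine_def using linear_sum[OF linear_lin[of i], of "\<lambda>j. y j *\<^sub>R b j" "{..<s}"] by (simp add: lin_scale)
    moreover have "combine y = 0" using y unfolding kern_def by simp
    ultimately have "(\<Sum>j<s. y j * lin (b j) i) = 0" by (simp add: lin_0)
    moreover have "(\<Sum>j<s. y j * coord (b j) i) = (\<Sum>j<s. if j = i then y j else 0)"
      using i by (intro sum.cong) (auto simp: coord_b)
    ultimately show ?thesis unfolding star_def using i by (simp add: right_diff_distrib sum_subtractf)
  qed
  have near0: "\<bar>y i - star \<gamma>0 i / N\<bar> \<le> K / N" if i: "i < s" for i
  proof -
    have "y i - star \<gamma>0 i / N = (\<Sum>j<s. (y j - k j / N) * star (b j) i)"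
      unfolding \<gamma>0(2) by (subst y_sum[OF i]) (simp add: sum_divide_distrib left_diff_distrib sum_subtractf)
    also have "\<bar>\<dots>\<bar> \<le> (\<Sum>j<s. 1 / N * \<bar>star (b j) i\<bar>)"
      by (rule order_trans[OF sum_abs]) (auto intro!: sum_mono mult_right_mono k simp: abs_mult simp del: times_divide_eq_left)
    also have "\<dots> = (\<Sum>j<s. \<bar>star (b j) i\<bar>) / N" by (simp add: sum_divide_distrib)
    also have "\<dots> \<le> K / N"
    proof (rule divide_right_mono)
      show "(\<Sum>j<s. \<bar>star (b j) i\<bar>) \<le> K"
        unfolding K_def using i
        by (intro member_le_sum[where i = i and f = "\<lambda>i. \<Sum>j<s. \<bar>star (b j) i\<bar>"]) (auto simp: sum_nonneg)
    qed simp
    finally show ?thesis .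
  qed
  have "(\<lambda>j. \<sigma> \<gamma>0 j / N) \<in> topspace (E n)" using sigma_E[OF \<gamma>0(1)] by (simp add: mem_E)
  moreover have "\<epsilon>0 / N > 0" using e0(1) N0 by simp
  ultimately obtain \<gamma> where \<gamma>: "\<gamma> \<in> L" "\<sigma> \<gamma> \<in> box n (\<lambda>j. \<sigma> \<gamma>0 j / N) (\<epsilon>0 / N)"
    using sigma_dense by blast
  have NL: "of_nat N *\<^sub>R \<gamma> \<in> L" using additive_on_of_nat[OF additive_star \<gamma>(1)] by blast
  have "\<gamma>0 - of_nat N *\<^sub>R \<gamma> \<in> D"
  proof (rule e0(2))
    show "\<gamma>0 - of_nat N *\<^sub>R \<gamma> \<in> L" using \<gamma>0(1) NL by (rule group_closure.diff)
    fix j assume "j < n"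
    then have "\<bar>\<sigma> \<gamma> j - \<sigma> \<gamma>0 j / N\<bar> < \<epsilon>0 / N" using \<gamma>(2) unfolding box_def by blast
    then have "N * \<bar>\<sigma> \<gamma> j - \<sigma> \<gamma>0 j / N\<bar> < \<epsilon>0" using N0 by (simp add: field_simps)
    moreover have "N * \<bar>\<sigma> \<gamma> j - \<sigma> \<gamma>0 j / N\<bar> = \<bar>N * \<sigma> \<gamma> j - \<sigma> \<gamma>0 j\<bar>"
      using N0 by (simp add: abs_mult_pos' right_diff_distrib)
    moreover have "\<sigma> (\<gamma>0 - of_nat N *\<^sub>R \<gamma>) j = \<sigma> \<gamma>0 j - N * \<sigma> \<gamma> j"
      using sigma_diff[OF \<gamma>0(1) NL] additive_on_of_nat[OF additive_sigma[of j] \<gamma>(1), of N] by simp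
    ultimately show "\<bar>\<sigma> (\<gamma>0 - of_nat N *\<^sub>R \<gamma>) j\<bar> < \<epsilon>0" by (simp add: abs_minus_commute)
  qed
  then have "\<bar>star \<gamma>0 i - N * star \<gamma> i\<bar> \<le> C" for i
    using C(2)[of "\<gamma>0 - of_nat N *\<^sub>R \<gamma>" i] star_diff[OF \<gamma>0(1) NL, of i]
      additive_on_of_nat[OF additive_star[of i] \<gamma>(1), of N] by simp
  then have near1: "\<bar>star \<gamma>0 i / N - star \<gamma> i\<bar> \<le> C / N" for i
  proof -
    have "star \<gamma>0 i / N - star \<gamma> i = (star \<gamma>0 i - N * star \<gamma> i) / N" using N0 by (simp add: diff_divide_distrib)
    then show ?thesis using \<open>\<And>i. \<bar>star \<gamma>0 i - N * star \<gamma> i\<bar> \<le> C\<close>[of i] N0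
      by (simp add: abs_divide divide_right_mono)
  qed
  have "\<bar>star \<gamma> i - y i\<bar> < \<epsilon>" if "i < s" for i
    using near0[OF that] near1[of i] Ne unfolding add_divide_distrib by linarith
  then show "\<exists>\<gamma>\<in>L. \<forall>i<s. \<bar>star \<gamma> i - y i\<bar> < \<epsilon>" using \<gamma>(1) by blast
qed

text \<open>The place of \<open>x\<close> relative to the window of \<open>A\<close>. If
  \<open>A\<close> is \<Lambda> moved by one of its points \<open>z\<close>, it is
  \<open>\<sigma> (x + z) - c\<close>, and the general case is a limit of these.\<close>

definition position :: "'a set \<Rightarrow> 'a \<Rightarrow> nat \<Rightarrow> real"
  where "position A x j = (if j < n then \<sigma> x j + project (cobound A) j - c j else 0)"

lemma position_E: "position A x \<in> topspace (E n)"
  by (simp add: mem_E position_def)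

lemma patch_continuous_project: "patch_continuous (\<lambda>A. project (cobound A) j)"
  unfolding project_def by (intro patch_continuous_sum patch_continuous_cmult patch_continuous_cobound)

lemma project_cobound_point: "x \<in> \<Lambda> \<Longrightarrow> project (cobound (translate \<Lambda> x)) j = \<sigma> x j"
  using project_cong[of "cobound (translate \<Lambda> x)" "star x" j] cobound_point project_star[OF mem_L] by simp

text \<open>Approximate \<open>A\<close> by \<open>translate \<Lambda> z\<close> on a patch that
  contains \<open>x\<close>. This transfers the two window inclusions from \<Lambda> to the whole
  transversal.\<close>

lemma nearby_point:
  assumes A: "A \<in> \<Xi>" and x: "x \<in> L" and e: "\<epsilon> > 0"
  shows "\<exists>z\<in>\<Lambda>. (x + z \<in> \<Lambda> \<longleftrightarrow> x \<in> A) \<and> (\<lambda>j. \<sigma> (x + z) j - c j) \<in> box n (position A x) \<epsilon>"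
proof -
  obtain \<rho> where \<rho>: "\<And>B j. B \<in> \<Xi> \<Longrightarrow> agree \<rho> A B \<Longrightarrow> j < n \<Longrightarrow> \<bar>project (cobound A) j - project (cobound B) j\<bar> < \<epsilon>"
    using patch_continuous_modulus[of n "\<lambda>j A. project (cobound A) j", OF patch_continuous_project e] A by blast
  obtain z where z: "z \<in> \<Lambda>" "agree (max \<rho> (norm x)) A (translate \<Lambda> z)" using transversal_patch[OF A] by blast
  have near: "\<bar>project (cobound A) j - \<sigma> z j\<bar> < \<epsilon>" if "j < n" for j
    using \<rho>[OF transversal_translate[OF base_transversal z(1)] agree_mono[OF z(2)] that] project_cobound_point[OF z(1)] by simp
  have xz: "x + z \<in> L" using x mem_L[OF z(1)] by (rule group_closure_add)
  have "(\<lambda>j. \<sigma> (x + z) j - c j) \<in> topspace (E n)" using sigma_E[OF xz] c_E by (simp add: mem_E)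
  moreover have "\<bar>\<sigma> (x + z) j - c j - position A x j\<bar> < \<epsilon>" if "j < n" for j
    using near[OF that] sigma_add[OF x mem_L[OF z(1)], of j] that unfolding position_def by simp
  ultimately have "(\<lambda>j. \<sigma> (x + z) j - c j) \<in> box n (position A x) \<epsilon>" unfolding box_def by simp
  moreover have "x + z \<in> \<Lambda> \<longleftrightarrow> x \<in> A" using agreeD[OF z(2), of x] by (simp add: mem_translate)
  ultimately show ?thesis using z(1) by blast
qed

lemma position_upper:
  assumes A: "A \<in> \<Xi>" and x: "x \<in> A" shows "position A x \<in> W"
proof -
  have xL: "x \<in> L" using transversal_subset_L[OF A] x by blast
  have "position A x \<in> E n closure_of W"
    unfolding closure_of_E_box
  proof (intro conjI allI impI position_E)
    fix \<epsilon> :: real assume "\<epsilon> > 0"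
    then obtain z where "x + z \<in> \<Lambda>" "(\<lambda>j. \<sigma> (x + z) j - c j) \<in> box n (position A x) \<epsilon>"
      using nearby_point[OF A xL] x by blast
    then show "\<exists>y\<in>W. y \<in> box n (position A x) \<epsilon>" using window_upper by blast
  qed
  then show ?thesis using W_closed by (simp add: closure_of_closedin)
qed

lemma position_lower:
  assumes A: "A \<in> \<Xi>" and x: "x \<in> L" and int: "position A x \<in> E n interior_of W" shows "x \<in> A"
proof -
  have "openin (E n) (E n interior_of W)" by (rule openin_interior_of)
  then obtain \<epsilon> where e: "\<epsilon> > 0" "box n (position A x) \<epsilon> \<subseteq> E n interior_of W"
    using int unfolding openin_E_box by meson
  obtain z where z: "z \<in> \<Lambda>" "x + z \<in> \<Lambda> \<longleftrightarrow> x \<in> A" "(\<lambda>j. \<sigma> (x + z) j - c j) \<in> box n (position A x) \<epsilon>"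
    using nearby_point[OF A x e(1)] by blast
  have "x + z \<in> \<Lambda>"
    by (rule window_lower[OF group_closure_add[OF x mem_L[OF z(1)]] subsetD[OF e(2) z(3)]])
  then show ?thesis using z(2) by blast
qed

definition nonsingular :: "'a set \<Rightarrow> bool"
  where "nonsingular A \<longleftrightarrow> (\<forall>x\<in>L. position A x \<in> W \<longrightarrow> position A x \<in> E n interior_of W)"

text \<open>A nonsingular set is recovered from its positions. Equal addresses make the positions in
  \<open>translate B p\<close> those of \<open>A\<close> shifted by \<open>p\<close>; so
  \<open>translate B p\<close> is nonsingular as well and equals
  \<open>translate A p\<close>.\<close>

lemma nonsingular_unique:
  assumes A: "A \<in> \<Xi>" and ns: "nonsingular A" and B: "B \<in> hull_of \<Lambda>" and eq: "address B = address A"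
  shows "B = A"
proof -
  have mem: "x \<in> A' \<longleftrightarrow> x \<in> L \<and> position A' x \<in> W" if "A' \<in> \<Xi>" "nonsingular A'" for A' x
    using position_upper[OF that(1)] position_lower[OF that(1)] that(2) transversal_subset_L[OF that(1)]
    unfolding nonsingular_def by blast
  obtain p where p: "p \<in> B" using hull_nonempty[OF B] by blast
  define A2 where "A2 = translate B p"
  have A2: "A2 \<in> \<Xi>" unfolding A2_def by (rule hull_translate_transversal[OF B p])
  have pL: "p \<in> L" and cob: "\<And>i. cobound A2 i = cobound A i + star p i"
    unfolding A2_def using address_eq_transversal[OF A B p eq] by auto
  have proj: "project (cobound A2) j = project (cobound A) j + \<sigma> p j" for j
    using project_add[of "cobound A" "star p" j] project_cong[of "cobound A2" "\<lambda>i. cobound A i + star p i" j]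
      cob project_star[OF pL] by simp
  have pos: "position A2 x = position A (x + p)" if "x \<in> L" for x
    unfolding position_def proj using sigma_add[OF that pL] by (intro ext) simp
  have xp: "x + p \<in> L \<longleftrightarrow> x \<in> L" for x
    using group_closure_add[OF _ pL, of x] group_closure.diff[OF _ pL, of "x + p"] by auto
  have "nonsingular A2"
    unfolding nonsingular_def
  proof (intro ballI impI)
    fix x assume x: "x \<in> L" "position A2 x \<in> W"
    then have "x + p \<in> L" "position A (x + p) \<in> W" using pos xp by auto
    then show "position A2 x \<in> E n interior_of W" using ns pos[OF x(1)] unfolding nonsingular_def by simp
  qed
  then have iff: "x \<in> A2 \<longleftrightarrow> x + p \<in> A" for x
    unfolding mem[OF A2 \<open>nonsingular A2\<close>] mem[OF A ns] xp using pos by auto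
  have "A2 = translate A p" unfolding set_eq_iff mem_translate using iff by blast
  then have "translate (translate B p) (- p) = translate (translate A p) (- p)" unfolding A2_def by (rule arg_cong)
  then show ?thesis by (simp only: translate_cancel)
qed

lemma nonsingular_exists: "\<exists>A\<in>\<Xi>. nonsingular A"
proof -
  let ?int = "E n interior_of W"
  define shift where "shift x y j = (if j < n then \<sigma> x j + y j - c j else 0)" for x y j
  have shift_cont: "continuous_map (E n) (E n) (shift x)" for x
    unfolding shift_def[abs_def] continuous_map_componentwise_Euclidean_space
    by (intro allI impI continuous_intros continuous_map_E_coordinate)
  have shift_E: "shift x y \<in> topspace (E n)" for x y unfolding shift_def by (simp add: mem_E)
  \<comment> \<open>The shifts for which \<open>x\<close> falls on the boundary of the window. The
    boundary of a closed set has empty interior, so Baire's theorem leaves a shift that avoids all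
    these sets.\<close>
  define T where "T x = {y \<in> topspace (E n). shift x y \<in> W - ?int}" for x
  have T_closed: "closedin (E n) (T x)" for x
  proof -
    have "closedin (E n) (W - ?int)" by (intro closedin_diff W_closed openin_interior_of)
    then show ?thesis unfolding T_def by (rule closedin_continuous_map_preimage[OF shift_cont])
  qed
  have T_int: "E n interior_of T x = {}" if x: "x \<in> L" for x
  proof (rule ccontr)
    assume "E n interior_of T x \<noteq> {}"
    then obtain y where "y \<in> E n interior_of T x" by blast
    then obtain \<epsilon> where y: "y \<in> topspace (E n)" "\<epsilon> > 0" "box n y \<epsilon> \<subseteq> T x" unfolding interior_of_E_box by blast
    have "box n (shift x y) \<epsilon> \<subseteq> W"
    proof
      fix v assume v: "v \<in> box n (shift x y) \<epsilon>"
      define y' where "y' j = (if j < n then v j - \<sigma> x j + c j else 0)" for j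
      have vE: "v \<in> topspace (E n)" using v unfolding box_def by blast
      have sv: "shift x y' = v" by (rule E_eqI[OF shift_E vE]) (simp add: shift_def y'_def)
      have "y' \<in> box n y \<epsilon>"
        using v unfolding box_def y'_def shift_def by (auto simp: mem_E algebra_simps)
      then have "y' \<in> T x" using y(3) by blast
      then have "shift x y' \<in> W" unfolding T_def by simp
      then show "v \<in> W" unfolding sv .
    qed
    then have "shift x y \<in> ?int" unfolding interior_of_E_box using shift_E y(2) by blast
    moreover have "y \<in> T x" using box_centre[OF y(1,2)] y(3) by blast
    ultimately show False unfolding T_def by simp
  qed
  have baire: "E n interior_of \<Union>(T ` L) = {}"
    by (rule Baire_category_alt) (use completely_metrizable_Euclidean_space countable_L T_closed T_int in auto)
  obtain v where v: "v \<in> ?int" using interior_W_nonempty by blast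
  then have vE: "v \<in> topspace (E n)" unfolding interior_of_E_box by blast
  \<comment> \<open>The shift is also chosen such that 0 falls into the interior. Then elements of
    \<open>L\<close> with \<sigma> near the shift lie in \<Lambda>, so the shift is a limit of
    projected coboundaries and, by compactness, is one of them.\<close>
  define O' where "O' = {y \<in> topspace (E n). shift 0 y \<in> ?int}"
  have O_open: "openin (E n) O'"
    unfolding O'_def by (rule openin_continuous_map_preimage[OF shift_cont openin_interior_of])
  have s0: "\<sigma> 0 j = 0" for j using additive_on_zero[OF additive_sigma] .
  have "(\<lambda>j. v j + c j) \<in> O'"
  proof -
    have "(\<lambda>j. v j + c j) \<in> topspace (E n)" using vE c_E by (simp add: mem_E)
    moreover have "shift 0 (\<lambda>j. v j + c j) = v" by (rule E_eqI[OF shift_E vE]) (simp add: shift_def s0)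
    ultimately show ?thesis unfolding O'_def using v by simp
  qed
  then have "\<not> O' \<subseteq> \<Union>(T ` L)" using interior_of_maximal[OF _ O_open, of "\<Union>(T ` L)"] baire by blast
  then obtain y where y: "y \<in> O'" "\<And>x. x \<in> L \<Longrightarrow> y \<notin> T x" by blast
  have yE: "y \<in> topspace (E n)" using y(1) unfolding O'_def by blast
  obtain \<delta> where \<delta>: "\<delta> > 0" "box n y \<delta> \<subseteq> O'" using O_open y(1) unfolding openin_E_box by meson
  have "\<exists>A\<in>\<Xi>. \<forall>j<n. \<bar>project (cobound A) j - y j\<bar> < \<epsilon>" if e: "\<epsilon> > 0" for \<epsilon>
  proof -
    obtain x where x: "x \<in> L" "\<sigma> x \<in> box n y (min \<delta> \<epsilon>)" using sigma_dense[OF yE, of "min \<delta> \<epsilon>"] \<delta>(1) e by auto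
    then have "\<sigma> x \<in> O'" using \<delta>(2) unfolding box_def by auto
    then have "shift 0 (\<sigma> x) \<in> ?int" unfolding O'_def by blast
    moreover have "shift 0 (\<sigma> x) = (\<lambda>j. \<sigma> x j - c j)"
      by (rule E_eqI[OF shift_E]) (use sigma_E[OF x(1)] c_E in \<open>auto simp: mem_E shift_def s0\<close>)
    ultimately have "x \<in> \<Lambda>" using window_lower[OF x(1)] by simp
    then show ?thesis
      using x(2) transversal_translate[OF base_transversal] unfolding box_def
      by (intro bexI[of _ "translate \<Lambda> x"]) (auto simp: project_cobound_point)
  qed
  then obtain A where A: "A \<in> \<Xi>" "\<And>j. j < n \<Longrightarrow> project (cobound A) j = y j"
    using patch_continuous_attains[of n "\<lambda>j A. project (cobound A) j" \<Xi> y, OF patch_continuous_project] by blast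
  have "position A x = shift x y" for x
    by (rule E_eqI[OF position_E shift_E]) (simp add: position_def shift_def A(2))
  then have "nonsingular A" unfolding nonsingular_def using y(2) yE unfolding T_def by auto
  then show ?thesis using A(1) by blast
qed

end

text \<open>The main point is that the group \<Gamma> of the scheme is \<open>L\<close>. For
  \<gamma> in \<Gamma>, density gives \<open>g\<close> with \<open>\<sigma> g\<close> close to
  \<open>\<sigma> \<gamma>\<close> divided by a large \<open>m\<close>; both \<open>g\<close> and
  \<gamma> minus \<open>m\<close> times \<open>g\<close> have small image, hence are differences of
  points of \<Lambda>.\<close>

lemma (in address_system) inter_model_locale:
  assumes "euclidean_inter_model_set \<Lambda>"
  shows "\<exists>n \<sigma> W c. inter_model \<Lambda> b n \<sigma> W c"
proof -
  obtain n \<Gamma> \<sigma> W t w where cps: "euclidean_cps n \<Gamma> \<sigma>" and win: "window n W" and wE: "w \<in> topspace (E n)"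
    and lower: "translate (cut_project \<Gamma> \<sigma> w (E n interior_of W)) t \<subseteq> \<Lambda>"
    and upper: "\<Lambda> \<subseteq> translate (cut_project \<Gamma> \<sigma> w W) t"
    using assms unfolding euclidean_inter_model_set_def by blast
  have n: "0 < n" and \<Gamma>: "0 \<in> \<Gamma>" "\<And>x y. x \<in> \<Gamma> \<Longrightarrow> y \<in> \<Gamma> \<Longrightarrow> x - y \<in> \<Gamma>"
    and \<sigma>E: "\<And>x. x \<in> \<Gamma> \<Longrightarrow> \<sigma> x \<in> topspace (E n)"
    and \<sigma>_add: "\<And>x y i. x \<in> \<Gamma> \<Longrightarrow> y \<in> \<Gamma> \<Longrightarrow> \<sigma> (x + y) i = \<sigma> x i + \<sigma> y i"
    and dense: "E n closure_of (\<sigma> ` \<Gamma>) = topspace (E n)"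
    using cps unfolding euclidean_cps_def by blast+
  have gc: "group_closure \<Gamma> = \<Gamma>" using \<Gamma> by (rule group_closure_ident)
  have \<Gamma>_add: "x + y \<in> \<Gamma>" if "x \<in> \<Gamma>" "y \<in> \<Gamma>" for x y using group_closure_add[of x \<Gamma> y] that unfolding gc by blast
  have add: "additive_on (group_closure \<Gamma>) (\<lambda>x. \<sigma> x j)" for j unfolding additive_on_def gc using \<sigma>_add by blast
  have cut: "x \<in> translate (cut_project \<Gamma> \<sigma> w V) t \<longleftrightarrow> x + t \<in> \<Gamma> \<and> (\<lambda>j. \<sigma> (x + t) j - w j) \<in> V" for x V
  proof -
    have "\<sigma> (x + t) \<in> {(\<lambda>i. w i + v i) | v. v \<in> V} \<longleftrightarrow> (\<lambda>j. \<sigma> (x + t) j - w j) \<in> V"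
    proof
      assume "\<sigma> (x + t) \<in> {(\<lambda>i. w i + v i) | v. v \<in> V}"
      then obtain v where v: "\<sigma> (x + t) = (\<lambda>i. w i + v i)" "v \<in> V" unfolding mem_Collect_eq by (elim exE conjE)
      have "(\<lambda>j. \<sigma> (x + t) j - w j) = v" unfolding v(1) by simp
      then show "(\<lambda>j. \<sigma> (x + t) j - w j) \<in> V" using v(2) by simp
    next
      assume "(\<lambda>j. \<sigma> (x + t) j - w j) \<in> V"
      then show "\<sigma> (x + t) \<in> {(\<lambda>i. w i + v i) | v. v \<in> V}"
        unfolding mem_Collect_eq by (intro exI[of _ "\<lambda>j. \<sigma> (x + t) j - w j"]) simp
    qed
    then show ?thesis unfolding mem_translate cut_project_def by simp
  qed
  have tG: "t \<in> \<Gamma>" using upper zero_mem cut[of 0 W] by auto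
  define c where "c = (\<lambda>j. w j - \<sigma> t j)"
  have cE: "c \<in> topspace (E n)" unfolding c_def using wE \<sigma>E[OF tG] by (simp add: mem_E)
  have shift: "(\<lambda>j. \<sigma> (x + t) j - w j) = (\<lambda>j. \<sigma> x j - c j)" if "x \<in> \<Gamma>" for x
    unfolding c_def using \<sigma>_add[OF that tG] by (intro ext) simp
  have \<Lambda>G: "x \<in> \<Gamma>" if "x \<in> \<Lambda>" for x
  proof -
    have "x + t \<in> \<Gamma>" using upper that cut[of x W] by blast
    then show ?thesis using \<Gamma>(2)[OF _ tG, of "x + t"] by simp
  qed
  have up: "(\<lambda>j. \<sigma> x j - c j) \<in> W" if "x \<in> \<Lambda>" for x
    using upper that cut[of x W] shift[OF \<Lambda>G[OF that]] by auto
  have low: "x \<in> \<Lambda>" if "x \<in> \<Gamma>" "(\<lambda>j. \<sigma> x j - c j) \<in> E n interior_of W" for x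
  proof -
    have "x \<in> translate (cut_project \<Gamma> \<sigma> w (E n interior_of W)) t"
      unfolding cut using shift[OF that(1)] that \<Gamma>_add[OF that(1) tG] by simp
    then show ?thesis using lower by blast
  qed
  have dense': "\<exists>\<gamma>\<in>\<Gamma>. \<sigma> \<gamma> \<in> box n y \<epsilon>" if "y \<in> topspace (E n)" "\<epsilon> > 0" for y \<epsilon>
  proof -
    have "y \<in> E n closure_of (\<sigma> ` \<Gamma>)" using that dense by simp
    then show ?thesis using that(2) unfolding closure_of_E_box by blast
  qed
  have "E n interior_of W \<noteq> {}"
  proof
    assume "E n interior_of W = {}"
    then have "W = {}" using win unfolding window_def by (metis closure_of_empty)
    then show False using up[OF zero_mem] by simp
  qed
  then obtain v where v: "v \<in> E n interior_of W" by blast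
  then have vE: "v \<in> topspace (E n)" unfolding interior_of_E_box by blast
  obtain \<epsilon> where e: "\<epsilon> > 0" "box n v \<epsilon> \<subseteq> E n interior_of W"
    using openin_interior_of[of "E n" W] v unfolding openin_E_box by meson
  \<comment> \<open>With \<open>\<gamma>'\<close> over the middle of a box in the interior, both
    \<open>\<gamma>'\<close> and \<open>\<gamma>' + \<gamma>\<close> are over the interior and hence
    in \<Lambda>.\<close>
  have small: "\<gamma> \<in> D" if \<gamma>: "\<gamma> \<in> \<Gamma>" "\<And>j. j < n \<Longrightarrow> \<bar>\<sigma> \<gamma> j\<bar> < \<epsilon> / 2" for \<gamma>
  proof -
    have "(\<lambda>j. v j + c j) \<in> topspace (E n)" using vE cE by (simp add: mem_E)
    then obtain \<gamma>' where \<gamma>': "\<gamma>' \<in> \<Gamma>" "\<sigma> \<gamma>' \<in> box n (\<lambda>j. v j + c j) (\<epsilon> / 2)"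
      using dense'[of _ "\<epsilon> / 2"] e(1) by (metis half_gt_zero)
    have d: "\<bar>\<sigma> \<gamma>' j - (v j + c j)\<bar> < \<epsilon> / 2" if "j < n" for j using \<gamma>'(2) that unfolding box_def by blast
    have inE: "(\<lambda>j. \<sigma> x j - c j) \<in> topspace (E n)" if "x \<in> \<Gamma>" for x using \<sigma>E[OF that] cE by (simp add: mem_E)
    have "(\<lambda>j. \<sigma> \<gamma>' j - c j) \<in> box n v \<epsilon>"
      unfolding box_def mem_Collect_eq
    proof (intro conjI allI impI inE[OF \<gamma>'(1)])
      fix j assume "j < n" then show "\<bar>\<sigma> \<gamma>' j - c j - v j\<bar> < \<epsilon>" using d[of j] e(1) by linarith
    qed
    then have 1: "\<gamma>' \<in> \<Lambda>" using low[OF \<gamma>'(1)] e(2) by blast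
    have sum: "\<gamma>' + \<gamma> \<in> \<Gamma>" by (rule \<Gamma>_add[OF \<gamma>'(1) \<gamma>(1)])
    have "(\<lambda>j. \<sigma> (\<gamma>' + \<gamma>) j - c j) \<in> box n v \<epsilon>"
      unfolding box_def mem_Collect_eq
    proof (intro conjI allI impI inE[OF sum])
      fix j assume "j < n"
      then show "\<bar>\<sigma> (\<gamma>' + \<gamma>) j - c j - v j\<bar> < \<epsilon>"
        using d[of j] \<gamma>(2)[of j] \<sigma>_add[OF \<gamma>'(1) \<gamma>(1), of j] by linarith
    qed
    then have 2: "\<gamma>' + \<gamma> \<in> \<Lambda>" using low[OF sum] e(2) by blast
    show ?thesis using difference_setI[OF 2 1] by simp
  qed
  have LG: "x \<in> \<Gamma>" if "x \<in> L" for x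
    using that
  proof induction
    case (base u)
    then show ?case using \<Gamma> \<Lambda>G unfolding difference_set_def by auto
  qed (use \<Gamma>(2) in blast)
  have GL: "\<gamma> \<in> L" if \<gamma>: "\<gamma> \<in> \<Gamma>" for \<gamma>
  proof -
    define S where "S = (\<Sum>j<n. \<bar>\<sigma> \<gamma> j\<bar>)"
    have S: "\<bar>\<sigma> \<gamma> j\<bar> \<le> S" if "j < n" for j unfolding S_def by (rule member_le_sum) (use that in auto)
    \<comment> \<open>\<open>m\<close> is so large that \<open>S / m\<close> and
      \<open>\<epsilon> / (2 * m)\<close> are at most \<open>\<epsilon> / 4\<close>, which makes
      \<open>\<sigma> g\<close> small; the error of \<open>\<sigma> g\<close>, multiplied by
      \<open>m\<close>, still stays below \<open>\<epsilon> / 2\<close>.\<close>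
    obtain m0 :: nat where m0: "4 * S / \<epsilon> < real m0" using reals_Archimedean2 by blast
    define m where "m = m0 + 2"
    have m: "m \<ge> 2" "4 * S / \<epsilon> < real m" using m0 unfolding m_def by auto
    have Sm: "S / m < \<epsilon> / 4" using m e(1) by (simp add: field_simps)
    have em: "\<epsilon> / (2 * m) \<le> \<epsilon> / 4" using m(1) e(1) by (intro divide_left_mono) auto
    have "(\<lambda>j. \<sigma> \<gamma> j / m) \<in> topspace (E n)" using \<sigma>E[OF \<gamma>] by (simp add: mem_E)
    then obtain g where g: "g \<in> \<Gamma>" "\<sigma> g \<in> box n (\<lambda>j. \<sigma> \<gamma> j / m) (\<epsilon> / (2 * m))"
      using dense'[of _ "\<epsilon> / (2 * m)"] e(1) m(1) by force
    have d: "\<bar>\<sigma> g j - \<sigma> \<gamma> j / m\<bar> < \<epsilon> / (2 * m)" if "j < n" for j using g(2) that unfolding box_def by blast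
    have mg: "of_nat m *\<^sub>R g \<in> \<Gamma>" "\<And>j. \<sigma> (of_nat m *\<^sub>R g) j = m * \<sigma> g j"
      using additive_on_of_nat[OF add, of g m] g(1) unfolding gc by auto
    have "g \<in> D"
    proof (rule small[OF g(1)])
      fix j assume j: "j < n"
      have "\<bar>\<sigma> \<gamma> j / m\<bar> \<le> S / m" using S[OF j] by (simp add: divide_right_mono)
      then show "\<bar>\<sigma> g j\<bar> < \<epsilon> / 2" using d[OF j] Sm em by linarith
    qed
    then have "g \<in> L" by (rule difference_set_group)
    then have 1: "of_nat m *\<^sub>R g \<in> L" using additive_on_of_nat[OF additive_star, of g m] by blast
    have "\<gamma> - of_nat m *\<^sub>R g \<in> D"
    proof (rule small[OF \<Gamma>(2)[OF \<gamma> mg(1)]])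
      fix j assume j: "j < n"
      have "m * \<bar>\<sigma> g j - \<sigma> \<gamma> j / m\<bar> < \<epsilon> / 2" using d[OF j] m(1) by (simp add: field_simps)
      moreover have "m * \<bar>\<sigma> g j - \<sigma> \<gamma> j / m\<bar> = \<bar>m * \<sigma> g j - \<sigma> \<gamma> j\<bar>"
        using m(1) by (simp add: abs_mult_pos' right_diff_distrib)
      moreover have "\<sigma> (\<gamma> - of_nat m *\<^sub>R g) j = \<sigma> \<gamma> j - m * \<sigma> g j"
        using additive_on_diff[OF add, of \<gamma> "of_nat m *\<^sub>R g" j] \<gamma> mg unfolding gc by simp
      ultimately show "\<bar>\<sigma> (\<gamma> - of_nat m *\<^sub>R g) j\<bar> < \<epsilon> / 2" by (simp add: abs_minus_commute)
    qed
    then have "(\<gamma> - of_nat m *\<^sub>R g) + of_nat m *\<^sub>R g \<in> L"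
      using 1 difference_set_group by (intro group_closure_add) auto
    then show ?thesis by simp
  qed
  have GLeq: "\<Gamma> = L" using LG GL by blast
  have "inter_model \<Lambda> b n \<sigma> W c"
  proof (intro inter_model.intro address_system_axioms inter_model_axioms.intro)
    show "\<exists>\<epsilon>>0. \<forall>\<gamma>\<in>L. (\<forall>j<n. \<bar>\<sigma> \<gamma> j\<bar> < \<epsilon>) \<longrightarrow> \<gamma> \<in> D"
      using small e(1) unfolding GLeq by (intro exI[of _ "\<epsilon> / 2"]) auto
  qed (use n \<sigma>E add[unfolded gc] dense' win cE up low in \<open>simp_all add: GLeq\<close>)
  then show ?thesis by blast
qed

section \<open>From the address system to inter-model sets\<close>

context address_system
begin

text \<open>The equation on the coboundaries says that \<open>translate B u\<close> has the same address as \<open>A\<close>.\<close>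

definition determined :: "'a set \<Rightarrow> bool"
  where "determined A \<longleftrightarrow> (\<forall>B\<in>\<Xi>. \<forall>u\<in>L. (\<forall>i<s. cobound B i = cobound A i - star u i) \<longrightarrow> translate B u = A)"

lemma determined_translate:
  assumes A: "A \<in> \<Xi>" and det: "determined A" and z: "z \<in> A"
  shows "determined (translate A z)"
  unfolding determined_def
proof (intro ballI impI)
  fix B u assume B: "B \<in> \<Xi>" and u: "u \<in> L" and eq: "\<forall>i<s. cobound B i = cobound (translate A z) i - star u i"
  have zL: "z \<in> L" using transversal_subset_L[OF A] z by blast
  have "\<forall>i<s. cobound B i = cobound A i - star (u - z) i"
    using eq cobound_translate[OF A z] star_diff[OF u zL] by simp
  then have "translate B (u - z) = A" using det B group_closure.diff[OF u zL] unfolding determined_def by blast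
  then have "translate (translate B (u - z)) z = translate A z" by simp
  then show "translate B u = translate A z" by (simp add: translate_translate)
qed

text \<open>Equivariance determines \<pi> on the translates of \<Lambda> by its points, where
  \<open>lin x\<close> equals \<open>- star x\<close> modulo integers; continuity extends the
  formula. On the transversal \<pi> is thus the address map followed by a rotation.\<close>

lemma factor_map_eq:
  assumes \<pi>: "factor_map (hull_topology \<Lambda>) translate (address_space \<Lambda>) (address_action \<Lambda> b) \<pi>"
  obtains v where "v \<in> topspace (E s)" "\<And>A. A \<in> \<Xi> \<Longrightarrow> \<pi> A = torus_class s (\<lambda>i. v i - cobound A i)"
proof -
  have cont: "continuous_map (hull_topology \<Lambda>) (torus s) \<pi>"
    and equiv: "\<And>A t. A \<in> hull_of \<Lambda> \<Longrightarrow> \<pi> (translate A t) = torus_add (\<pi> A) (torus_class s (lin t))"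
    using \<pi> unfolding factor_map_def address_space_def topspace_hull_topology address_action_eq by auto
  have \<pi>_in: "\<pi> A \<in> topspace (torus s)" if "A \<in> hull_of \<Lambda>" for A
    using continuous_map_image_subset_topspace[OF cont] that by (auto simp: topspace_hull_topology)
  obtain v where v: "v \<in> topspace (E s)" "\<pi> \<Lambda> = torus_class s v" using \<pi>_in[OF base_hull] unfolding topspace_torus by blast
  define h where "h A = torus_class s (\<lambda>i. v i - cobound A i)" for A
  have hE: "(\<lambda>i. v i - cobound A i) \<in> topspace (E s)" for A using v(1) cobound_E[of A] by (simp add: mem_E)
  have h_in: "h A \<in> topspace (torus s)" for A unfolding h_def using torus_class_in[OF hE] .
  have orbit: "\<pi> (translate \<Lambda> x) = h (translate \<Lambda> x)" if x: "x \<in> \<Lambda>" for x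
  proof -
    have E': "(\<lambda>i. v i + lin x i) \<in> topspace (E s)" using v(1) lin_E[of x] by (simp add: mem_E)
    have "\<pi> (translate \<Lambda> x) = torus_class s (\<lambda>i. v i + lin x i)"
      unfolding equiv[OF base_hull] v(2) by (rule torus_add_class[OF v(1) lin_E])
    also have "\<dots> = h (translate \<Lambda> x)"
      unfolding h_def torus_class_eq_iff[OF E' hE]
      by (simp add: cobound_point[OF x] star_def coord_Ints)
    finally show ?thesis .
  qed
  have "\<pi> A = h A" if A: "A \<in> \<Xi>" for A
  proof (rule ccontr)
    assume ne: "\<pi> A \<noteq> h A"
    define \<epsilon> where "\<epsilon> = torus_dist s (\<pi> A) (h A)"
    have Ah: "A \<in> hull_of \<Lambda>" using transversal_hull[OF A] .
    have e: "\<epsilon> > 0"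
      unfolding \<epsilon>_def using torus.zero[OF \<pi>_in[OF Ah] h_in[of A]] torus.nonneg[of s "\<pi> A" "h A"] ne by linarith
    define U where "U = {B \<in> topspace (hull_topology \<Lambda>). \<pi> B \<in> torus.mball s (\<pi> A) (\<epsilon> / 2)}"
    have "openin (torus s) (torus.mball s (\<pi> A) (\<epsilon> / 2))"
      using torus.openin_mball[of s "\<pi> A" "\<epsilon> / 2"] unfolding torus_mtopology .
    then have "openin (hull_topology \<Lambda>) U" unfolding U_def by (rule openin_continuous_map_preimage[OF cont])
    moreover have "A \<in> U" unfolding U_def using Ah \<pi>_in[OF Ah] e by (simp add: topspace_hull_topology)
    ultimately obtain \<rho> \<delta> where \<rho>: "\<delta> > 0" "\<And>B t. B \<in> hull_of \<Lambda> \<Longrightarrow> agree \<rho> B A \<Longrightarrow> norm t < \<delta> \<Longrightarrow> translate B t \<in> U"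
      unfolding openin_hull_topology_agree by meson
    define \<eta> where "\<eta> = \<epsilon> / (2 * (s + 1))"
    have \<eta>: "\<eta> > 0" unfolding \<eta>_def using e by simp
    obtain \<rho>2 where \<rho>2: "\<And>A B i. A \<in> \<Xi> \<Longrightarrow> B \<in> \<Xi> \<Longrightarrow> agree \<rho>2 A B \<Longrightarrow> i < s \<Longrightarrow> \<bar>cobound A i - cobound B i\<bar> < \<eta>"
      using cobound_modulus[OF \<eta>] by metis
    obtain x where x: "x \<in> \<Lambda>" "agree (max \<rho> \<rho>2) A (translate \<Lambda> x)" using transversal_patch[OF A] by blast
    define B where "B = translate \<Lambda> x"
    have B: "B \<in> \<Xi>" "agree (max \<rho> \<rho>2) A B" unfolding B_def using x transversal_translate[OF base_transversal] by auto
    have "translate B 0 \<in> U"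
      by (rule \<rho>(2)[OF transversal_hull[OF B(1)] agree_mono[OF agree_sym[OF B(2)]]]) (use \<rho>(1) in auto)
    then have 1: "torus_dist s (\<pi> A) (\<pi> B) < \<epsilon> / 2" unfolding U_def by (simp add: translate_0)
    have "torus_dist s (h B) (h A) \<le> (\<Sum>i<s. \<bar>cobound A i - cobound B i\<bar>)"
      unfolding h_def torus_dist_class[OF hE hE] by (rule order_trans[OF torus_pre_dist_le]) simp
    also have "\<dots> \<le> (\<Sum>i<s. \<eta>)"
      using \<rho>2[OF A B(1) agree_mono[OF B(2)]] by (intro sum_mono) (auto intro: less_imp_le)
    also have "\<dots> < \<epsilon> / 2" unfolding \<eta>_def using e by (simp add: field_simps)
    finally have "torus_dist s (\<pi> B) (h A) < \<epsilon> / 2" using orbit[OF x(1)] unfolding B_def by simp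
    then show False
      using 1 torus.triangle[OF \<pi>_in[OF Ah] \<pi>_in[OF transversal_hull[OF B(1)]] h_in[of A]] unfolding \<epsilon>_def by linarith
  qed
  then show ?thesis using that v(1) unfolding h_def by blast
qed

text \<open>A preimage of the class of \<open>v - y\<close>, moved into the transversal, shows that
  \<open>y = cobound A - star p\<close> with \<open>p \<in> L\<close>. If \<Lambda> moved by its
  point \<open>z\<close> agrees with \<open>A\<close> on a large patch, then
  \<open>star (z - p)\<close> is near \<open>y\<close>.\<close>

lemma factor_map_star_dense:
  assumes \<pi>: "factor_map (hull_topology \<Lambda>) translate (address_space \<Lambda>) (address_action \<Lambda> b) \<pi>"
  shows star_dense
  unfolding star_dense_def
proof (intro ballI allI impI)
  fix y and \<epsilon> :: real assume y: "y \<in> kern" and e: "\<epsilon> > 0"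
  obtain v where v: "v \<in> topspace (E s)" "\<And>A. A \<in> \<Xi> \<Longrightarrow> \<pi> A = torus_class s (\<lambda>i. v i - cobound A i)"
    using factor_map_eq[OF \<pi>] by metis
  have surj: "\<pi> ` hull_of \<Lambda> = topspace (torus s)"
    and equiv: "\<And>A t. A \<in> hull_of \<Lambda> \<Longrightarrow> \<pi> (translate A t) = torus_add (\<pi> A) (torus_class s (lin t))"
    using \<pi> unfolding factor_map_def address_space_def topspace_hull_topology address_action_eq by auto
  have yE: "(\<lambda>i. v i - y i) \<in> topspace (E s)" using v(1) y unfolding kern_def by (simp add: mem_E)
  then obtain B where B: "B \<in> hull_of \<Lambda>" "\<pi> B = torus_class s (\<lambda>i. v i - y i)"
    using surj torus_class_in[OF yE] by (metis imageE)
  obtain p where p: "p \<in> B" using hull_nonempty[OF B(1)] by blast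
  define A where "A = translate B p"
  have A: "A \<in> \<Xi>" unfolding A_def by (rule hull_translate_transversal[OF B(1) p])
  have E1: "(\<lambda>i. v i - cobound A i) \<in> topspace (E s)" using v(1) cobound_E[of A] by (simp add: mem_E)
  have E2: "(\<lambda>i. v i - cobound A i + lin (- p) i) \<in> topspace (E s)"
    using v(1) cobound_E[of A] lin_E[of "- p"] by (simp add: mem_E)
  have "\<pi> B = \<pi> (translate A (- p))" unfolding A_def by simp
  also have "\<dots> = torus_class s (\<lambda>i. v i - cobound A i + lin (- p) i)"
    unfolding equiv[OF transversal_hull[OF A]] v(2)[OF A] by (rule torus_add_class[OF E1 lin_E])
  finally have cls: "\<forall>i<s. (v i - y i) - (v i - cobound A i + lin (- p) i) \<in> \<int>"
    unfolding B(2) torus_class_eq_iff[OF yE E2] .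
  define k where "k = (\<lambda>i. cobound A i - y i - lin (- p) i)"
  have k: "k i \<in> \<int>" if "i < s" for i using cls that unfolding k_def by (simp add: algebra_simps)
  have "combine k = combine (cobound A) - combine y - combine (lin (- p))" unfolding k_def combine_diff ..
  then have kp: "combine k = p" using combine_cobound[OF A] y combine_lin[of "- p"] unfolding kern_def by simp
  have pL: "p \<in> L" and kc: "\<And>i. i < s \<Longrightarrow> coord p i = k i" using coord_surj[of k, OF k] unfolding kp by auto
  have y_eq: "y i = cobound A i - star p i" if "i < s" for i
    using kc[OF that] unfolding k_def star_def lin_minus by simp
  obtain \<rho> where \<rho>: "\<And>A B i. A \<in> \<Xi> \<Longrightarrow> B \<in> \<Xi> \<Longrightarrow> agree \<rho> A B \<Longrightarrow> i < s \<Longrightarrow> \<bar>cobound A i - cobound B i\<bar> < \<epsilon>"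
    using cobound_modulus[OF e] by metis
  obtain z where z: "z \<in> \<Lambda>" "agree \<rho> A (translate \<Lambda> z)" using transversal_patch[OF A] by blast
  have "\<bar>star (z - p) i - y i\<bar> < \<epsilon>" if i: "i < s" for i
    using \<rho>[OF A transversal_translate[OF base_transversal z(1)] z(2) i]
    unfolding cobound_point[OF z(1)] star_diff[OF mem_L[OF z(1)] pL] y_eq[OF i] by linarith
  then show "\<exists>\<gamma>\<in>L. \<forall>i<s. \<bar>star \<gamma> i - y i\<bar> < \<epsilon>"
    using group_closure.diff[OF mem_L[OF z(1)] pL] by blast
qed

text \<open>The one-point fibre is moved into the transversal; there the equation in
  \<open>determined\<close> says that two lifts differ by the integer vector
  \<open>coord u\<close>.\<close>

lemma factor_map_determined:
  assumes \<pi>: "factor_map (hull_topology \<Lambda>) translate (address_space \<Lambda>) (address_action \<Lambda> b) \<pi>"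
    and unique: "\<exists>!A. A \<in> hull_of \<Lambda> \<and> \<pi> A = w"
  shows "\<exists>A\<in>\<Xi>. determined A"
proof -
  obtain v where v: "v \<in> topspace (E s)" "\<And>A. A \<in> \<Xi> \<Longrightarrow> \<pi> A = torus_class s (\<lambda>i. v i - cobound A i)"
    using factor_map_eq[OF \<pi>] by metis
  have equiv: "\<And>A t. A \<in> hull_of \<Lambda> \<Longrightarrow> \<pi> (translate A t) = torus_add (\<pi> A) (torus_class s (lin t))"
    using \<pi> unfolding factor_map_def address_space_def topspace_hull_topology address_action_eq by auto
  obtain B where B: "B \<in> hull_of \<Lambda>" "\<pi> B = w" "\<And>C. C \<in> hull_of \<Lambda> \<Longrightarrow> \<pi> C = w \<Longrightarrow> C = B" using unique by metis
  obtain p where p: "p \<in> B" using hull_nonempty[OF B(1)] by blast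
  define A where "A = translate B p"
  have A: "A \<in> \<Xi>" unfolding A_def by (rule hull_translate_transversal[OF B(1) p])
  have Ap: "translate A (- p) = B" unfolding A_def by simp
  have hE: "(\<lambda>i. v i - cobound C i) \<in> topspace (E s)" for C using v(1) cobound_E[of C] by (simp add: mem_E)
  have "determined A"
    unfolding determined_def
  proof (intro ballI impI)
    fix C u assume C: "C \<in> \<Xi>" and u: "u \<in> L" and eq: "\<forall>i<s. cobound C i = cobound A i - star u i"
    have E': "(\<lambda>i. v i - cobound C i + lin u i) \<in> topspace (E s)"
      using hE[of C] lin_E[of u] by (simp add: mem_E)
    have "\<pi> (translate C u) = torus_class s (\<lambda>i. v i - cobound C i + lin u i)"
      unfolding equiv[OF transversal_hull[OF C]] v(2)[OF C] by (rule torus_add_class[OF hE lin_E])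
    also have "\<dots> = \<pi> A"
      unfolding v(2)[OF A] torus_class_eq_iff[OF E' hE] using eq by (simp add: star_def coord_Ints)
    finally have "\<pi> (translate C u) = \<pi> A" .
    then have "\<pi> (translate (translate C u) (- p)) = \<pi> (translate A (- p))"
      unfolding equiv[OF transversal_hull[OF A]] equiv[OF hull_of_translate[OF transversal_hull[OF C]]] by simp
    then have "\<pi> (translate (translate C u) (- p)) = w" unfolding Ap B(2) .
    then have "translate (translate C u) (- p) = B"
      by (rule B(3)[OF hull_of_translate[OF hull_of_translate[OF transversal_hull[OF C]]]])
    then have "translate (translate (translate C u) (- p)) p = translate B p" by simp
    then show "translate C u = A" unfolding A_def by simp
  qed
  then show ?thesis using A by blast
qed

text \<open>Apply \<open>near_decomposition\<close> to the sets that miss \<open>u\<close>: a set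
  \<open>B\<close> with the coboundary in question satisfies \<open>translate B u = A\<close>, and
  \<open>0 \<in> A\<close> shows that \<open>B\<close> contains \<open>u\<close>.\<close>

lemma determined_near:
  assumes A: "A \<in> \<Xi>" and det: "determined A"
  shows "\<exists>\<delta>>0. \<forall>\<gamma>\<in>L. (\<forall>i<s. \<bar>star \<gamma> i - cobound A i\<bar> < \<delta>) \<longrightarrow> \<gamma> \<in> \<Lambda>"
proof -
  define Q where "Q u = {B\<in>\<Xi>. u \<notin> B}" for u
  have "\<not> (\<forall>i<s. cobound B i = cobound A i - star u i)" if u: "u \<in> L" and B: "B \<in> Q u" for u B
  proof
    assume "\<forall>i<s. cobound B i = cobound A i - star u i"
    then have "translate B u = A" using det u B unfolding determined_def Q_def by blast
    then have "0 \<in> translate B u" using transversal_zero[OF A] by simp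
    then show False using B unfolding Q_def by (simp add: mem_translate)
  qed
  then obtain \<delta> where \<delta>: "\<delta> > 0" "\<And>\<gamma>. \<gamma> \<in> L \<Longrightarrow> (\<forall>i<s. \<bar>star \<gamma> i - cobound A i\<bar> < \<delta>) \<Longrightarrow>
      \<exists>x\<in>\<Lambda>. \<exists>u\<in>L. \<gamma> = x + u \<and> translate \<Lambda> x \<notin> Q u"
    using near_decomposition[of Q "cobound A"] unfolding Q_def by blast
  have "\<gamma> \<in> \<Lambda>" if \<gamma>: "\<gamma> \<in> L" "\<forall>i<s. \<bar>star \<gamma> i - cobound A i\<bar> < \<delta>" for \<gamma>
  proof -
    obtain x u where xu: "x \<in> \<Lambda>" "\<gamma> = x + u" "translate \<Lambda> x \<notin> Q u" using \<delta>(2)[OF \<gamma>] by blast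
    then have "u \<in> translate \<Lambda> x" using transversal_translate[OF base_transversal xu(1)] unfolding Q_def by blast
    then show ?thesis unfolding xu(2) by (simp add: mem_translate add.commute)
  qed
  then show ?thesis using \<delta>(1) by blast
qed

end

text \<open>A real basis of the ambient space among the \<open>b i\<close> leaves \<open>n = s - d\<close> indices \<open>e k\<close>, and
  the coordinates at these indices parametrise the kernel of \<open>combine\<close>.\<close>

locale internal_coordinates = address_system \<Lambda> b for \<Lambda> :: "'a::euclidean_space set" and b +
  fixes n :: nat and e :: "nat \<Rightarrow> nat" and K :: real
  assumes n_pos: "0 < n" and e_less: "\<And>k. k < n \<Longrightarrow> e k < s" and K_pos: "K > 0"
    and kern_surj: "\<And>y. \<exists>v\<in>kern. \<forall>k<n. v (e k) = y k"
    and kern_bound: "\<And>v m i. v \<in> kern \<Longrightarrow> (\<And>k. k < n \<Longrightarrow> \<bar>v (e k)\<bar> \<le> m) \<Longrightarrow> i < s \<Longrightarrow> \<bar>v i\<bar> \<le> K * m"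

lemma (in address_system) internal_coordinates_exist:
  assumes "DIM('a) < s"
  shows "\<exists>n e K. internal_coordinates \<Lambda> b n e K"
proof -
  obtain B where B: "B \<subseteq> b ` {..<s}" "independent B" "b ` {..<s} \<subseteq> span B"
    using maximal_independent_subset by metis
  have span_B: "t \<in> span B" for t
  proof -
    have "combine (lin t) \<in> span B"
      unfolding combine_def using B(3) by (intro span_sum span_scale) auto
    then show ?thesis unfolding combine_lin .
  qed
  have finB: "finite B" using B(1) finite_subset by blast
  have cardB: "card B = DIM('a)" using basis_card_eq_dim[of B UNIV] B(2) span_B by (auto simp: dim_UNIV)
  define I where "I = {i. i < s \<and> b i \<in> B}"
  define J where "J = {i. i < s \<and> b i \<notin> B}"
  have IJ: "I \<union> J = {..<s}" "I \<inter> J = {}" "finite I" "finite J" unfolding I_def J_def by auto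
  have injI: "inj_on b I" by (rule inj_on_subset[OF inj_b]) (auto simp: I_def)
  have bI: "b ` I = B" unfolding I_def using B(1) by auto
  have "card I = DIM('a)" using card_image[OF injI] unfolding bI cardB by simp
  moreover have "card {..<s} = card I + card J" unfolding IJ(1)[symmetric] by (rule card_Un_disjoint[OF IJ(3,4,2)])
  ultimately have n_pos: "0 < card J" using assms by simp
  obtain e where e: "bij_betw e {..<card J} J"
    using ex_bij_betw_nat_finite[OF IJ(4)] unfolding atLeast0LessThan by blast
  have split_sum: "(\<Sum>i<s. f i) = (\<Sum>i\<in>I. f i) + (\<Sum>k<card J. f (e k))" for f :: "nat \<Rightarrow> 'b::comm_monoid_add"
    unfolding IJ(1)[symmetric] sum.union_disjoint[OF IJ(3,4,2)] sum.reindex_bij_betw[OF e] ..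
  define rep where "rep z i = representation B z (b i)" for z i
  have rep_sum: "(\<Sum>i\<in>I. rep z i *\<^sub>R b i) = z" for z
  proof -
    have "(\<Sum>x\<in>B. representation B z x *\<^sub>R x) = z"
      by (rule sum_representation_eq[OF B(2) span_B finB]) simp
    then show ?thesis unfolding rep_def bI[symmetric] sum.reindex[OF injI] by simp
  qed
  have linear_rep: "linear (\<lambda>z. rep z i)" for i
    unfolding rep_def by (rule linearI) (simp_all add: representation_add[OF B(2) span_B span_B] representation_scale[OF B(2) span_B])
  have "\<exists>C>0. \<forall>z. \<bar>rep z i\<bar> \<le> C * norm z" for i
    using linear_bounded_pos[OF linear_rep, of i] by auto
  then obtain C where C: "\<And>i. C i > 0" "\<And>i z. \<bar>rep z i\<bar> \<le> C i * norm z" by metis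
  define N where "N = (\<Sum>k<card J. norm (b (e k)))"
  \<comment> \<open>The term 1 covers the indices in \<open>J\<close>, whose coordinates are given;
    the other term bounds those in \<open>I\<close>, which are solved for by
    \<open>rep\<close>.\<close>
  define K where "K = 1 + (\<Sum>i<s. C i) * N"
  have Csum: "(\<Sum>i<s. C i) \<ge> 0" using C(1) by (simp add: sum_nonneg less_imp_le)
  have N0: "N \<ge> 0" unfolding N_def by (simp add: sum_nonneg)
  have K1: "K \<ge> 1" unfolding K_def using Csum N0 by simp
  have surj: "\<exists>v\<in>kern. \<forall>k<card J. v (e k) = y k" for y
  proof -
    define z where "z = (\<Sum>k<card J. y k *\<^sub>R b (e k))"
    \<comment> \<open>Prescribed on \<open>J\<close>; on \<open>I\<close> the coefficients cancel
      the resulting vector \<open>z\<close>.\<close>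
    define v where "v i = (if i \<in> I then - rep z i else if i \<in> J then y (the_inv_into {..<card J} e i) else 0)" for i
    have ve: "v (e k) = y k" if "k < card J" for k
    proof -
      have "e k \<in> J" using e that by (auto simp: bij_betw_def)
      moreover have "the_inv_into {..<card J} e (e k) = k"
        using e that by (intro the_inv_into_f_f) (auto simp: bij_betw_def)
      ultimately show ?thesis unfolding v_def using IJ(2) by auto
    qed
    have "combine v = (\<Sum>i\<in>I. - rep z i *\<^sub>R b i) + (\<Sum>k<card J. y k *\<^sub>R b (e k))"
      unfolding combine_def split_sum using ve by (simp add: v_def)
    also have "\<dots> = 0" using rep_sum[of z] unfolding z_def by (simp add: sum_negf)
    finally have "combine v = 0" .
    moreover have "v \<in> topspace (E s)" unfolding mem_E v_def using IJ(1) by (auto simp: I_def J_def)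
    ultimately show ?thesis using ve unfolding kern_def by blast
  qed
  have bound: "\<bar>v i\<bar> \<le> K * m" if v: "v \<in> kern" and m: "\<And>k. k < card J \<Longrightarrow> \<bar>v (e k)\<bar> \<le> m" and i: "i < s" for v m i
  proof -
    have m0: "m \<ge> 0" using m[OF n_pos] by linarith
    define z where "z = (\<Sum>k<card J. v (e k) *\<^sub>R b (e k))"
    show ?thesis
    proof (cases "i \<in> I")
      case False
      then have "i \<in> J" using i IJ(1) by auto
      then obtain k where "k < card J" "i = e k" using e by (auto simp: bij_betw_def)
      then have "\<bar>v i\<bar> \<le> m" using m by blast
      also have "m \<le> K * m" using K1 m0 by (simp add: mult_right_mono[of 1 K m, simplified])
      finally show ?thesis .
    next
      case True
      have "(\<Sum>i\<in>I. v i *\<^sub>R b i) + z = 0" using v unfolding kern_def combine_def split_sum z_def by simp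
      then have "(\<Sum>i\<in>I. (v i + rep z i) *\<^sub>R b i) = 0"
        using rep_sum[of z] by (simp add: scaleR_add_left sum.distrib)
      moreover have "(\<Sum>i\<in>I. (v i + rep z i) *\<^sub>R b i) = (\<Sum>x\<in>B. (v (the_inv_into I b x) + rep z (the_inv_into I b x)) *\<^sub>R x)"
        unfolding bI[symmetric] sum.reindex[OF injI] by (intro sum.cong) (auto simp: the_inv_into_f_f[OF injI])
      ultimately have sum0: "(\<Sum>x\<in>B. (v (the_inv_into I b x) + rep z (the_inv_into I b x)) *\<^sub>R x) = 0" by simp
      have "b i \<in> B" using True unfolding I_def by blast
      then have "v (the_inv_into I b (b i)) + rep z (the_inv_into I b (b i)) = 0"
        by (rule independentD[OF B(2) finB subset_refl sum0])
      then have "v i + rep z i = 0" using True by (simp add: the_inv_into_f_f[OF injI])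
      then have "\<bar>v i\<bar> \<le> C i * norm z" using C(2)[of z i] by linarith
      also have "\<dots> \<le> C i * (N * m)"
      proof (rule mult_left_mono)
        have "norm z \<le> (\<Sum>k<card J. norm (v (e k) *\<^sub>R b (e k)))" unfolding z_def by (rule norm_sum)
        also have "\<dots> \<le> (\<Sum>k<card J. norm (b (e k)) * m)"
          using m by (intro sum_mono) (simp add: mult.commute[of "norm _"] mult_right_mono)
        finally show "norm z \<le> N * m" unfolding N_def by (simp add: sum_distrib_right)
      qed (use C(1)[of i] in simp)
      also have "\<dots> \<le> (\<Sum>i<s. C i) * (N * m)"
      proof (rule mult_right_mono)
        show "C i \<le> (\<Sum>i<s. C i)" by (rule member_le_sum) (use i C(1) in \<open>auto simp: less_imp_le\<close>)
      qed (use N0 m0 in simp)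
      also have "\<dots> \<le> K * m" unfolding K_def using m0 by (simp add: algebra_simps)
      finally show ?thesis .
    qed
  qed
  have "internal_coordinates \<Lambda> b (card J) e K"
  proof (intro internal_coordinates.intro address_system_axioms internal_coordinates_axioms.intro n_pos surj bound)
    show "e k < s" if "k < card J" for k using e that unfolding bij_betw_def J_def by auto
  qed (use K1 in auto)
  then show ?thesis by blast
qed

context internal_coordinates
begin

definition select :: "(nat \<Rightarrow> real) \<Rightarrow> nat \<Rightarrow> real"
  where "select v k = (if k < n then v (e k) else 0)"

lemma select_E: "select v \<in> topspace (E n)"
  by (simp add: mem_E select_def)

lemma select_surj:
  assumes "y \<in> topspace (E n)" obtains v where "v \<in> kern" "select v = y"
proof -
  obtain v where v: "v \<in> kern" "\<forall>k<n. v (e k) = y k" using kern_surj by blast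
  have "select v = y" by (rule E_eqI[OF select_E assms]) (simp add: select_def v(2))
  then show ?thesis using that v(1) by blast
qed

lemma kern_add: "v \<in> kern \<Longrightarrow> w \<in> kern \<Longrightarrow> (\<lambda>i. v i + w i) \<in> kern"
  unfolding kern_def by (simp add: mem_E combine_add)

lemma kern_diff: "v \<in> kern \<Longrightarrow> w \<in> kern \<Longrightarrow> (\<lambda>i. v i - w i) \<in> kern"
  unfolding kern_def by (simp add: mem_E combine_diff)

lemma select_box:
  assumes v: "v \<in> kern" and w: "w \<in> kern" and "select v \<in> box n (select w) \<epsilon>" and i: "i < s"
  shows "\<bar>v i - w i\<bar> \<le> K * \<epsilon>"
proof -
  have "\<bar>v (e k) - w (e k)\<bar> \<le> \<epsilon>" if "k < n" for k
    using assms(3) that unfolding box_def select_def by auto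
  then show ?thesis using kern_bound[OF kern_diff[OF v w] _ i] by simp
qed

lemma select_in_box:
  assumes "\<And>i. i < s \<Longrightarrow> \<bar>v i - w i\<bar> < \<epsilon>" shows "select v \<in> box n (select w) \<epsilon>"
  unfolding box_def using assms e_less select_E by (simp add: select_def)

definition sigma :: "'a \<Rightarrow> nat \<Rightarrow> real"
  where "sigma \<gamma> = select (star \<gamma>)"

lemma sigma_add: "x \<in> L \<Longrightarrow> y \<in> L \<Longrightarrow> sigma (x + y) k = sigma x k + sigma y k"
  unfolding sigma_def select_def using star_add by simp

lemma sigma_diff: "x \<in> L \<Longrightarrow> y \<in> L \<Longrightarrow> sigma (x - y) k = sigma x k - sigma y k"
  unfolding sigma_def select_def using star_diff by simp

lemma coord_bound:
  assumes "\<gamma> \<in> L" "\<And>k. k < n \<Longrightarrow> \<bar>sigma \<gamma> k\<bar> \<le> m" "i < s"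
  shows "\<bar>coord \<gamma> i\<bar> \<le> K * m + \<bar>lin \<gamma> i\<bar>"
proof -
  have "\<bar>star \<gamma> i\<bar> \<le> K * m"
    by (rule kern_bound[OF star_kern[OF assms(1)] _ assms(3)]) (use assms(2) in \<open>auto simp: sigma_def select_def\<close>)
  then show ?thesis unfolding star_def by linarith
qed

section \<open>The lattice of the constructed scheme\<close>

lemma small_zero: "\<exists>\<delta>>0. \<forall>\<gamma>\<in>L. norm \<gamma> < \<delta> \<longrightarrow> (\<forall>k<n. \<bar>sigma \<gamma> k\<bar> < \<delta>) \<longrightarrow> \<gamma> = 0"
proof -
  obtain B where B: "B > 0" "\<And>t i. \<bar>lin t i\<bar> \<le> B * norm t" using lin_bound by blast
  \<comment> \<open>This makes the bound on the coordinates \<open>1 / 2\<close>, and an integer of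
    absolute value below 1 is 0.\<close>
  define \<delta> where "\<delta> = 1 / (2 * (K + B))"
  have KB: "K + B > 0" using K_pos B(1) by simp
  have "\<gamma> = 0" if \<gamma>: "\<gamma> \<in> L" "norm \<gamma> < \<delta>" "\<forall>k<n. \<bar>sigma \<gamma> k\<bar> < \<delta>" for \<gamma>
  proof (rule coord_inject[OF \<gamma>(1) zero_in_group_closure])
    fix i assume i: "i < s"
    have "\<bar>coord \<gamma> i\<bar> \<le> K * \<delta> + \<bar>lin \<gamma> i\<bar>"
      by (rule coord_bound[OF \<gamma>(1) _ i]) (use \<gamma>(3) in \<open>auto intro: less_imp_le\<close>)
    also have "\<dots> \<le> K * \<delta> + B * \<delta>"
    proof -
      have "B * norm \<gamma> \<le> B * \<delta>" using \<gamma>(2) B(1) by simp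
      then show ?thesis using B(2)[of \<gamma> i] by linarith
    qed
    also have "\<dots> = (K + B) * \<delta>" by (simp add: distrib_right)
    also have "\<dots> = 1 / 2" unfolding \<delta>_def using KB by simp
    finally have "\<bar>coord \<gamma> i\<bar> < 1" by simp
    moreover obtain m where m: "coord \<gamma> i = of_int m" using coord_Ints by (rule Ints_cases)
    ultimately have "m = 0" by (simp flip: of_int_abs)
    then show "coord \<gamma> i = coord 0 i" using m additive_on_zero[OF additive_coord] by simp
  qed
  moreover have "\<delta> > 0" unfolding \<delta>_def using KB by simp
  ultimately show ?thesis by blast
qed

abbreviation graph :: "('a \<times> (nat \<Rightarrow> real)) set"
  where "graph \<equiv> {(\<gamma>, sigma \<gamma>) | \<gamma>. \<gamma> \<in> L}"

abbreviation coset :: "'a \<times> (nat \<Rightarrow> real) \<Rightarrow> ('a \<times> (nat \<Rightarrow> real)) set"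
  where "coset \<equiv> \<lambda>(x, y). {(x + \<gamma>, \<lambda>i. y i + v i) | \<gamma> v. (\<gamma>, v) \<in> graph}"

lemma graph_discrete: "subtopology (prod_topology euclidean (E n)) graph = discrete_topology graph"
proof (rule subtopology_eq_discrete_topology, intro conjI)
  show "graph \<subseteq> topspace (prod_topology euclidean (E n))" using select_E unfolding sigma_def by auto
  obtain \<delta> where \<delta>: "\<delta> > 0" "\<And>\<gamma>. \<gamma> \<in> L \<Longrightarrow> norm \<gamma> < \<delta> \<Longrightarrow> (\<forall>k<n. \<bar>sigma \<gamma> k\<bar> < \<delta>) \<Longrightarrow> \<gamma> = 0"
    using small_zero by blast
  show "graph \<inter> prod_topology euclidean (E n) derived_set_of graph = {}"
  proof (rule ccontr)
    assume "graph \<inter> prod_topology euclidean (E n) derived_set_of graph \<noteq> {}"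
    then obtain \<gamma> where \<gamma>: "\<gamma> \<in> L" "(\<gamma>, sigma \<gamma>) \<in> prod_topology euclidean (E n) derived_set_of graph" by blast
    define U where "U = ball \<gamma> \<delta> \<times> box n (sigma \<gamma>) \<delta>"
    have "openin (prod_topology euclidean (E n)) U"
      unfolding U_def openin_prod_Times_iff using openin_box by simp
    moreover have "(\<gamma>, sigma \<gamma>) \<in> U"
      unfolding U_def using \<delta>(1) box_centre[OF select_E \<delta>(1)] by (simp add: sigma_def)
    ultimately obtain q where q: "q \<noteq> (\<gamma>, sigma \<gamma>)" "q \<in> graph" "q \<in> U"
      using \<gamma>(2) unfolding in_derived_set_of by blast
    obtain \<gamma>' where \<gamma>': "\<gamma>' \<in> L" "q = (\<gamma>', sigma \<gamma>')" using q(2) by blast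
    have "\<gamma>' - \<gamma> = 0"
    proof (rule \<delta>(2)[OF group_closure.diff[OF \<gamma>'(1) \<gamma>(1)]])
      show "norm (\<gamma>' - \<gamma>) < \<delta>" using q(3) unfolding \<gamma>'(2) U_def by (simp add: dist_norm norm_minus_commute)
      show "\<forall>k<n. \<bar>sigma (\<gamma>' - \<gamma>) k\<bar> < \<delta>"
        using q(3) sigma_diff[OF \<gamma>'(1) \<gamma>(1)] unfolding \<gamma>'(2) U_def box_def by simp
    qed
    then show False using q(1) unfolding \<gamma>'(2) by simp
  qed
qed

lemma coset_shift:
  assumes g: "g \<in> L" shows "coset (x, y) = coset (x - g, \<lambda>i. y i - sigma g i)"
proof -
  have sub: "coset (x, y) \<subseteq> coset (x - g, \<lambda>i. y i - sigma g i)" if g: "g \<in> L" for x y g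
  proof
    fix q assume "q \<in> coset (x, y)"
    then obtain \<gamma> where \<gamma>: "\<gamma> \<in> L" "q = (x + \<gamma>, \<lambda>i. y i + sigma \<gamma> i)" by auto
    have q: "q = (x - g + (\<gamma> + g), \<lambda>i. y i - sigma g i + sigma (\<gamma> + g) i)"
      unfolding \<gamma>(2) using sigma_add[OF \<gamma>(1) g] by simp
    have "(\<gamma> + g, sigma (\<gamma> + g)) \<in> graph" using group_closure_add[OF \<gamma>(1) g] by blast
    then show "q \<in> coset (x - g, \<lambda>i. y i - sigma g i)"
      unfolding q prod.case mem_Collect_eq by (intro exI[of _ "\<gamma> + g"] exI[of _ "sigma (\<gamma> + g)"] conjI refl) blast
  qed
  have neg: "- g \<in> L" using g by simp
  have sneg: "sigma (- g) i = - sigma g i" for i unfolding sigma_def select_def using star_minus[OF g] by simp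
  show ?thesis
  proof (rule antisym[OF sub[OF g]])
    show "coset (x - g, \<lambda>i. y i - sigma g i) \<subseteq> coset (x, y)"
      using sub[OF neg, of "x - g" "\<lambda>i. y i - sigma g i"] by (simp add: sneg)
  qed
qed

text \<open>A fundamental domain is found by rounding: lift \<open>(x, y)\<close> to
  \<open>lin x + y'\<close> in the coordinate space and take the integer part \<open>k\<close>.
  Subtracting the lattice point of \<open>combine k\<close> moves the pair into a fixed compact
  set.\<close>

lemma graph_cocompact: "compact_space (quotient_topology (prod_topology euclidean (E n)) coset)"
proof -
  let ?P = "prod_topology euclidean (E n) :: ('a \<times> (nat \<Rightarrow> real)) topology"
  let ?Y = "quotient_topology ?P coset"
  have q: "quotient_map ?P ?Y coset" by (rule quotient_map_quotient_topology)
  obtain B where B: "B > 0" "\<And>t i. \<bar>lin t i\<bar> \<le> B * norm t" using lin_bound by blast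
  obtain R where R: "R > 0" "\<And>v m. m \<ge> 0 \<Longrightarrow> (\<And>i. i < s \<Longrightarrow> \<bar>v i\<bar> \<le> m) \<Longrightarrow> norm (combine v) \<le> R * m"
    using combine_bound by blast
  \<comment> \<open>1 for the rounding error and \<open>B * R\<close> for
    \<open>lin (x - g)\<close>.\<close>
  define M where "M = 1 + B * R"
  define S where "S = cball (0::'a) R \<times> {y \<in> topspace (E n). \<forall>k<n. y k \<in> {-M..M}}"
  have "compactin ?P S" unfolding S_def compactin_Times using compactin_E_cube by simp
  then have "compactin ?Y (coset ` S)" using quotient_imp_continuous_map[OF q] by (rule image_compactin)
  moreover have "coset ` S = topspace ?Y"
  proof -
    have sub: "coset ` S \<subseteq> coset ` topspace ?P" by (rule image_mono) (auto simp: S_def)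
    have sup: "coset p \<in> coset ` S" if p: "p \<in> topspace ?P" for p
    proof -
      obtain x y where xy: "p = (x, y)" "y \<in> topspace (E n)" using p by (cases p) auto
      obtain y' where y': "y' \<in> kern" "select y' = y" using select_surj[OF xy(2)] by blast
      define v where "v = (\<lambda>i. lin x i + y' i)"
      define k where "k = (\<lambda>i. of_int \<lfloor>v i\<rfloor> :: real)"
      define g where "g = combine k"
      have k: "k i \<in> \<int>" for i unfolding k_def by simp
      have g: "g \<in> L" "\<And>i. i < s \<Longrightarrow> coord g i = k i" unfolding g_def using coord_surj[of k, OF k] by auto
      have vk: "\<bar>v i - k i\<bar> \<le> 1" for i unfolding k_def by linarith
      have "combine v = x" unfolding v_def combine_add combine_lin using y'(1) unfolding kern_def by simp
      then have xg: "x - g = combine (\<lambda>i. v i - k i)" unfolding combine_diff g_def by simp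
      have norm_xg: "norm (x - g) \<le> R" using R(2)[of 1 "\<lambda>i. v i - k i"] vk unfolding xg by simp
      have "\<bar>y' i - star g i\<bar> \<le> M" if "i < s" for i
      proof -
        have "y' i - star g i = (v i - k i) - lin (x - g) i"
          using g(2)[OF that] unfolding v_def star_def lin_diff by simp
        moreover have "\<bar>lin (x - g) i\<bar> \<le> B * R"
          using B(2)[of "x - g" i] mult_left_mono[OF norm_xg, of B] B(1) by linarith
        ultimately show ?thesis using vk[of i] unfolding M_def by linarith
      qed
      then have "\<bar>y k - sigma g k\<bar> \<le> M" if "k < n" for k
        using that e_less unfolding y'(2)[symmetric] sigma_def select_def by simp
      then have "y k - sigma g k \<in> {-M..M}" if "k < n" for k using that by (simp only: abs_le_iff atLeastAtMost_iff) fastforce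
      moreover have "(\<lambda>i. y i - sigma g i) \<in> topspace (E n)"
        using xy(2) select_E[of "star g"] unfolding sigma_def by (simp add: mem_E)
      ultimately have mem: "(x - g, \<lambda>i. y i - sigma g i) \<in> S" unfolding S_def using norm_xg by simp
      have "coset p = coset (x - g, \<lambda>i. y i - sigma g i)" unfolding xy(1) by (rule coset_shift[OF g(1)])
      then show ?thesis using mem by (rule image_eqI)
    qed
    have "coset ` S = coset ` topspace ?P" by (rule antisym[OF sub image_subsetI[OF sup]])
    also have "\<dots> = topspace ?Y" by (rule quotient_imp_surjective_map[OF q])
    finally show ?thesis .
  qed
  ultimately show ?thesis unfolding compact_space_def by simp
qed

lemma sigma_dense:
  assumes star_dense "v \<in> kern" "\<epsilon> > 0"
  shows "\<exists>\<gamma>\<in>L. (\<forall>i<s. \<bar>star \<gamma> i - v i\<bar> < \<epsilon>) \<and> sigma \<gamma> \<in> box n (select v) \<epsilon>"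
proof -
  obtain \<gamma> where \<gamma>: "\<gamma> \<in> L" "\<forall>i<s. \<bar>star \<gamma> i - v i\<bar> < \<epsilon>" using assms unfolding star_dense_def by blast
  then show ?thesis unfolding sigma_def using select_in_box by blast
qed

lemma cps:
  assumes star_dense shows "euclidean_cps n L sigma"
proof -
  have "E n closure_of (sigma ` L) = topspace (E n)"
  proof (intro equalityI subsetI closure_of_subset_topspace[THEN subsetD])
    fix y assume y: "y \<in> topspace (E n)"
    obtain v where v: "v \<in> kern" "select v = y" using select_surj[OF y] by blast
    show "y \<in> E n closure_of (sigma ` L)"
      unfolding closure_of_E_box using y sigma_dense[OF assms v(1)] unfolding v(2) by blast
  qed
  then show ?thesis
    unfolding euclidean_cps_def Let_def
    using n_pos countable_L group_closure.diff sigma_add graph_discrete graph_cocompact select_E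
    by (auto simp: sigma_def)
qed

section \<open>The window of the constructed scheme\<close>

definition win :: "(nat \<Rightarrow> real) set"
  where "win = (\<lambda>A. select (cobound A)) ` \<Xi>"

lemma win_point: "x \<in> \<Lambda> \<Longrightarrow> sigma x \<in> win"
proof -
  assume x: "x \<in> \<Lambda>"
  have "sigma x = select (cobound (translate \<Lambda> x))"
    by (intro ext) (simp add: sigma_def select_def cobound_point[OF x])
  then show ?thesis unfolding win_def using transversal_translate[OF base_transversal x] by blast
qed

lemma win_compact: "compactin (E n) win"
proof -
  have "continuous_map patch_topology (E n) (\<lambda>f. select (cobound (Collect f)))"
  proof (rule continuous_map_into_E)
    fix k assume "k < n"
    then show "continuous_map patch_topology euclideanreal (\<lambda>f. select (cobound (Collect f)) k)"
      unfolding select_def using patch_continuous_continuous_map[OF patch_continuous_cobound] by simp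
  qed (simp add: select_def)
  then have "compactin (E n) ((\<lambda>f. select (cobound (Collect f))) ` {f. Collect f \<in> \<Xi>})"
    using compact_patch_topology unfolding compact_space_def topspace_patch_topology by (metis image_compactin)
  moreover have "(\<lambda>f. select (cobound (Collect f))) ` {f. Collect f \<in> \<Xi>} = win"
  proof -
    have "select (cobound A) \<in> (\<lambda>f. select (cobound (Collect f))) ` {f. Collect f \<in> \<Xi>}" if "A \<in> \<Xi>" for A
      using that by (intro image_eqI[of _ _ "\<lambda>x. x \<in> A"]) auto
    then show ?thesis unfolding win_def by auto
  qed
  ultimately show ?thesis by simp
qed

lemma win_closed: "closedin (E n) win"
  using compactin_imp_closedin[OF Hausdorff_Euclidean_space win_compact] .

text \<open>Elements of \<open>L\<close> with star near \<open>cobound A\<close> lie in \<Lambda> by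
  \<open>determined_near\<close>, so their images lie in \<open>win\<close>. These images are dense
  around \<open>select (cobound A)\<close>, and \<open>win\<close> is closed.\<close>

lemma determined_interior:
  assumes star_dense and A: "A \<in> \<Xi>" and det: "determined A"
  shows "select (cobound A) \<in> E n interior_of win"
proof -
  obtain \<delta> where \<delta>: "\<delta> > 0" "\<And>\<gamma>. \<gamma> \<in> L \<Longrightarrow> (\<forall>i<s. \<bar>star \<gamma> i - cobound A i\<bar> < \<delta>) \<Longrightarrow> \<gamma> \<in> \<Lambda>"
    using determined_near[OF A det] by blast
  \<comment> \<open>\<open>K\<close> converts distance in the selected coordinates into distance in
    the kernel; half of \<delta> is left for the approximation by a star.\<close>
  have "box n (select (cobound A)) (\<delta> / (2 * K)) \<subseteq> win"
  proof
    fix y assume y: "y \<in> box n (select (cobound A)) (\<delta> / (2 * K))"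
    then have yE: "y \<in> topspace (E n)" unfolding box_def by blast
    obtain v where v: "v \<in> kern" "select v = y" using select_surj[OF yE] by blast
    have near: "\<bar>v i - cobound A i\<bar> \<le> \<delta> / 2" if "i < s" for i
      using select_box[OF v(1) cobound_kern[OF A] _ that] y K_pos unfolding v(2) by force
    have "y \<in> E n closure_of win"
      unfolding closure_of_E_box
    proof (intro conjI allI impI yE)
      fix \<epsilon> :: real assume "\<epsilon> > 0"
      then have "min \<epsilon> (\<delta> / 2) > 0" using \<delta>(1) by simp
      then obtain \<gamma> where \<gamma>: "\<gamma> \<in> L" "\<forall>i<s. \<bar>star \<gamma> i - v i\<bar> < min \<epsilon> (\<delta> / 2)" "sigma \<gamma> \<in> box n (select v) (min \<epsilon> (\<delta> / 2))"
        using sigma_dense[OF assms(1) v(1)] by blast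
      have "\<gamma> \<in> \<Lambda>"
      proof (rule \<delta>(2)[OF \<gamma>(1)], intro allI impI)
        fix i assume i: "i < s"
        have "\<bar>star \<gamma> i - v i\<bar> < \<delta> / 2" using \<gamma>(2) i by simp
        then show "\<bar>star \<gamma> i - cobound A i\<bar> < \<delta>" using near[OF i] by linarith
      qed
      then have "sigma \<gamma> \<in> win" by (rule win_point)
      moreover have "sigma \<gamma> \<in> box n y \<epsilon>" using \<gamma>(3) unfolding v(2) box_def by simp
      ultimately show "\<exists>y'\<in>win. y' \<in> box n y \<epsilon>" by blast
    qed
    then show "y \<in> win" using win_closed by (simp add: closure_of_closedin)
  qed
  moreover have "\<delta> / (2 * K) > 0" using \<delta>(1) K_pos by simp
  ultimately show ?thesis unfolding interior_of_E_box using select_E by blast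
qed

text \<open>By minimality the translates of \<open>A\<close> by its points come close to every
  member of the transversal, and \<open>determined_interior\<close> applies to each of them.\<close>

lemma window_win:
  assumes dense: star_dense and A: "A \<in> \<Xi>" and det: "determined A"
  shows "window n win"
  unfolding window_def
proof (intro conjI win_compact equalityI subsetI)
  fix y assume "y \<in> win"
  then obtain B where B: "B \<in> \<Xi>" "y = select (cobound B)" unfolding win_def by blast
  show "y \<in> E n closure_of (E n interior_of win)"
    unfolding closure_of_E_box
  proof (intro conjI allI impI)
    show "y \<in> topspace (E n)" unfolding B(2) by (rule select_E)
    fix \<epsilon> :: real assume "\<epsilon> > 0"
    then obtain \<rho> where \<rho>: "\<And>A B i. A \<in> \<Xi> \<Longrightarrow> B \<in> \<Xi> \<Longrightarrow> agree \<rho> A B \<Longrightarrow> i < s \<Longrightarrow> \<bar>cobound A i - cobound B i\<bar> < \<epsilon>"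
      using cobound_modulus by metis
    obtain z where z: "z \<in> A" "agree \<rho> (translate A z) B" using transversal_minimal[of \<rho>] A B(1) by blast
    have "select (cobound (translate A z)) \<in> E n interior_of win"
      by (rule determined_interior[OF dense transversal_translate[OF A z(1)] determined_translate[OF A det z(1)]])
    moreover have "select (cobound (translate A z)) \<in> box n y \<epsilon>"
      unfolding B(2) by (rule select_in_box) (rule \<rho>[OF transversal_translate[OF A z(1)] B(1) z(2)])
    ultimately show "\<exists>y'\<in>E n interior_of win. y' \<in> box n y \<epsilon>" by blast
  qed
next
  fix y assume "y \<in> E n closure_of (E n interior_of win)"
  then have "y \<in> E n closure_of win" by (rule closure_of_mono[OF interior_of_subset, THEN subsetD])
  then show "y \<in> win" using win_closed by (simp add: closure_of_closedin)
qed

text \<open>A hole \<gamma> of \<Lambda> recurs as a hole \<open>\<gamma> + z\<close> of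
  \<open>A\<close>. If its image were interior, some \<open>B\<close> would have the coboundary for
  which \<open>translate B u\<close>, with \<open>u = - (\<gamma> + z)\<close>, must be
  \<open>A\<close>; but this set contains \<open>\<gamma> + z\<close> because
  \<open>0 \<in> B\<close>.\<close>

lemma window_lower:
  assumes A: "A \<in> \<Xi>" and det: "determined A" and \<gamma>: "\<gamma> \<in> L" and int: "sigma \<gamma> \<in> E n interior_of win"
  shows "\<gamma> \<in> \<Lambda>"
proof (rule ccontr)
  assume no: "\<gamma> \<notin> \<Lambda>"
  obtain \<epsilon> where \<epsilon>: "\<epsilon> > 0" "box n (sigma \<gamma>) \<epsilon> \<subseteq> win" using int unfolding interior_of_E_box by blast
  obtain \<rho> where \<rho>: "\<And>A B i. A \<in> \<Xi> \<Longrightarrow> B \<in> \<Xi> \<Longrightarrow> agree \<rho> A B \<Longrightarrow> i < s \<Longrightarrow> \<bar>cobound A i - cobound B i\<bar> < \<epsilon>"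
    using cobound_modulus[OF \<epsilon>(1)] by metis
  obtain z where z: "z \<in> A" "agree (max \<rho> (norm \<gamma>)) (translate A z) \<Lambda>"
    using transversal_minimal[of "max \<rho> (norm \<gamma>)"] A base_transversal by blast
  have zL: "z \<in> L" using transversal_subset_L[OF A] z(1) by blast
  note Az = transversal_translate[OF A z(1)]
  have notin: "\<gamma> + z \<notin> A" using agreeD[OF z(2), of \<gamma>] no by (simp add: mem_translate)
  have small: "\<bar>cobound (translate A z) i\<bar> < \<epsilon>" if "i < s" for i
    using \<rho>[OF Az base_transversal agree_mono[OF z(2)] that] cobound_base by simp
  define v where "v = (\<lambda>i. cobound (translate A z) i + star \<gamma> i)"
  have v: "v \<in> kern" unfolding v_def by (rule kern_add[OF cobound_kern[OF Az] star_kern[OF \<gamma>]])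
  have "select v \<in> box n (sigma \<gamma>) \<epsilon>"
    unfolding sigma_def by (rule select_in_box) (simp add: v_def small)
  then have "select v \<in> win" using \<epsilon>(2) by blast
  then obtain B where B: "B \<in> \<Xi>" "select v = select (cobound B)" unfolding win_def by blast
  \<comment> \<open>\<open>kern_bound\<close> with \<open>m = 0\<close>: the selected coordinates
    determine an element of the kernel.\<close>
  have Bv: "cobound B i = v i" if i: "i < s" for i
  proof -
    have "\<bar>cobound B i - v i\<bar> \<le> K * 0"
    proof (rule kern_bound[OF kern_diff[OF cobound_kern[OF B(1)] v] _ i])
      fix k assume "k < n"
      then show "\<bar>cobound B (e k) - v (e k)\<bar> \<le> 0" using fun_cong[OF B(2), of k] unfolding select_def by simp
    qed
    then show ?thesis by simp
  qed
  define u where "u = - (\<gamma> + z)"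
  have gz: "\<gamma> + z \<in> L" using group_closure_add[OF \<gamma> zL] .
  have uL: "u \<in> L" unfolding u_def group_closure_minus_iff by (rule gz)
  have "cobound B i = cobound A i - star u i" if "i < s" for i
    unfolding Bv[OF that] v_def u_def cobound_translate[OF A z(1)] star_minus[OF gz] star_add[OF \<gamma> zL] by simp
  then have "translate B u = A" using det B(1) uL unfolding determined_def by blast
  moreover have "\<gamma> + z \<in> translate B u" using transversal_zero[OF B(1)] by (simp add: mem_translate u_def)
  ultimately show False using notin by simp
qed

lemma inter_modelI:
  assumes dense: star_dense and A: "A \<in> \<Xi>" and det: "determined A"
  shows "euclidean_inter_model_set \<Lambda>"
proof -
  have cut: "x \<in> translate (cut_project L sigma (\<lambda>_. 0) V) 0 \<longleftrightarrow> x \<in> L \<and> sigma x \<in> V" for x V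
    unfolding mem_translate cut_project_def by simp
  have "translate (cut_project L sigma (\<lambda>_. 0) (E n interior_of win)) 0 \<subseteq> \<Lambda>"
    using window_lower[OF A det] cut by blast
  moreover have "\<Lambda> \<subseteq> translate (cut_project L sigma (\<lambda>_. 0) win) 0"
    using win_point mem_L cut by blast
  moreover have "(\<lambda>_. 0) \<in> topspace (E n)" by (simp add: mem_E)
  moreover have "delone \<Lambda>" using meyer unfolding meyer_def by blast
  ultimately show ?thesis
    unfolding euclidean_inter_model_set_def using cps[OF dense] window_win[OF assms] by blast
qed

end

section \<open>The maximal equicontinuous factor\<close>

text \<open>Two points with the same image under \<open>\<pi>\<close> are proximal: some translation moves their common
  image close to the point with a unique preimage, hence both of them close to this preimage.
  An equicontinuous factor identifies proximal points.\<close>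

lemma maximal_equicontinuous_factorI:
  assumes X: "compact_space X" and Y: "equicontinuous_factor X \<alpha> Y \<beta>" and Hd: "Hausdorff_space Y"
    and act: "\<And>x t. x \<in> topspace X \<Longrightarrow> \<alpha> x t \<in> topspace X"
    and \<pi>: "factor_map X \<alpha> Y \<beta> \<pi>"
    and x0: "x0 \<in> topspace X" "\<And>x. x \<in> topspace X \<Longrightarrow> \<pi> x = \<pi> x0 \<Longrightarrow> x = x0"
    and dense: "\<And>y U. y \<in> topspace Y \<Longrightarrow> openin Y U \<Longrightarrow> \<pi> x0 \<in> U \<Longrightarrow> \<exists>t. \<beta> y t \<in> U"
  shows "maximal_equicontinuous_factor TYPE('z) X \<alpha> Y \<beta>"
  unfolding maximal_equicontinuous_factor_def
proof (intro conjI allI impI Y)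
  fix Z :: "'z topology" and \<gamma>
  assume Z: "equicontinuous_factor X \<alpha> Z \<gamma>"
  obtain \<zeta> where \<zeta>: "factor_map X \<alpha> Z \<gamma> \<zeta>" and Zdyn: "dynamical_system Z \<gamma>" and Zeq: "equicontinuous_action Z \<gamma>"
    using Z unfolding equicontinuous_factor_def topological_factor_def by blast
  have \<pi>_cont: "continuous_map X Y \<pi>" and \<pi>_surj: "\<pi> ` topspace X = topspace Y"
    and \<pi>_eq: "\<And>x t. x \<in> topspace X \<Longrightarrow> \<pi> (\<alpha> x t) = \<beta> (\<pi> x) t"
    using \<pi> unfolding factor_map_def by auto
  have \<zeta>_cont: "continuous_map X Z \<zeta>" and \<zeta>_surj: "\<zeta> ` topspace X = topspace Z"
    and \<zeta>_eq: "\<And>x t. x \<in> topspace X \<Longrightarrow> \<zeta> (\<alpha> x t) = \<gamma> (\<zeta> x) t"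
    using \<zeta> unfolding factor_map_def by auto
  have \<zeta>_in: "\<zeta> x \<in> topspace Z" if "x \<in> topspace X" for x using \<zeta>_surj that by blast
  have \<gamma>_back: "\<gamma> (\<gamma> z t) (- t) = z" if "z \<in> topspace Z" for z t
    using Zdyn that unfolding dynamical_system_def by simp
  obtain m where m: "mtopology_of m = Z"
    and equi: "\<And>\<epsilon>. \<epsilon> > 0 \<Longrightarrow> \<exists>\<delta>>0. \<forall>x \<in> topspace Z. \<forall>y \<in> topspace Z.
         mdist m x y < \<delta> \<longrightarrow> (\<forall>t. mdist m (\<gamma> x t) (\<gamma> y t) < \<epsilon>)"
    using Zeq unfolding equicontinuous_action_def by blast
  interpret M: Metric_space "mspace m" "mdist m" by simp
  have mZ: "M.mtopology = Z" using m unfolding mtopology_of_def .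
  have mspace: "mspace m = topspace Z" using M.topspace_mtopology unfolding mZ by simp
  have fibres: "\<zeta> x = \<zeta> y" if x: "x \<in> topspace X" and y: "y \<in> topspace X" and eq: "\<pi> x = \<pi> y" for x y
  proof (rule ccontr)
    assume ne: "\<zeta> x \<noteq> \<zeta> y"
    then have "mdist m (\<zeta> x) (\<zeta> y) > 0"
      using M.mdist_pos_eq \<zeta>_in[OF x] \<zeta>_in[OF y] unfolding mspace by blast
    then obtain \<delta> where \<delta>: "\<delta> > 0" "\<And>a b t. a \<in> topspace Z \<Longrightarrow> b \<in> topspace Z \<Longrightarrow> mdist m a b < \<delta> \<Longrightarrow>
        mdist m (\<gamma> a t) (\<gamma> b t) < mdist m (\<zeta> x) (\<zeta> y)"
      using equi by meson
    define V where "V = {x \<in> topspace X. \<zeta> x \<in> M.mball (\<zeta> x0) (\<delta> / 2)}"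
    have "openin Z (M.mball (\<zeta> x0) (\<delta> / 2))" using M.openin_mball unfolding mZ .
    then have V: "openin X V" unfolding V_def by (rule openin_continuous_map_preimage[OF \<zeta>_cont])
    have "\<zeta> x0 \<in> mspace m" unfolding mspace by (rule \<zeta>_in[OF x0(1)])
    then have "x0 \<in> V" unfolding V_def using x0(1) \<delta>(1) by simp
    \<comment> \<open>Open since \<pi> is a closed map; every point that \<pi> sends into it lies in
      \<open>V\<close>. It contains \<open>\<pi> x0\<close> because the fibre through
      \<open>x0\<close> is a single point.\<close>
    define U where "U = topspace Y - \<pi> ` (topspace X - V)"
    have "closedin Y (\<pi> ` (topspace X - V))"
      using continuous_imp_closed_map[OF \<pi>_cont X Hd] V unfolding closed_map_def by blast
    then have "openin Y U" unfolding U_def by (rule openin_diff[OF openin_topspace])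
    moreover have "\<pi> x0 \<in> U"
    proof -
      have "\<pi> x0 \<notin> \<pi> ` (topspace X - V)"
      proof
        assume "\<pi> x0 \<in> \<pi> ` (topspace X - V)"
        then obtain x' where x': "\<pi> x0 = \<pi> x'" "x' \<in> topspace X - V" by (rule imageE)
        have "x' = x0" by (rule x0(2)) (use x' in auto)
        then show False using x'(2) \<open>x0 \<in> V\<close> by simp
      qed
      moreover have "\<pi> x0 \<in> topspace Y" unfolding \<pi>_surj[symmetric] using x0(1) by (rule imageI)
      ultimately show ?thesis unfolding U_def by (rule DiffI[rotated])
    qed
    moreover have "\<pi> x \<in> topspace Y" unfolding \<pi>_surj[symmetric] using x by (rule imageI)
    ultimately obtain t where t: "\<beta> (\<pi> x) t \<in> U" using dense[of "\<pi> x" U] by blast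
    have inV: "\<alpha> z t \<in> V" if "z \<in> topspace X" "\<pi> z = \<pi> x" for z
    proof (rule ccontr)
      assume "\<alpha> z t \<notin> V"
      then have "\<pi> (\<alpha> z t) \<in> \<pi> ` (topspace X - V)" using act[OF that(1)] by (intro imageI DiffI)
      then show False using t \<pi>_eq[OF that(1), of t] that(2) unfolding U_def by simp
    qed
    have ball: "\<zeta> (\<alpha> x t) \<in> M.mball (\<zeta> x0) (\<delta> / 2)" "\<zeta> (\<alpha> y t) \<in> M.mball (\<zeta> x0) (\<delta> / 2)"
      using inV[OF x] inV[OF y] eq unfolding V_def by auto
    then have "mdist m (\<zeta> (\<alpha> x t)) (\<zeta> (\<alpha> y t)) \<le> mdist m (\<zeta> (\<alpha> x t)) (\<zeta> x0) + mdist m (\<zeta> x0) (\<zeta> (\<alpha> y t))"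
      by (intro M.triangle) auto
    then have "mdist m (\<zeta> (\<alpha> x t)) (\<zeta> (\<alpha> y t)) < \<delta>"
      using ball M.commute[of "\<zeta> (\<alpha> x t)" "\<zeta> x0"] by simp
    \<comment> \<open>Moving back by \<open>- t\<close>, equicontinuity bounds the distance of
      \<open>\<zeta> x\<close> and \<open>\<zeta> y\<close> strictly by itself.\<close>
    then have "mdist m (\<gamma> (\<zeta> (\<alpha> x t)) (- t)) (\<gamma> (\<zeta> (\<alpha> y t)) (- t)) < mdist m (\<zeta> x) (\<zeta> y)"
      by (intro \<delta>(2) \<zeta>_in act x y)
    then show False unfolding \<zeta>_eq[OF x] \<zeta>_eq[OF y] \<gamma>_back[OF \<zeta>_in[OF x]] \<gamma>_back[OF \<zeta>_in[OF y]] by simp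
  qed
  obtain g where g: "continuous_map Y Z g" "g ` topspace Y = \<zeta> ` topspace X" "\<And>x. x \<in> topspace X \<Longrightarrow> g (\<pi> x) = \<zeta> x"
  proof (rule quotient_map_lift_exists[OF continuous_imp_quotient_map[OF \<pi>_cont X Hd \<pi>_surj] \<zeta>_cont])
    show "\<zeta> x = \<zeta> y" if "x \<in> topspace X" "y \<in> topspace X" "\<pi> x = \<pi> y" for x y using that by (rule fibres)
  qed (rule that)
  have "g (\<beta> y t) = \<gamma> (g y) t" if y: "y \<in> topspace Y" for y t
  proof -
    obtain x where x: "x \<in> topspace X" "y = \<pi> x" using y \<pi>_surj by blast
    show ?thesis unfolding x(2) \<pi>_eq[OF x(1), symmetric] g(3)[OF act[OF x(1)]] g(3)[OF x(1)] by (rule \<zeta>_eq[OF x(1)])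
  qed
  then show "topological_factor Y \<beta> Z \<gamma>"
    unfolding topological_factor_def factor_map_def using g(1,2) \<zeta>_surj by auto
qed

context address_system
begin

text \<open>The difference \<open>v\<close> of two lifts is \<open>lin (combine v)\<close> plus a
  kernel vector. Moving by \<open>combine v\<close> settles the first part; moving by
  \<open>- \<gamma>\<close> adds \<open>- lin \<gamma>\<close>, which modulo integers is
  \<open>star \<gamma>\<close> and approximates the second.\<close>

lemma orbits_dense:
  assumes dense: star_dense and y: "y \<in> topspace (torus s)" and U: "openin (torus s) U" "w \<in> U"
  shows "\<exists>t. address_action \<Lambda> b y t \<in> U"
proof -
  have wT: "w \<in> topspace (torus s)" using U openin_subset by blast
  obtain x where x: "x \<in> topspace (E s)" "y = torus_class s x" using y unfolding topspace_torus by blast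
  obtain z where z: "z \<in> topspace (E s)" "w = torus_class s z" using wT unfolding topspace_torus by blast
  have "openin (torus.mtopology s) U" using U(1) unfolding torus_mtopology .
  then obtain \<epsilon> where e: "\<epsilon> > 0" "torus.mball s w \<epsilon> \<subseteq> U" using U(2) unfolding torus.openin_mtopology by blast
  define v where "v = (\<lambda>i. z i - x i)"
  define k where "k = (\<lambda>i. v i - lin (combine v) i)"
  have "k \<in> kern"
    unfolding kern_def k_def using x(1) z(1) lin_E[of "combine v"] combine_diff[of v "lin (combine v)"] combine_lin
    by (simp add: mem_E v_def)
  moreover have "\<epsilon> / (s + 1) > 0" using e(1) by simp
  ultimately obtain \<gamma> where \<gamma>: "\<gamma> \<in> L" "\<forall>i<s. \<bar>star \<gamma> i - k i\<bar> < \<epsilon> / (s + 1)"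
    using dense unfolding star_dense_def by blast
  define t where "t = combine v - \<gamma>"
  define x' where "x' = (\<lambda>i. x i + lin t i + coord \<gamma> i)"
  have E1: "(\<lambda>i. x i + lin t i) \<in> topspace (E s)" using x(1) lin_E[of t] by (simp add: mem_E)
  have E2: "x' \<in> topspace (E s)" unfolding x'_def using x(1) lin_E[of t] coord_E[of \<gamma>] by (simp add: mem_E)
  have "address_action \<Lambda> b y t = torus_class s (\<lambda>i. x i + lin t i)"
    unfolding address_action_eq x(2) by (rule torus_add_class[OF x(1) lin_E])
  also have "\<dots> = torus_class s x'"
    unfolding torus_class_eq_iff[OF E1 E2] unfolding x'_def using coord_Ints by simp
  finally have act: "address_action \<Lambda> b y t = torus_class s x'" .
  have "torus_dist s w (torus_class s x') \<le> (\<Sum>i<s. \<bar>z i - x' i\<bar>)"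
    unfolding z(2) torus_dist_class[OF z(1) E2] by (rule torus_pre_dist_le)
  also have "\<dots> \<le> (\<Sum>i<s. \<epsilon> / (s + 1))"
  proof (rule sum_mono)
    fix i assume "i \<in> {..<s}"
    then have "\<bar>star \<gamma> i - k i\<bar> < \<epsilon> / (s + 1)" using \<gamma>(2) by simp
    moreover have "z i - x' i = k i - star \<gamma> i"
      unfolding x'_def k_def v_def t_def star_def lin_diff by simp
    ultimately show "\<bar>z i - x' i\<bar> \<le> \<epsilon> / (s + 1)" by linarith
  qed
  also have "\<dots> < \<epsilon>" using e(1) by (simp add: field_simps)
  finally have "torus_class s x' \<in> torus.mball s w \<epsilon>" using wT torus_class_in[OF E2] by simp
  then show ?thesis using act e(2) by (intro exI[of _ t]) auto
qed

lemma address_maximal: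
  assumes dense: star_dense and A: "A \<in> hull_of \<Lambda>" and unique: "\<And>B. B \<in> hull_of \<Lambda> \<Longrightarrow> address B = address A \<Longrightarrow> B = A"
  shows "maximal_equicontinuous_factor TYPE('z) (hull_topology \<Lambda>) translate (address_space \<Lambda>) (address_action \<Lambda> b)"
proof (rule maximal_equicontinuous_factorI[OF compact_hull_topology _ _ _ address_factor_map[OF dense]])
  have action: "address_action \<Lambda> b = (\<lambda>w t. torus_add w (torus_class s (lin t)))"
    by (intro ext) (rule address_action_eq)
  show "equicontinuous_factor (hull_topology \<Lambda>) translate (address_space \<Lambda>) (address_action \<Lambda> b)"
    unfolding equicontinuous_factor_def topological_factor_def
    using torus_rotation[OF lin_E linear_lin] address_factor_map[OF dense] unfolding address_space_def action by blast
  show "Hausdorff_space (address_space \<Lambda>)" unfolding address_space_def by (rule Hausdorff_torus)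
  show "A \<in> topspace (hull_topology \<Lambda>)" using A by (simp add: topspace_hull_topology)
  show "translate B t \<in> topspace (hull_topology \<Lambda>)" if "B \<in> topspace (hull_topology \<Lambda>)" for B t
    using that hull_of_translate by (simp add: topspace_hull_topology)
  show "B = A" if "B \<in> topspace (hull_topology \<Lambda>)" "address B = address A" for B
    using that unique by (simp add: topspace_hull_topology)
  show "\<exists>t. address_action \<Lambda> b y t \<in> U"
    if "y \<in> topspace (address_space \<Lambda>)" "openin (address_space \<Lambda>) U" "address A \<in> U" for y U
    using orbits_dense[OF dense] that unfolding address_space_def by blast
qed

lemma inter_model_iff_address:
  "(euclidean_inter_model_set \<Lambda> \<longleftrightarrow> DIM('a) < s \<and>
      (\<exists>\<pi>. factor_map (hull_topology \<Lambda>) translate (address_space \<Lambda>) (address_action \<Lambda> b) \<pi> \<and>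
           (\<exists>w \<in> topspace (address_space \<Lambda>). \<exists>!A. A \<in> hull_of \<Lambda> \<and> \<pi> A = w)))
    \<and> (euclidean_inter_model_set \<Lambda> \<longrightarrow>
      maximal_equicontinuous_factor TYPE('z) (hull_topology \<Lambda>) translate (address_space \<Lambda>) (address_action \<Lambda> b))"
proof -
  have "DIM('a) < s \<and> star_dense \<and> (\<exists>A\<in>hull_of \<Lambda>. \<forall>B\<in>hull_of \<Lambda>. address B = address A \<longrightarrow> B = A)"
    if im: "euclidean_inter_model_set \<Lambda>"
  proof -
    obtain n \<sigma> W c where "inter_model \<Lambda> b n \<sigma> W c" using inter_model_locale[OF im] by blast
    then interpret inter_model \<Lambda> b n \<sigma> W c .
    show ?thesis
      using rank_gt_dim star_dense nonsingular_exists nonsingular_unique transversal_hull by blast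
  qed
  then have imp: "DIM('a) < s" star_dense "\<exists>A\<in>hull_of \<Lambda>. \<forall>B\<in>hull_of \<Lambda>. address B = address A \<longrightarrow> B = A"
    if "euclidean_inter_model_set \<Lambda>"
    using that by auto
  have converse: "euclidean_inter_model_set \<Lambda>"
    if dim: "DIM('a) < s" and \<pi>: "factor_map (hull_topology \<Lambda>) translate (address_space \<Lambda>) (address_action \<Lambda> b) \<pi>"
      and w: "\<exists>!A. A \<in> hull_of \<Lambda> \<and> \<pi> A = w" for \<pi> w
  proof -
    obtain n e K where "internal_coordinates \<Lambda> b n e K" using internal_coordinates_exist[OF dim] by blast
    then interpret internal_coordinates \<Lambda> b n e K .
    show ?thesis using inter_modelI[OF factor_map_star_dense[OF \<pi>]] factor_map_determined[OF \<pi> w] by blast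
  qed
  have forth: "\<exists>\<pi>. factor_map (hull_topology \<Lambda>) translate (address_space \<Lambda>) (address_action \<Lambda> b) \<pi> \<and>
      (\<exists>w \<in> topspace (address_space \<Lambda>). \<exists>!A. A \<in> hull_of \<Lambda> \<and> \<pi> A = w)" if im: "euclidean_inter_model_set \<Lambda>"
  proof -
    obtain A where A: "A \<in> hull_of \<Lambda>" "\<And>B. B \<in> hull_of \<Lambda> \<Longrightarrow> address B = address A \<Longrightarrow> B = A"
      using imp(3)[OF im] by blast
    show ?thesis
    proof (intro exI[of _ address] conjI bexI[of _ "address A"] ex1I[of _ A])
      show "address A \<in> topspace (address_space \<Lambda>)" unfolding address_space_def by (rule address_in)
    qed (use A address_factor_map[OF imp(2)[OF im]] in auto)
  qed
  have mef: "maximal_equicontinuous_factor TYPE('z) (hull_topology \<Lambda>) translate (address_space \<Lambda>) (address_action \<Lambda> b)"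
    if im: "euclidean_inter_model_set \<Lambda>"
  proof -
    obtain A where A: "A \<in> hull_of \<Lambda>" "\<forall>B\<in>hull_of \<Lambda>. address B = address A \<longrightarrow> B = A" using imp(3)[OF im] by blast
    show ?thesis by (rule address_maximal[OF imp(2)[OF im] A(1)]) (use A(2) in blast)
  qed
  show ?thesis
  proof (intro conjI impI iffI)
    assume im: "euclidean_inter_model_set \<Lambda>"
    show "DIM('a) < s" by (rule imp(1)[OF im])
    show "\<exists>\<pi>. factor_map (hull_topology \<Lambda>) translate (address_space \<Lambda>) (address_action \<Lambda> b) \<pi> \<and>
      (\<exists>w \<in> topspace (address_space \<Lambda>). \<exists>!A. A \<in> hull_of \<Lambda> \<and> \<pi> A = w)" by (rule forth[OF im])
    show "maximal_equicontinuous_factor TYPE('z) (hull_topology \<Lambda>) translate (address_space \<Lambda>) (address_action \<Lambda> b)"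
      by (rule mef[OF im])
  qed (elim conjE exE bexE, rule converse)
qed

end

section \<open>Translation invariance\<close>

lemma difference_set_translate: "difference_set (translate \<Lambda> t) = difference_set \<Lambda>"
proof -
  have sub: "difference_set (translate A u) \<subseteq> difference_set A" for A :: "'a set" and u
  proof
    fix d assume "d \<in> difference_set (translate A u)"
    then obtain x y where "x \<in> translate A u" "y \<in> translate A u" "d = x - y" by (rule difference_setE)
    then show "d \<in> difference_set A" using difference_setI[of "x + u" A "y + u"] by (simp add: mem_translate)
  qed
  show ?thesis using sub[of \<Lambda> t] sub[of "translate \<Lambda> t" "- t"] by simp
qed

lemma hull_of_translate_eq: "hull_of (translate \<Lambda> t) = hull_of \<Lambda>"
proof -
  have "(\<exists>u. agree \<rho> A (translate (translate \<Lambda> t) u)) \<longleftrightarrow> (\<exists>u. agree \<rho> A (translate \<Lambda> u))" for \<rho> A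
    unfolding translate_translate by (metis add.commute diff_add_cancel)
  then show ?thesis unfolding set_eq_iff hull_of_iff by blast
qed

lemma meyer_translate: "meyer \<Lambda> \<Longrightarrow> meyer (translate \<Lambda> t)"
  unfolding meyer_def difference_set_translate using delone_translate by blast

lemma repetitive_translate:
  assumes "repetitive \<Lambda>" shows "repetitive (translate \<Lambda> u)"
  unfolding repetitive_iff translate_translate
proof (intro allI impI)
  fix \<rho> :: real assume "\<rho> > 0"
  then obtain M where M: "M > 0" "\<And>c t. \<exists>t'. norm (t' - c) \<le> M \<and> agree \<rho> (translate \<Lambda> t') (translate \<Lambda> t)"
    using assms unfolding repetitive_iff by blast
  have "\<exists>t'. norm (t' - c) \<le> M \<and> agree \<rho> (translate \<Lambda> (u + t')) (translate \<Lambda> (u + t))" for c t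
  proof -
    obtain t' where "norm (t' - (u + c)) \<le> M" "agree \<rho> (translate \<Lambda> t') (translate \<Lambda> (u + t))" using M(2) by blast
    then show ?thesis by (intro exI[of _ "t' - u"]) (simp add: algebra_simps)
  qed
  then show "\<exists>M>0. \<forall>c t. \<exists>t'. norm (t' - c) \<le> M \<and> agree \<rho> (translate \<Lambda> (u + t')) (translate \<Lambda> (u + t))"
    using M(1) by blast
qed

lemma translate_mono: "A \<subseteq> B \<Longrightarrow> translate A t \<subseteq> translate B t"
  unfolding translate_def by (rule image_mono)

lemma inter_model_translate:
  assumes "euclidean_inter_model_set \<Lambda>" shows "euclidean_inter_model_set (translate \<Lambda> u)"
proof -
  obtain n \<Gamma> \<sigma> W t w where d: "delone \<Lambda>" and cps: "euclidean_cps n \<Gamma> \<sigma>" "window n W" "w \<in> topspace (Euclidean_space n)"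
    and sub: "translate (cut_project \<Gamma> \<sigma> w (Euclidean_space n interior_of W)) t \<subseteq> \<Lambda>"
      "\<Lambda> \<subseteq> translate (cut_project \<Gamma> \<sigma> w W) t"
    using assms unfolding euclidean_inter_model_set_def by blast
  have "translate (cut_project \<Gamma> \<sigma> w (Euclidean_space n interior_of W)) (t + u) \<subseteq> translate \<Lambda> u"
    "translate \<Lambda> u \<subseteq> translate (cut_project \<Gamma> \<sigma> w W) (t + u)"
    using translate_mono[OF sub(1), of u] translate_mono[OF sub(2), of u] unfolding translate_translate .
  then show ?thesis
    unfolding euclidean_inter_model_set_def using delone_translate[OF d] cps by blast
qed

lemma inter_model_translate_iff: "euclidean_inter_model_set (translate \<Lambda> u) \<longleftrightarrow> euclidean_inter_model_set \<Lambda>"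
  using inter_model_translate[of \<Lambda> u] inter_model_translate[of "translate \<Lambda> u" "- u"] by auto

lemma transversal_translate_eq: "transversal (translate \<Lambda> t) = transversal \<Lambda>"
  unfolding transversal_def hull_of_translate_eq ..

lemma hull_topology_translate_eq: "hull_topology (translate \<Lambda> t) = hull_topology \<Lambda>"
  unfolding hull_topology_def hull_nbhd_def hull_of_translate_eq ..

lemma address_translate_eq:
  "address_space (translate \<Lambda> t) = address_space \<Lambda>" "address_action (translate \<Lambda> t) = address_action \<Lambda>"
  unfolding address_space_def address_action_def[abs_def] address_linear_map_def
    difference_set_translate transversal_translate_eq by simp_all

theorem theorem1:
  fixes \<Lambda> :: "(real ^ 'd) set" and b :: "nat \<Rightarrow> real ^ 'd"
  assumes "repetitive \<Lambda>" and "meyer \<Lambda>"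
    and "zbasis (difference_group \<Lambda>) b"
  shows "(euclidean_inter_model_set \<Lambda> \<longleftrightarrow>
      CARD('d) < difference_rank \<Lambda> \<and>
      (\<exists>\<pi>. factor_map (hull_topology \<Lambda>) translate (address_space \<Lambda>) (address_action \<Lambda> b) \<pi> \<and>
           (\<exists>w \<in> topspace (address_space \<Lambda>). \<exists>!\<Lambda>'. \<Lambda>' \<in> hull_of \<Lambda> \<and> \<pi> \<Lambda>' = w)))
    \<and> (euclidean_inter_model_set \<Lambda> \<longrightarrow>
      maximal_equicontinuous_factor TYPE('z) (hull_topology \<Lambda>) translate
        (address_space \<Lambda>) (address_action \<Lambda> b))"
proof -
  obtain x where x: "x \<in> \<Lambda>" using meyerE[OF assms(2)] by metis
  \<comment> \<open>All notions in the statement are invariant under translation of \<Lambda>, so a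
    point of \<Lambda> may be moved to 0.\<close>
  interpret address_system "translate \<Lambda> x" b
    by unfold_locales
      (use assms x in \<open>simp_all add: meyer_translate repetitive_translate mem_translate difference_set_translate\<close>)
  show ?thesis
    using inter_model_iff_address
    unfolding inter_model_translate_iff hull_topology_translate_eq address_translate_eq
      hull_of_translate_eq difference_set_translate DIM_cart DIM_real mult_1_right .
qed

end
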